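(* Consider the symmetric exclusion process on $\mathbb{T}^d_N$ with finite-range translation-invariant symmetric jump probability $p$. Let $\rho_0:\mathbb{T}^d\to[0,1]$ be continuous and start the process from the local equilibrium measure $\mu^N=\prod_{x\in\mathbb{T}^d_N}\mathrm{Bern}(\rho_0(x/N))$. Then, for each $t\ge0$, the empirical measure $\pi^N_{N^2t}$ converges in probability, as $N\to\infty$, to the deterministic measure $\rho(t,u)\,du$, where $\rho(t,u)$ satisfies (in the weak sense) the hydrodynamic equation $$\partial_t\rho(t,u)=\tfrac12\,\triangle_C\,\rho(t,u),\qquad \rho(0,u)=\rho_0(u).$$
   Context: $\mathbb{T}=\mathbb{R}/\mathbb{Z}$, $\mathbb{T}^d_N=(\mathbb{Z}/N\mathbb{Z})^d$. The jump probability $p(x,y)=p(y-x)$ does not depend on $N$, $p(z)=p(-z)$, and $p(z)=0$ for $|z|>R$ for some $R<\infty$. The exclusion process $\eta_t$ on $\{0,1\}^{\mathbb{T}^d_N}$ is the Markov chain with generator $$(Lf)(\eta)=\sum_{x,y\in\mathbb{T}^d_N}\eta(x)(1-\eta(x+y))p(y)\big[f(\eta^{x,x+y})-f(\eta)\big],$$ where $\eta^{a,b}$ is $\eta$ with the values at $a$ and $b$ exchanged. $\triangle_C=\sum_{1\le i,j\le d}C_{i,j}\,\partial^2_{x_i,x_j}$ with $C_{i,j}=\sum_z z_iz_jp(z)$. The empirical measure is $\pi^N_t=N^{-d}\sum_{x\in\mathbb{T}^d_N}\eta_t(x)\delta_{x/N}$, a random element of the space $\mathcal{M}_+(\mathbb{T}^d)$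 of finite nonnegative measures on $\mathbb{T}^d$ with the topology of weak convergence (metrized by $\delta(\mu,\nu)=\sum_k2^{-k}\frac{|\langle\mu,f_k\rangle-\langle\nu,f_k\rangle|}{1+|\langle\mu,f_k\rangle-\langle\nu,f_k\rangle|}$ for a countable dense family $\{f_k\}$ in $C(\mathbb{T}^d)$). Convergence in probability refers to the process started from $\mu^N$. A bounded function $\rho$ is a weak solution if for all $C^2$ functions $G:[0,\infty)\times\mathbb{T}^d\to\mathbb{R}$ and all $t\geq 0$, $\int G(t,u)\rho(t,u)du-\int G(0,u)\rho_0(u)du=\int_0^t\int(\partial_sG+\tfrac12\triangle_CG)(s,u)\rho(s,u)\,du\,ds$; the bounded weak solution is unique. *)

theory Defs
  imports "HOL-Probability.Probability" "HOL-Probability.Product_PMF"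
begin

(* The torus T^d = R^d/Z^d is represented by its universal cover: functions on T^d are
   Z^d-periodic functions on R^d, and measures on T^d are Borel measures carried by the
   fundamental domain [0,1)^d. *)

definition real_vec :: "int ^ 'd \<Rightarrow> real ^ 'd" where
  "real_vec z = (\<chi> i. real_of_int (z $ i))"

definition periodic :: "(real ^ 'd \<Rightarrow> real) \<Rightarrow> bool" where
  "periodic g \<longleftrightarrow> (\<forall>u z. g (u + real_vec z) = g u)"

definition torus_cont :: "(real ^ 'd \<Rightarrow> real) set" where
  "torus_cont = {g. continuous_on UNIV g \<and> periodic g}"

definition unit_cube :: "(real ^ 'd) set" where
  "unit_cube = {u. \<forall>i. 0 \<le> u $ i \<and> u $ i < 1}"


(* (Z/NZ)^d is represented by the residues {0,...,N-1}^d, with addition followed by wrap N. *)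

definition sites :: "nat \<Rightarrow> (int ^ 'd) set" where
  "sites N = {x. \<forall>i. 0 \<le> x $ i \<and> x $ i < int N}"

definition wrap :: "nat \<Rightarrow> int ^ 'd \<Rightarrow> int ^ 'd" where
  "wrap N z = (\<chi> i. z $ i mod int N)"

definition point :: "nat \<Rightarrow> int ^ 'd \<Rightarrow> real ^ 'd" where
  "point N x = (1 / real N) *\<^sub>R real_vec x"

(* True means occupied; sites outside the discrete torus carry the dummy value False,
   as in Pi_pmf. *)
definition configs :: "nat \<Rightarrow> (int ^ 'd \<Rightarrow> bool) set" where
  "configs N = {\<eta>. \<forall>x. x \<notin> sites N \<longrightarrow> \<not> \<eta> x}"

definition exchange :: "('s \<Rightarrow> bool) \<Rightarrow> 's \<Rightarrow> 's \<Rightarrow> ('s \<Rightarrow> bool)" where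
  "exchange \<eta> a b = \<eta>(a := \<eta> b, b := \<eta> a)"

(* The image of p under Z^d -> (Z/NZ)^d is the jump probability on the discrete torus. Once N
   exceeds twice the range of p, it is just p evaluated at the representative nearest to 0. *)
definition exclusion_generator ::
    "(int ^ 'd) pmf \<Rightarrow> nat \<Rightarrow> ((int ^ 'd \<Rightarrow> bool) \<Rightarrow> real) \<Rightarrow> (int ^ 'd \<Rightarrow> bool) \<Rightarrow> real" where
  "exclusion_generator p N F \<eta> =
     (\<Sum>x\<in>sites N. \<Sum>y\<in>sites N.
        of_bool (\<eta> x) * (1 - of_bool (\<eta> (wrap N (x + y)))) * pmf (map_pmf (wrap N) p) y
          * (F (exchange \<eta> x (wrap N (x + y))) - F \<eta>))"


(* The kernel of exp(tA), obtained by applying the exponential series to an indicator. *)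
definition transition_prob :: "(('s \<Rightarrow> real) \<Rightarrow> 's \<Rightarrow> real) \<Rightarrow> real \<Rightarrow> 's \<Rightarrow> 's \<Rightarrow> real" where
  "transition_prob A t \<xi> \<zeta> = (\<Sum>k. t ^ k / fact k * (A ^^ k) (indicator {\<zeta>}) \<xi>)"

(* Meant for a finite state space S, taken with the discrete topology: right continuity and the
   existence of left limits say that paths are eventually constant on either side of a time. *)
definition markov_chain ::
    "'s set \<Rightarrow> (('s \<Rightarrow> real) \<Rightarrow> 's \<Rightarrow> real) \<Rightarrow> 's pmf \<Rightarrow> 'w measure \<Rightarrow> (real \<Rightarrow> 'w \<Rightarrow> 's) \<Rightarrow> bool" where
  "markov_chain S A \<mu> M X \<longleftrightarrow>
     prob_space M \<and>
     (\<forall>t\<ge>0. X t \<in> measurable M (count_space S)) \<and>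
     (AE \<omega> in M. (\<forall>t\<ge>0. \<forall>\<^sub>F s in at_right t. X s \<omega> = X t \<omega>) \<and>
                  (\<forall>t>0. \<exists>\<xi>. \<forall>\<^sub>F s in at_left t. X s \<omega> = \<xi>)) \<and>
     (\<forall>n (s :: nat \<Rightarrow> real) \<xi>.
        s 0 = 0 \<longrightarrow> (\<forall>i<n. s i \<le> s (Suc i)) \<longrightarrow> (\<forall>i\<le>n. \<xi> i \<in> S) \<longrightarrow>
        measure M {\<omega> \<in> space M. \<forall>i\<le>n. X (s i) \<omega> = \<xi> i} =
          pmf \<mu> (\<xi> 0) * (\<Prod>i<n. transition_prob A (s (Suc i) - s i) (\<xi> i) (\<xi> (Suc i))))"

definition local_equilibrium :: "(real ^ 'd \<Rightarrow> real) \<Rightarrow> nat \<Rightarrow> (int ^ 'd \<Rightarrow> bool) pmf" where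
  "local_equilibrium \<rho>\<^sub>0 N = Pi_pmf (sites N) False (\<lambda>x. bernoulli_pmf (\<rho>\<^sub>0 (point N x)))"


definition empirical_measure :: "nat \<Rightarrow> (int ^ 'd \<Rightarrow> bool) \<Rightarrow> (real ^ 'd) measure" where
  "empirical_measure N \<eta> =
     distr (point_measure (sites N) (\<lambda>x. ennreal (of_bool (\<eta> x) / real N ^ CARD('d)))) borel (point N)"

(* ennreal truncates negative values of r, so this is the measure r(u)du for r nonnegative
   almost everywhere; bounded weak solutions below with initial datum in [0,1] are. *)
definition torus_density :: "(real ^ 'd \<Rightarrow> real) \<Rightarrow> (real ^ 'd) measure" where
  "torus_density r = density lborel (\<lambda>u. ennreal (r u) * indicator unit_cube u)"

definition dense_family :: "(nat \<Rightarrow> real ^ 'd \<Rightarrow> real) \<Rightarrow> bool" where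
  "dense_family f \<longleftrightarrow>
     (\<forall>k. f k \<in> torus_cont) \<and>
     (\<forall>g\<in>torus_cont. \<forall>\<epsilon>>0. \<exists>k. \<forall>u. \<bar>f k u - g u\<bar> < \<epsilon>)"

definition weak_dist ::
    "(nat \<Rightarrow> real ^ 'd \<Rightarrow> real) \<Rightarrow> (real ^ 'd) measure \<Rightarrow> (real ^ 'd) measure \<Rightarrow> real" where
  "weak_dist f \<mu> \<nu> =
     (\<Sum>k. (1 / 2) ^ k * (\<bar>(\<integral>u. f k u \<partial>\<mu>) - (\<integral>u. f k u \<partial>\<nu>)\<bar>
                          / (1 + \<bar>(\<integral>u. f k u \<partial>\<mu>) - (\<integral>u. f k u \<partial>\<nu>)\<bar>)))"

definition converges_in_probability ::
    "('b \<Rightarrow> 'b \<Rightarrow> real) \<Rightarrow> (nat \<Rightarrow> 'w measure) \<Rightarrow> (nat \<Rightarrow> 'w \<Rightarrow> 'b) \<Rightarrow> 'b \<Rightarrow> bool" where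
  "converges_in_probability \<delta> M X a \<longleftrightarrow>
     (\<forall>\<epsilon>>0. (\<lambda>N. measure (M N) {\<omega> \<in> space (M N). \<delta> (X N \<omega>) a > \<epsilon>}) \<longlonglongrightarrow> 0)"


definition covariance :: "(int ^ 'd) pmf \<Rightarrow> 'd \<Rightarrow> 'd \<Rightarrow> real" where
  "covariance p i j = (\<Sum>z\<in>set_pmf p. real_of_int (z $ i) * real_of_int (z $ j) * pmf p z)"

definition partial :: "'d \<Rightarrow> (real ^ 'd \<Rightarrow> real) \<Rightarrow> real ^ 'd \<Rightarrow> real" where
  "partial i g u = deriv (\<lambda>h. g (u + h *\<^sub>R axis i 1)) 0"

definition laplacian :: "('d \<Rightarrow> 'd \<Rightarrow> real) \<Rightarrow> (real ^ 'd \<Rightarrow> real) \<Rightarrow> real ^ 'd \<Rightarrow> real" where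
  "laplacian C g u = (\<Sum>i\<in>UNIV. \<Sum>j\<in>UNIV. C i j * partial i (partial j g) u)"

(* Twice continuously differentiable on S, for S of the form [0,\<infinity>) x R^d (one-sided at the boundary):
   D z v and H z v w are the first and second directional derivatives at z. *)
definition C2_on :: "('a::euclidean_space) set \<Rightarrow> ('a \<Rightarrow> real) \<Rightarrow> bool" where
  "C2_on S G \<longleftrightarrow>
     (\<exists>D H. (\<forall>z\<in>S. (G has_derivative D z) (at z within S)) \<and>
            (\<forall>v. \<forall>z\<in>S. ((\<lambda>z. D z v) has_derivative H z v) (at z within S)) \<and>
            (\<forall>v w. continuous_on S (\<lambda>z. H z v w)))"

definition test_function :: "(real \<Rightarrow> real ^ 'd \<Rightarrow> real) \<Rightarrow> bool" where
  "test_function G \<longleftrightarrow>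
     C2_on ({0..} \<times> UNIV) (\<lambda>(s, u). G s u) \<and> (\<forall>s\<ge>0. periodic (G s))"

definition bounded_weak_solution ::
    "('d \<Rightarrow> 'd \<Rightarrow> real) \<Rightarrow> (real ^ 'd \<Rightarrow> real) \<Rightarrow> (real \<Rightarrow> real ^ 'd \<Rightarrow> real) \<Rightarrow> bool" where
  "bounded_weak_solution C \<rho>\<^sub>0 \<rho> \<longleftrightarrow>
     (\<lambda>(t, u). \<rho> t u) \<in> borel_measurable (restrict_space borel ({0..} \<times> UNIV)) \<and>
     (\<forall>t\<ge>0. periodic (\<rho> t)) \<and>
     (\<exists>K. \<forall>t\<ge>0. \<forall>u. \<bar>\<rho> t u\<bar> \<le> K) \<and>
     (\<forall>G. test_function G \<longrightarrow> (\<forall>t\<ge>0.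
        (LINT u:unit_cube|lborel. G t u * \<rho> t u) - (LINT u:unit_cube|lborel. G 0 u * \<rho>\<^sub>0 u) =
        (LINT s:{0..t}|lborel. LINT u:unit_cube|lborel.
           (vector_derivative (\<lambda>r. G r u) (at s within {0..}) + 1 / 2 * laplacian C (G s) u) * \<rho> s u)))"

end

theory Submission
  imports Defs
begin

text \<open>Write \<open>\<pi>(g)\<close> for the integral of \<open>g\<close> against the empirical measure. By the symmetry of
  \<open>p\<close>, the generator maps \<open>\<eta> \<mapsto> \<pi>(g)\<close> to \<open>\<eta> \<mapsto> \<pi>(Pg - g)\<close>, where \<open>P\<close> is the transition operator
  of a single random walk: the exclusion terms cancel in pairs. For a Fourier mode \<open>g\<close> this makes
  \<open>\<pi>(g)\<close> an eigenfunction, with eigenvalue asymptotic to \<open>- rate k / N\<^sup>2\<close>, so its expectation at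
  time \<open>N\<^sup>2 t\<close> is an explicit multiple of a Riemann sum. The squared-gradient term of \<open>\<pi>(g)\<close> is
  \<open>O(N\<^bsup>-d-2\<^esup>)\<close> because a jump changes \<open>\<pi>(g)\<close> by \<open>O(N\<^bsup>-d-1\<^esup>)\<close>, so the variance at that time is
  \<open>O(N\<^bsup>-d\<^esup>)\<close> and Chebyshev's inequality applies. Trigonometric polynomials are dense, which extends
  the convergence to all continuous test functions.

  On the macroscopic side, testing a weak solution with the backward heat flow of a mode determines
  its Fourier coefficients, hence uniqueness. Existence also covers degenerate covariances, where
  Fourier series of the solution need not converge: the Fourier multiplier is a pointwise limit of
  averaging operators (central limit theorem), hence a sup-norm contraction on trigonometric
  polynomials, and extends to continuous data.\<close>

subsection \<open>Continuous functions on the torus\<close>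

text \<open>Cosines with a free phase replace complex exponentials: phase -pi/2 gives the sines, and
  everything stays real. Two obstacles shape the analysis. A general test function has to be paired
  with a mode after applying the Laplacian, and this is done without integration by parts: half the
  Laplacian of g is the bounded limit of N^2 (P_N g - g), where P_N averages over one jump scaled by
  1/N. Since P_N is self-adjoint and modes are its eigenfunctions, the pairing is known exactly
  before the limit. Self-adjointness asks only for invariance of the integral under shifts by
  lattice points, and that is visible on Riemann sums. The variance is controlled without
  martingales. For an eigenfunction F of the generator, the second moment satisfies a scalar
  differential inequality whose solution is compared with the square of the explicitly known mean.
  The law of the pair (X_0, X_t) is all that this uses of the process.\<close>

definition mode :: "int ^ 'd \<Rightarrow> real \<Rightarrow> real ^ 'd \<Rightarrow> real" where
  "mode k a u = cos (2 * pi * (real_vec k \<bullet> u) + a)"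

lemma real_vec_add: "real_vec (x + y) = real_vec x + real_vec y"
  and real_vec_minus: "real_vec (- x) = - real_vec x"
  and real_vec_diff: "real_vec (x - y) = real_vec x - real_vec y"
  and real_vec_zero [simp]: "real_vec 0 = 0"
  and real_vec_nth [simp]: "real_vec x $ i = real_of_int (x $ i)"
  by (simp_all add: real_vec_def vec_eq_iff)

lemma inner_real_vec: "real_vec k \<bullet> real_vec z = real_of_int (\<Sum>i\<in>UNIV. k $ i * z $ i)"
  by (simp add: inner_vec_def)

lemma cos_add_2pi_int: "cos (x + 2 * pi * real_of_int n) = cos x"
  by (simp add: cos_add)

lemma mode_periodic: "mode k a (u + real_vec z) = mode k a u"
  using cos_add_2pi_int[of "2 * pi * (real_vec k \<bullet> u) + a" "\<Sum>i\<in>UNIV. k $ i * z $ i"]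
  by (simp add: mode_def inner_add_right inner_real_vec algebra_simps del: of_int_sum of_int_mult)

lemma abs_mode_le: "\<bar>mode k a u\<bar> \<le> 1"
  by (simp add: mode_def)

lemma mode_torus_cont [simp, intro]: "mode k a \<in> torus_cont"
  by (auto simp: torus_cont_def periodic_def mode_periodic) (auto simp: mode_def intro!: continuous_intros)

lemma torus_cont_const [simp, intro]: "(\<lambda>u. c) \<in> torus_cont"
  and torus_cont_add [intro]: "f \<in> torus_cont \<Longrightarrow> g \<in> torus_cont \<Longrightarrow> (\<lambda>u. f u + g u) \<in> torus_cont"
  and torus_cont_diff [intro]: "f \<in> torus_cont \<Longrightarrow> g \<in> torus_cont \<Longrightarrow> (\<lambda>u. f u - g u) \<in> torus_cont"
  and torus_cont_mult [intro]: "f \<in> torus_cont \<Longrightarrow> g \<in> torus_cont \<Longrightarrow> (\<lambda>u. f u * g u) \<in> torus_cont"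
  by (auto simp: torus_cont_def periodic_def intro!: continuous_intros)

lemma torus_cont_shift:
  assumes "f \<in> torus_cont"
  shows "(\<lambda>u. f (u + v)) \<in> torus_cont"
proof -
  have "f (u + real_vec z + v) = f (u + v)" for u z
  proof -
    have "f (u + real_vec z + v) = f ((u + v) + real_vec z)" by (simp add: ac_simps)
    then show ?thesis using assms unfolding torus_cont_def periodic_def by simp
  qed
  moreover have "continuous_on UNIV (\<lambda>u. f (u + v))"
    using assms by (intro continuous_on_compose2[of UNIV f _ "\<lambda>u. u + v"] continuous_intros) (simp_all add: torus_cont_def)
  ultimately show ?thesis by (simp add: torus_cont_def periodic_def)
qed

lemma torus_cont_sum: "(\<And>i. i \<in> I \<Longrightarrow> f i \<in> torus_cont) \<Longrightarrow> (\<lambda>u. \<Sum>i\<in>I. f i u) \<in> torus_cont"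
  by (induction I rule: infinite_finite_induct) auto

lemma torus_cont_prod: "(\<And>i. i \<in> I \<Longrightarrow> f i \<in> torus_cont) \<Longrightarrow> (\<lambda>u. \<Prod>i\<in>I. f i u) \<in> torus_cont"
  by (induction I rule: infinite_finite_induct) auto

lemma torus_cont_measurable: "f \<in> torus_cont \<Longrightarrow> f \<in> borel_measurable borel"
  by (auto simp: torus_cont_def intro: borel_measurable_continuous_onI)

text \<open>Serves twice: subtracting it moves a point into the fundamental domain, and applied to N
  u it yields the site whose grid cell contains u.\<close>

definition int_part :: "real ^ 'd \<Rightarrow> int ^ 'd" where
  "int_part u = (\<chi> i. \<lfloor>u $ i\<rfloor>)"

lemma minus_int_part_unit_cube: "u - real_vec (int_part u) \<in> unit_cube"
proof -
  have "u $ i - real_of_int \<lfloor>u $ i\<rfloor> < 1" for i by linarith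
  then show ?thesis by (simp add: unit_cube_def int_part_def)
qed

lemma periodic_minus: "periodic g \<Longrightarrow> g (u - real_vec z) = g u"
  unfolding periodic_def by (metis diff_add_cancel)

lemma unit_cube_subset: "unit_cube \<subseteq> cbox 0 1"
  by (auto simp: unit_cube_def mem_box_cart less_imp_le)

text \<open>Compactness of the closed cube bounds \<open>g\<close> there, and every point has an
  integer translate in it. The half-open \<open>unit_cube\<close> is not compact, hence
  \<open>cbox 0 1\<close>.\<close>

lemma torus_cont_bounded:
  assumes "g \<in> torus_cont"
  obtains B where "0 \<le> B" "\<And>u. \<bar>g u\<bar> \<le> B"
proof -
  have "compact (g ` cbox 0 1)"
    using assms by (intro compact_continuous_image) (auto simp: torus_cont_def intro: continuous_on_subset)
  then obtain B where B: "\<And>x. x \<in> g ` cbox 0 1 \<Longrightarrow> norm x \<le> B"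
    using compact_imp_bounded bounded_iff by metis
  have "\<bar>g u\<bar> \<le> B" for u
  proof -
    have "g u = g (u - real_vec (int_part u))"
      using assms by (simp add: torus_cont_def periodic_minus)
    moreover have "u - real_vec (int_part u) \<in> cbox 0 1"
      using minus_int_part_unit_cube unit_cube_subset by blast
    ultimately show ?thesis using B by auto
  qed
  moreover from this[of 0] have "0 \<le> B" by linarith
  ultimately show thesis using that by blast
qed

subsection \<open>Integration over the unit cube\<close>

lemma finite_int_box: "finite {z :: int ^ 'd::finite. \<forall>i. z $ i \<in> {a..b}}"
proof -
  have "{z :: int ^ 'd. \<forall>i. z $ i \<in> {a..b}} \<subseteq> (\<lambda>f. \<chi> i. f i) ` (UNIV \<rightarrow>\<^sub>E {a..b} :: ('d \<Rightarrow> int) set)"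
  proof
    fix z :: "int ^ 'd" assume "z \<in> {z. \<forall>i. z $ i \<in> {a..b}}"
    then show "z \<in> (\<lambda>f. \<chi> i. f i) ` (UNIV \<rightarrow>\<^sub>E {a..b})"
      by (intro image_eqI[of _ _ "\<lambda>i. z $ i"]) auto
  qed
  then show ?thesis
    by (rule finite_subset) (intro finite_imageI finite_PiE; simp)
qed

lemma sites_finite [simp, intro]: "finite (sites N :: (int ^ 'd::finite) set)"
  by (rule finite_subset[OF _ finite_int_box[of 0 "int N"]]) (auto simp: sites_def less_imp_le)

text \<open>Half-open cells, so that those indexed by \<open>sites N\<close> tile
  \<open>unit_cube\<close> without gaps or overlaps. The floor description hands over both
  measurability and the index of the cell of a given point.\<close>

definition cell :: "nat \<Rightarrow> int ^ 'd \<Rightarrow> (real ^ 'd) set" where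
  "cell N x = {u. int_part (real N *\<^sub>R u) = x}"

lemma cell_iff:
  assumes "0 < N"
  shows "u \<in> cell N x \<longleftrightarrow> (\<forall>i. point N x $ i \<le> u $ i \<and> u $ i < point N x $ i + 1 / real N)"
proof -
  have "\<lfloor>real N * u $ i\<rfloor> = x $ i \<longleftrightarrow> point N x $ i \<le> u $ i \<and> u $ i < point N x $ i + 1 / real N" for i
    using assms by (simp add: floor_eq_iff point_def field_simps)
  then show ?thesis by (simp add: cell_def int_part_def vec_eq_iff)
qed

lemma measurable_nth_borel [measurable]: "(\<lambda>u :: real ^ 'd. u $ i) \<in> borel_measurable borel"
  by (intro borel_measurable_continuous_onI continuous_intros)

lemma borel_measurable_vec:
  fixes f :: "'a \<Rightarrow> real ^ 'd"
  assumes "\<And>i. (\<lambda>x. f x $ i) \<in> borel_measurable M"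
  shows "f \<in> borel_measurable M"
  unfolding borel_measurable_euclidean_space[of f]
proof
  fix b :: "real ^ 'd" assume "b \<in> Basis"
  then obtain i where "b = axis i 1" by (auto simp: Basis_vec_def)
  then show "(\<lambda>x. f x \<bullet> b) \<in> borel_measurable M"
    using assms[of i] by (simp add: inner_axis)
qed

lemma cell_borel [measurable]: "cell N x \<in> sets borel"
  unfolding cell_def int_part_def vec_eq_iff vec_lambda_beta vector_scaleR_component by measurable

lemma unit_cube_borel [measurable]: "unit_cube \<in> sets borel"
  unfolding unit_cube_def by measurable

lemma unit_cube_eq_cell: "unit_cube = cell 1 0"
  by (auto simp: unit_cube_def cell_def int_part_def vec_eq_iff floor_eq_iff)

text \<open>The cell lies between an open and a closed box of the same volume.\<close>

lemma emeasure_cell: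
  fixes x :: "int ^ 'd"
  assumes "0 < N"
  shows "emeasure lborel (cell N x) = ennreal ((1 / real N) ^ CARD('d))"
proof -
  let ?l = "point N x" and ?r = "point N x + (\<chi> i. 1 / real N)"
  have le: "?l \<bullet> b \<le> ?r \<bullet> b" if "b \<in> Basis" for b
    using that by (auto simp: Basis_vec_def inner_axis)
  have vol: "(\<Prod>b\<in>Basis. (?r - ?l) \<bullet> b) = (1 / real N) ^ CARD('d)"
  proof -
    have "(\<Prod>b\<in>Basis. (?r - ?l) \<bullet> b) = (\<Prod>b\<in>(Basis :: (real ^ 'd) set). 1 / real N)"
      by (intro prod.cong) (auto simp: Basis_vec_def inner_axis)
    then show ?thesis by simp
  qed
  have "box ?l ?r \<subseteq> cell N x" "cell N x \<subseteq> cbox ?l ?r"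
    using assms by (auto simp: cell_iff mem_box_cart less_imp_le)
  then have "emeasure lborel (box ?l ?r) \<le> emeasure lborel (cell N x)"
    "emeasure lborel (cell N x) \<le> emeasure lborel (cbox ?l ?r)"
    by (auto intro!: emeasure_mono)
  with le vol show ?thesis
    by (metis antisym emeasure_lborel_box emeasure_lborel_cbox)
qed

text \<open>Normalised Haar measure of the torus, read in the chosen fundamental domain.\<close>

abbreviation haar :: "(real ^ 'd) measure" where
  "haar \<equiv> restrict_space lborel unit_cube"

lemma space_haar [simp]: "space haar = unit_cube"
  by (simp add: space_restrict_space)

lemma prob_space_haar: "prob_space (haar :: (real ^ 'd) measure)"
proof
  show "emeasure (haar :: (real ^ 'd) measure) (space haar) = 1"
    by (simp add: emeasure_restrict_space unit_cube_eq_cell emeasure_cell)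
qed

interpretation haar: prob_space haar
  by (rule prob_space_haar)

lemma set_integral_unit_cube: "(LINT u:unit_cube|lborel. f u) = integral\<^sup>L haar f" for f :: "_ \<Rightarrow> real"
  by (simp add: integral_restrict_space set_lebesgue_integral_def)

lemma haar_measurable: "f \<in> borel_measurable borel \<Longrightarrow> f \<in> borel_measurable haar"
  by (intro measurable_restrict_space1) simp

lemma haar_integrable_bounded:
  fixes f :: "real ^ 'd \<Rightarrow> real"
  assumes "f \<in> borel_measurable borel" "\<And>u. \<bar>f u\<bar> \<le> B"
  shows "integrable haar f"
  using assms by (intro haar.integrable_const_bound[of _ B] haar_measurable) auto

lemma haar_integrable [intro]: "f \<in> torus_cont \<Longrightarrow> integrable haar f"
  by (meson haar_integrable_bounded torus_cont_bounded torus_cont_measurable)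

lemma int_part_sites:
  assumes "0 < N"
  shows "int_part (real N *\<^sub>R u) \<in> sites N \<longleftrightarrow> u \<in> unit_cube"
  using assms by (auto simp: int_part_def sites_def unit_cube_def le_floor_iff floor_less_iff zero_le_mult_iff)

text \<open>The cells tile the cube and each has mass N^(-d), so a lattice average is literally an
  integral. Used for Riemann sums and, with h = 1, for counting the sites.\<close>

lemma integral_step_function:
  fixes h :: "int ^ 'd \<Rightarrow> real"
  assumes "0 < N"
  shows "(\<integral>u. h (int_part (real N *\<^sub>R u)) \<partial>haar) = (\<Sum>x\<in>sites N. h x) / real N ^ CARD('d)"
proof -
  have "(\<integral>u. h (int_part (real N *\<^sub>R u)) \<partial>haar)
      = (\<integral>u. (\<Sum>x\<in>sites N. h x * indicator (cell N x) u) \<partial>lborel)"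
    unfolding set_integral_unit_cube[symmetric] set_lebesgue_integral_def
  proof (intro Bochner_Integration.integral_cong refl)
    fix u :: "real ^ 'd"
    have "(\<Sum>x\<in>sites N. h x * indicator (cell N x) u)
        = (\<Sum>x\<in>sites N. if x = int_part (real N *\<^sub>R u) then h x else 0)"
      by (intro sum.cong) (auto simp: cell_def indicator_def)
    also have "\<dots> = indicator unit_cube u *\<^sub>R h (int_part (real N *\<^sub>R u))"
      using int_part_sites[OF assms, of u] by (simp add: indicator_def)
    finally show "indicator unit_cube u *\<^sub>R h (int_part (real N *\<^sub>R u))
      = (\<Sum>x\<in>sites N. h x * indicator (cell N x) u)" ..
  qed
  also have "\<dots> = (\<Sum>x\<in>sites N. h x * measure lborel (cell N x))"
    using assms by (subst Bochner_Integration.integral_sum) (auto simp: emeasure_cell less_top[symmetric])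
  also have "\<dots> = (\<Sum>x\<in>sites N. h x) / real N ^ CARD('d)"
    using assms by (simp add: measure_def emeasure_cell sum_divide_distrib power_divide)
  finally show ?thesis .
qed

lemma card_sites: "0 < N \<Longrightarrow> real (card (sites N :: (int ^ 'd) set)) = real N ^ CARD('d)"
  using integral_step_function[of N "\<lambda>_ :: int ^ 'd. 1"] haar.prob_space[where ?'a = 'd] by simp

text \<open>The lattice average is the integral of \<open>g\<close> evaluated at the lower corner of
  the cell of u. As N grows this corner tends to u, and dominated convergence applies with a sup
  bound of \<open>g\<close> as majorant.\<close>

lemma riemann_sum:
  fixes g :: "real ^ 'd \<Rightarrow> real"
  assumes "g \<in> torus_cont"
  shows "(\<lambda>N. (\<Sum>x\<in>sites N. g (point N x)) / real N ^ CARD('d)) \<longlonglongrightarrow> integral\<^sup>L haar g"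
proof -
  obtain B where B: "0 \<le> B" "\<And>u. \<bar>g u\<bar> \<le> B"
    using assms torus_cont_bounded by blast
  have pt: "(\<lambda>N. point N (int_part (real N *\<^sub>R u))) \<longlonglongrightarrow> u" for u :: "real ^ 'd"
  proof (rule vec_tendstoI)
    fix i
    have "(\<lambda>N. real_of_int \<lfloor>real N * u $ i\<rfloor> / real N) \<longlonglongrightarrow> u $ i"
    proof (rule tendsto_sandwich[of "\<lambda>N. u $ i - 1 / real N" _ _ "\<lambda>N. u $ i"])
      show "\<forall>\<^sub>F n in sequentially. u $ i - 1 / real n \<le> real_of_int \<lfloor>real n * u $ i\<rfloor> / real n"
        using eventually_gt_at_top[of 0]
      proof eventually_elim
        case (elim n)
        have "real n * u $ i - 1 \<le> real_of_int \<lfloor>real n * u $ i\<rfloor>" by linarith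
        then have "(real n * u $ i - 1) / real n \<le> real_of_int \<lfloor>real n * u $ i\<rfloor> / real n"
          by (rule divide_right_mono) simp
        with elim show ?case by (simp add: diff_divide_distrib)
      qed
      show "\<forall>\<^sub>F n in sequentially. real_of_int \<lfloor>real n * u $ i\<rfloor> / real n \<le> u $ i"
        using eventually_gt_at_top[of 0]
      proof eventually_elim
        case (elim n)
        have "real_of_int \<lfloor>real n * u $ i\<rfloor> \<le> real n * u $ i" by linarith
        with elim show ?case by (simp add: field_simps)
      qed
      show "(\<lambda>N. u $ i - 1 / real N) \<longlonglongrightarrow> u $ i"
        using tendsto_diff[OF tendsto_const lim_1_over_n, of "u $ i"] by simp
    qed auto
    then show "(\<lambda>N. point N (int_part (real N *\<^sub>R u)) $ i) \<longlonglongrightarrow> u $ i"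
      by (simp add: point_def int_part_def)
  qed
  have "(\<lambda>N. \<integral>u. g (point N (int_part (real N *\<^sub>R u))) \<partial>haar) \<longlonglongrightarrow> integral\<^sup>L haar g"
  proof (rule integral_dominated_convergence[where w = "\<lambda>_. B"])
    fix N
    have "(\<lambda>u :: real ^ 'd. point N (int_part (real N *\<^sub>R u))) \<in> borel_measurable borel"
      by (rule borel_measurable_vec) (simp add: point_def int_part_def)
    then show "(\<lambda>u. g (point N (int_part (real N *\<^sub>R u)))) \<in> borel_measurable haar"
      by (intro haar_measurable measurable_compose[OF _ torus_cont_measurable[OF assms]])
  next
    show "AE x in haar. (\<lambda>N. g (point N (int_part (real N *\<^sub>R x)))) \<longlonglongrightarrow> g x"
      using assms continuous_on_tendsto_compose[OF _ pt, of UNIV g] by (simp add: torus_cont_def)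
  next
    show "g \<in> borel_measurable haar"
      using assms by (intro haar_measurable torus_cont_measurable)
  next
    show "integrable haar (\<lambda>_ :: real ^ 'd. B)" by simp
  next
    show "AE x in haar. norm (g (point N (int_part (real N *\<^sub>R x)))) \<le> B" for N
      using B by simp
  qed
  then show ?thesis
    by (rule Lim_transform_eventually)
       (auto intro!: eventually_mono[OF eventually_gt_at_top[of 0]]
         integral_step_function[of N "\<lambda>y. g (point N y)" for N])
qed

section \<open>Translations of the discrete torus and rational shifts of the integral\<close>

lemma wrap_sites: "0 < N \<Longrightarrow> wrap N z \<in> sites N"
  by (simp add: wrap_def sites_def)

lemma wrap_eq: "x \<in> sites N \<Longrightarrow> wrap N x = x"
  by (simp add: wrap_def sites_def vec_eq_iff)

lemma wrap_add_wrap: "wrap N (x + wrap N y) = wrap N (x + y)" "wrap N (wrap N x + y) = wrap N (x + y)"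
  by (simp_all add: wrap_def vec_eq_iff mod_simps)

lemma bij_betw_wrap_add:
  assumes "0 < N"
  shows "bij_betw (\<lambda>x. wrap N (x + z)) (sites N) (sites N)"
proof (rule bij_betw_byWitness[where f' = "\<lambda>x. wrap N (x - z)"])
  have "wrap N (wrap N (x + z) - z) = wrap N x" "wrap N (wrap N (x - z) + z) = wrap N x" for x
    by (simp_all add: wrap_def vec_eq_iff mod_simps)
  then show "\<forall>a\<in>sites N. wrap N (wrap N (a + z) - z) = a" "\<forall>a\<in>sites N. wrap N (wrap N (a - z) + z) = a"
    by (simp_all add: wrap_eq)
qed (use assms wrap_sites in blast)+

lemma periodic_wrap:
  assumes "periodic g" "0 < N"
  shows "g (point N (wrap N z)) = g (point N z)"
proof -
  define q :: "int ^ 'a" where "q = (\<chi> i. z $ i div int N)"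
  have "z $ i = wrap N z $ i + int N * q $ i" for i
    by (simp add: wrap_def q_def)
  then have "real_of_int (z $ i) = real_of_int (wrap N z $ i) + real N * real_of_int (q $ i)" for i
    by (metis of_int_add of_int_mult of_int_of_nat_eq)
  then have "point N z = point N (wrap N z) + real_vec q"
    using assms(2) by (simp add: point_def vec_eq_iff field_simps)
  with assms show ?thesis by (simp add: periodic_def)
qed

lemma point_add: "point N (x + y) = point N x + point N y"
  by (simp add: point_def real_vec_add scaleR_add_right)

lemma sum_sites_shift:
  assumes "periodic g" "0 < N"
  shows "(\<Sum>x\<in>sites N. g (point N x + point N z)) = (\<Sum>x\<in>sites N. g (point N x))"
proof -
  have "(\<Sum>x\<in>sites N. g (point N x)) = (\<Sum>x\<in>sites N. g (point N (wrap N (x + z))))"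
    using sum.reindex_bij_betw[OF bij_betw_wrap_add[OF assms(2)], of "\<lambda>x. g (point N x)" z] by simp
  also have "\<dots> = (\<Sum>x\<in>sites N. g (point N x + point N z))"
    using assms by (simp add: periodic_wrap point_add)
  finally show ?thesis ..
qed

text \<open>Along the refined grids of mesh 1/(M (n + 1)) the shift \<open>point M z\<close> is
  itself a lattice vector, so it only permutes the terms of each Riemann sum. Rational shifts are
  what averages at scale 1/N produce.\<close>

lemma integral_shift:
  fixes g :: "real ^ 'd \<Rightarrow> real"
  assumes g: "g \<in> torus_cont" and M: "0 < M"
  shows "(\<integral>u. g (u + point M z) \<partial>haar) = integral\<^sup>L haar g"
proof -
  define h where "h = (\<lambda>u. g (u + point M z))"
  have h: "h \<in> torus_cont" unfolding h_def using g by (rule torus_cont_shift)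
  have mono: "strict_mono (\<lambda>n. M * Suc n)"
    using M by (simp add: strict_mono_Suc_iff)
  have eq: "(\<Sum>x\<in>sites (M * Suc n). h (point (M * Suc n) x)) = (\<Sum>x\<in>sites (M * Suc n). g (point (M * Suc n) x))" for n
  proof -
    define w where "w = (\<chi> i. int (Suc n) * z $ i)"
    have "point M z = point (M * Suc n) w"
      unfolding point_def w_def vec_eq_iff
      by (simp only: of_nat_mult vector_scaleR_component real_vec_nth vec_lambda_beta of_int_mult of_int_of_nat_eq) simp
    then show ?thesis
      unfolding h_def using sum_sites_shift[of g "M * Suc n"] g M by (simp add: torus_cont_def)
  qed
  have "(\<lambda>n. (\<Sum>x\<in>sites (M * Suc n). g (point (M * Suc n) x)) / real (M * Suc n) ^ CARD('d)) \<longlonglongrightarrow> integral\<^sup>L haar h"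
    using LIMSEQ_subseq_LIMSEQ[OF riemann_sum[OF h] mono] unfolding comp_def eq .
  moreover have "(\<lambda>n. (\<Sum>x\<in>sites (M * Suc n). g (point (M * Suc n) x)) / real (M * Suc n) ^ CARD('d)) \<longlonglongrightarrow> integral\<^sup>L haar g"
    using LIMSEQ_subseq_LIMSEQ[OF riemann_sum[OF g] mono] unfolding comp_def .
  ultimately show ?thesis unfolding h_def by (rule LIMSEQ_unique)
qed

subsection \<open>Trigonometric polynomials\<close>

text \<open>Generated from scaled modes by sums, so that every linear statement about modes extends
  by rule induction.\<close>

inductive trig_poly :: "(real ^ 'd \<Rightarrow> real) \<Rightarrow> bool" where
  trig_mode: "trig_poly (\<lambda>u. c * mode k a u)"
| trig_add: "trig_poly g \<Longrightarrow> trig_poly h \<Longrightarrow> trig_poly (\<lambda>u. g u + h u)"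

lemma trig_poly_const: "trig_poly (\<lambda>u. c)"
  using trig_mode[of c 0 0] by (simp add: mode_def)

lemma trig_poly_scale: "trig_poly g \<Longrightarrow> trig_poly (\<lambda>u. c * g u)"
proof (induction rule: trig_poly.induct)
  case (trig_mode c' k a)
  show ?case using trig_poly.trig_mode[of "c * c'" k a] by (simp add: mult.assoc)
qed (auto simp: distrib_left intro: trig_poly.trig_add)

lemma mode_mult: "mode k a u * mode l b u = 1 / 2 * mode (k - l) (a - b) u + 1 / 2 * mode (k + l) (a + b) u"
  unfolding mode_def cos_times_cos real_vec_add real_vec_diff by (simp add: inner_add_left inner_diff_left algebra_simps add_divide_distrib)

lemma trig_poly_mult:
  assumes "trig_poly g" "trig_poly h"
  shows "trig_poly (\<lambda>u. g u * h u)"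
  using assms(1)
proof (induction rule: trig_poly.induct)
  case (trig_mode c k a)
  show ?case using assms(2)
  proof (induction rule: trig_poly.induct)
    case (trig_mode c' l b)
    have "trig_poly (\<lambda>u. (c * c') * (1 / 2 * mode (k - l) (a - b) u + 1 / 2 * mode (k + l) (a + b) u))"
      by (intro trig_poly_scale trig_add trig_poly.trig_mode)
    moreover have "(c * c') * (1 / 2 * mode (k - l) (a - b) u + 1 / 2 * mode (k + l) (a + b) u) = c * mode k a u * (c' * mode l b u)" for u
      unfolding mode_mult[symmetric] by simp
    ultimately show ?case by (simp only:)
  qed (auto simp: distrib_left intro: trig_add)
qed (auto simp: distrib_right intro: trig_poly.trig_add)

lemma trig_poly_sum: "finite I \<Longrightarrow> (\<And>i. i \<in> I \<Longrightarrow> trig_poly (f i)) \<Longrightarrow> trig_poly (\<lambda>u. \<Sum>i\<in>I. f i u)"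
  by (induction I rule: finite_induct) (auto intro: trig_poly_const trig_add)

lemma mode_minus_real_vec: "mode k a (u - real_vec z) = mode k a u"
  using mode_periodic[of k a "u - real_vec z" z] by simp

text \<open>The torus as a product of d circles in R^(2d): the first component collects the cosines
  of the coordinates, the second the sines.\<close>

definition torus_embed :: "real ^ 'd \<Rightarrow> (real ^ 'd) \<times> (real ^ 'd)" where
  "torus_embed u = (\<chi> i. mode (axis i 1) 0 u, \<chi> i. mode (axis i 1) (- pi / 2) u)"

lemma real_vec_axis: "real_vec (axis i 1) = axis i 1"
  by (simp add: vec_eq_iff axis_def)

lemma continuous_torus_embed: "continuous_on S torus_embed"
  unfolding torus_embed_def mode_def by (intro continuous_intros)

text \<open>Equal cosine and sine of 2 pi u_i and 2 pi v_i force u_i - v_i to be an integer. So the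
  embedding separates exactly the points of the torus.\<close>

lemma torus_embed_eqD:
  assumes "torus_embed u = torus_embed v" and "periodic g"
  shows "g u = g v"
proof -
  have "\<exists>n. u $ i = v $ i + real_of_int n" for i
  proof -
    have "cos (2 * pi * u $ i) = cos (2 * pi * v $ i)" "sin (2 * pi * u $ i) = sin (2 * pi * v $ i)"
      using assms(1) by (simp_all add: torus_embed_def mode_def vec_eq_iff real_vec_axis inner_axis' cos_diff)
    then have "sin (2 * pi * u $ i) = sin (2 * pi * v $ i) \<and> cos (2 * pi * u $ i) = cos (2 * pi * v $ i)" by simp
    then obtain n where "2 * pi * u $ i = 2 * pi * v $ i + 2 * pi * real_of_int n"
      unfolding sin_cos_eq_iff by (auto simp: mult_ac)
    then have "2 * pi * (u $ i) = 2 * pi * (v $ i + real_of_int n)" by (simp add: algebra_simps)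
    then show ?thesis by auto
  qed
  then obtain n where "\<And>i. u $ i = v $ i + real_of_int (n i)" by metis
  then have "u = v + real_vec (\<chi> i. n i)" by (simp add: vec_eq_iff)
  then show ?thesis using assms(2) by (simp add: periodic_def)
qed

lemma torus_embed_cbox: "\<exists>v\<in>cbox 0 1. torus_embed v = torus_embed u"
proof
  show "torus_embed (u - real_vec (int_part u)) = torus_embed u"
    by (simp add: torus_embed_def vec_eq_iff mode_minus_real_vec)
  show "u - real_vec (int_part u) \<in> cbox 0 1"
    using minus_int_part_unit_cube unit_cube_subset by blast
qed

text \<open>The coordinate functions of the embedding are modes, and the product-to-sum formula
  keeps products of trigonometric polynomials in the class.\<close>

lemma trig_poly_polynomial:
  assumes "real_polynomial_function P"
  shows "trig_poly (\<lambda>u :: real ^ 'd. P (torus_embed u))"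
  using assms
proof (induction rule: real_polynomial_function.induct)
  case (linear f)
  then have lin: "linear f" by (rule bounded_linear.linear)
  have "f (torus_embed u) = (\<Sum>b\<in>Basis. f b * (torus_embed u \<bullet> b))" for u :: "real ^ 'd"
    by (subst euclidean_representation[of "torus_embed u", symmetric])
       (simp add: linear_sum[OF lin] linear_cmul[OF lin] mult.commute)
  moreover have "trig_poly (\<lambda>u :: real ^ 'd. torus_embed u \<bullet> b)" if "b \<in> Basis" for b
  proof -
    from that obtain i where "b = (axis i 1, 0) \<or> b = (0, axis i 1)"
      by (auto simp: Basis_prod_def Basis_vec_def)
    then show ?thesis
      using trig_mode[of 1 "axis i 1" 0] trig_mode[of 1 "axis i 1" "- pi / 2"]
      by (auto simp: torus_embed_def inner_axis)
  qed
  ultimately show ?case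
    by (auto intro!: trig_poly_sum trig_poly_scale)
next
  case (const c)
  show ?case by (rule trig_poly_const)
qed (auto intro: trig_add trig_poly_mult)

text \<open>Stone--Weierstrass on the image of the cube under \<^term>\<open>torus_embed\<close>, through which every
  periodic continuous function factors.\<close>

lemma trig_poly_dense:
  fixes g :: "real ^ 'd \<Rightarrow> real"
  assumes g: "g \<in> torus_cont" and "0 < \<epsilon>"
  obtains q where "trig_poly q" "\<And>u. \<bar>g u - q u\<bar> < \<epsilon>"
proof -
  define K where "K = torus_embed ` (cbox 0 1 :: (real ^ 'd) set)"
  \<comment> \<open>\<open>g\<close> read on the embedded torus. The choice of preimage is
    immaterial, since two preimages differ by an integer vector.\<close>
  define G where "G y = g (SOME u. u \<in> cbox 0 1 \<and> torus_embed u = y)" for y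
  have per: "periodic g" using g by (simp add: torus_cont_def)
  have G: "G (torus_embed u) = g u" for u
  proof -
    obtain v where v: "v \<in> cbox 0 1" "torus_embed v = torus_embed u"
      using torus_embed_cbox by metis
    then have "\<exists>w. w \<in> cbox 0 1 \<and> torus_embed w = torus_embed u" by blast
    then have "torus_embed (SOME w. w \<in> cbox 0 1 \<and> torus_embed w = torus_embed u) = torus_embed u"
      by (metis (mono_tags, lifting) someI_ex)
    then show ?thesis
      unfolding G_def by (rule torus_embed_eqD[OF _ per])
  qed
  have K: "compact K"
    unfolding K_def by (intro compact_continuous_image continuous_torus_embed) auto
  \<comment> \<open>\<open>torus_embed\<close> is a closed map on the compact cube: the preimage of
    a closed set under \<open>G\<close> is the image of a compact set, hence closed.\<close>
  have "continuous_on K G"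
  proof (subst continuous_on_closed_vimage)
    show "closed K" using K by (rule compact_imp_closed)
    show "\<forall>B. closed B \<longrightarrow> closed (G -` B \<inter> K)"
    proof (intro allI impI)
      fix B :: "real set" assume "closed B"
      have "G -` B \<inter> K = torus_embed ` (g -` B \<inter> cbox 0 1)"
        by (auto simp: K_def G)
      moreover have "closed (g -` B \<inter> cbox 0 1)"
        using g \<open>closed B\<close> by (intro closed_Int closed_vimage closed_cbox) (simp_all add: torus_cont_def)
      moreover have "bounded (g -` B \<inter> cbox 0 1)"
        by (intro bounded_Int) auto
      ultimately show "closed (G -` B \<inter> K)"
        by (auto intro!: compact_imp_closed compact_continuous_image continuous_torus_embed simp: compact_eq_bounded_closed)
    qed
  qed
  then obtain P where P: "real_polynomial_function P" "\<And>y. y \<in> K \<Longrightarrow> \<bar>G y - P y\<bar> < \<epsilon>"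
    using Stone_Weierstrass_real_polynomial_function[OF K _ \<open>0 < \<epsilon>\<close>] by blast
  show thesis
  proof
    show "trig_poly (\<lambda>u :: real ^ 'd. P (torus_embed u))"
      using P(1) by (rule trig_poly_polynomial)
    fix u :: "real ^ 'd"
    have "torus_embed u \<in> K" using torus_embed_cbox[of u] unfolding K_def by (metis image_eqI)
    then show "\<bar>g u - P (torus_embed u)\<bar> < \<epsilon>" using P(2) G by metis
  qed
qed

subsection \<open>Densities are determined by periodic continuous functions\<close>

text \<open>The cosine centred at the midpoint, minus its value at the endpoints, is a 1-periodic
  function that on (0,1) is positive exactly between a and b. Multiplying its positive part by n and
  truncating at 1 makes it tend to the indicator.\<close>

lemma cos_bump_limit:
  fixes a b x :: real
  assumes "0 \<le> a" "a < b" "b \<le> 1" "0 < x" "x < 1"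
  shows "(\<lambda>n. min 1 (real n * max 0 (cos (2 * pi * (x - (a + b) / 2)) - cos (pi * (b - a)))))
    \<longlonglongrightarrow> indicator {a<..<b} x"
proof -
  define v where "v = \<bar>x - (a + b) / 2\<bar>"
  define d where "d = cos (2 * pi * (x - (a + b) / 2)) - cos (pi * (b - a))"
  have v: "cos (2 * pi * (x - (a + b) / 2)) = cos (2 * pi * v)"
    by (simp add: v_def abs_if) (metis cos_minus minus_diff_eq mult_minus_right)
  have mono: "cos (2 * pi * s) \<le> cos (2 * pi * r) \<longleftrightarrow> r \<le> s" if "0 \<le> r" "r \<le> 1/2" "0 \<le> s" "s \<le> 1/2" for r s :: real
    using that by (subst cos_mono_le_eq) auto
  have half: "cos (pi * (b - a)) = cos (2 * pi * ((b - a) / 2))" by simp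
  show ?thesis
  proof (cases "x \<in> {a<..<b}")
    case True
    then have "v < (b - a) / 2" by (auto simp: v_def abs_if field_simps)
    moreover have "0 \<le> v" by (simp add: v_def)
    ultimately have "0 < d"
      unfolding d_def v half using mono[of "(b - a) / 2" v] assms by (simp add: not_le)
    then have "(\<lambda>n. min 1 (real n * max 0 d)) \<longlonglongrightarrow> 1"
    proof (intro tendsto_eventually eventually_mono[OF eventually_ge_at_top[of "nat \<lceil>1 / d\<rceil>"]])
      fix n assume "nat \<lceil>1 / d\<rceil> \<le> n"
      then have "1 / d \<le> real n" by linarith
      with \<open>0 < d\<close> show "min 1 (real n * max 0 d) = 1" by (simp add: field_simps min_def)
    qed
    with True show ?thesis by (simp add: d_def)
  next
    case False
    then have v1: "(b - a) / 2 \<le> v" "v \<le> 1 - (b - a) / 2"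
      using assms by (auto simp: v_def abs_if field_simps)
    have "d \<le> 0"
    proof (cases "v \<le> 1/2")
      case True
      then show ?thesis unfolding d_def v half using mono[of "(b - a) / 2" v] assms v1 by simp
    next
      case False
      \<comment> \<open>Beyond half a period the cosine increases again; the reflection v to 1 - v
        returns to the range where it is monotone.\<close>
      have "cos (2 * pi * v) = cos (2 * pi * (1 - v))"
        by (simp add: right_diff_distrib cos_diff)
      moreover have "v \<le> 1" "b - a \<le> 2 - v * 2" using v1 assms by argo+
      ultimately show ?thesis unfolding d_def v half using mono[of "(b - a) / 2" "1 - v"] assms v1 False by simp
    qed
    with False show ?thesis by (simp add: d_def)
  qed
qed

text \<open>The open cube already has volume 1, so the faces are null. Points on faces have to be
  avoided because periodic bumps cannot tell 0 from 1.\<close>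

lemma AE_haar_box: "AE u in (haar :: (real ^ 'd) measure). u \<in> box 0 1"
proof -
  have box: "box 0 1 \<subseteq> (unit_cube :: (real ^ 'd) set)"
    by (auto simp: unit_cube_def mem_box_cart less_imp_le)
  have one: "(1 :: real ^ 'd) \<bullet> b = 1" if "b \<in> Basis" for b
    using that by (auto simp: Basis_vec_def inner_axis)
  have "emeasure lborel (box 0 1 :: (real ^ 'd) set) = 1"
    by (subst emeasure_lborel_box) (auto simp: one)
  then have "haar.prob (box 0 1 :: (real ^ 'd) set) = 1"
    using box by (simp add: measure_def emeasure_restrict_space)
  then show ?thesis
    using box by (subst haar.prob_eq_1[symmetric]) (auto simp: sets_restrict_space_iff)
qed

text \<open>Adding \<open>B\<close> makes both densities nonnegative, so they define finite
  measures. Continuous periodic bumps approximate indicators of boxes boundedly, hence the measures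
  agree on boxes, which form an intersection-stable generator of the Borel sets.\<close>

lemma haar_AE_unique:
  fixes r s :: "real ^ 'd \<Rightarrow> real"
  assumes [measurable]: "r \<in> borel_measurable borel" "s \<in> borel_measurable borel"
    and B: "\<And>u. \<bar>r u\<bar> \<le> B" "\<And>u. \<bar>s u\<bar> \<le> B"
    and eq: "\<And>g. g \<in> torus_cont \<Longrightarrow> (\<integral>u. g u * r u \<partial>haar) = (\<integral>u. g u * s u \<partial>haar)"
  shows "AE u in haar. r u = s u"
proof -
  define \<nu> where "\<nu> q = density lborel (\<lambda>u. ennreal (B + q u) * indicator unit_cube u)" for q :: "real ^ 'd \<Rightarrow> real"
  have sets_\<nu> [simp]: "sets (\<nu> q) = sets borel" for q by (simp add: \<nu>_def)
  have em: "emeasure (\<nu> q) A = ennreal (\<integral>u. indicator A u * (B + q u) \<partial>haar)"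
    if [measurable]: "q \<in> borel_measurable borel" "A \<in> sets borel" and b: "\<And>u. \<bar>q u\<bar> \<le> B" for q A
  proof -
    have pos: "0 \<le> B + q u" for u using b[of u] by linarith
    have "emeasure (\<nu> q) A = (\<integral>\<^sup>+ u. ennreal (indicator A u * (B + q u)) * indicator unit_cube u \<partial>lborel)"
      unfolding \<nu>_def by (subst emeasure_density) (auto intro!: nn_integral_cong simp: indicator_def)
    also have "\<dots> = (\<integral>\<^sup>+ u. ennreal (indicator A u * (B + q u)) \<partial>haar)"
      by (subst nn_integral_restrict_space) auto
    also have "\<dots> = ennreal (\<integral>u. indicator A u * (B + q u) \<partial>haar)"
    proof (intro nn_integral_eq_integral haar_integrable_bounded[of _ "2 * B"])
      show "\<bar>indicator A u * (B + q u)\<bar> \<le> 2 * B" for u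
        using b[of u] by (auto simp: indicator_def)
    qed (use pos in auto)
    finally show ?thesis .
  qed
  have box: "(\<integral>u. indicator (box a b) u * (B + r u) \<partial>haar) = (\<integral>u. indicator (box a b) u * (B + s u) \<partial>haar)" for a b
  proof -
    \<comment> \<open>The box is clipped to the unit cube, which changes nothing for
      \<open>haar\<close>. If the clipped box is degenerate, both integrals vanish.\<close>
    define a' where "a' = (\<chi> i. max 0 (a $ i))"
    define b' where "b' = (\<chi> i. min 1 (b $ i))"
    show ?thesis
    proof (cases "\<forall>i. a' $ i < b' $ i")
      case True
      define g where "g n u = (\<Prod>i\<in>UNIV. min 1 (real n * max 0 (cos (2 * pi * (u $ i - (a' $ i + b' $ i) / 2)) - cos (pi * (b' $ i - a' $ i)))))" for n and u :: "real ^ 'd"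
      have g: "g n \<in> torus_cont" for n
        unfolding g_def
      proof (rule torus_cont_prod)
        fix i :: 'd
        have "cos (2 * pi * (w + real_of_int m - c)) = cos (2 * pi * (w - c))" for w c m
          using cos_add_2pi_int[of "2 * pi * (w - c)" m] by (simp add: algebra_simps)
        then show "(\<lambda>u. min 1 (real n * max 0 (cos (2 * pi * (u $ i - (a' $ i + b' $ i) / 2)) - cos (pi * (b' $ i - a' $ i))))) \<in> torus_cont"
          unfolding torus_cont_def periodic_def by (auto intro!: continuous_intros)
      qed
      have g01: "0 \<le> g n u" "g n u \<le> 1" for n u
        unfolding g_def by (auto intro!: prod_nonneg prod_le_1)
      have lim: "(\<lambda>n. \<integral>u. g n u * (B + q u) \<partial>haar) \<longlonglongrightarrow> (\<integral>u. indicator (box a b) u * (B + q u) \<partial>haar)"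
        if [measurable]: "q \<in> borel_measurable borel" and b: "\<And>u. \<bar>q u\<bar> \<le> B" for q
      proof (rule integral_dominated_convergence[where w = "\<lambda>_. 2 * B"])
        show "(\<lambda>u. indicator (box a b) u * (B + q u)) \<in> borel_measurable haar"
          by (intro haar_measurable) measurable
        show "(\<lambda>u. g n u * (B + q u)) \<in> borel_measurable haar" for n
          using torus_cont_measurable[OF g[of n]] that(1)
          by (intro haar_measurable borel_measurable_times borel_measurable_add) auto
        have "\<bar>B + q u\<bar> \<le> 2 * B" for u using b[of u] by linarith
        then have "\<bar>g n u * (B + q u)\<bar> \<le> 1 * (2 * B)" for n u
          unfolding abs_mult using g01[of n u] by (intro mult_mono) auto
        then show "AE u in haar. norm (g n u * (B + q u)) \<le> 2 * B" for n by simp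
        show "AE u in haar. (\<lambda>n. g n u * (B + q u)) \<longlonglongrightarrow> indicator (box a b) u * (B + q u)"
          using AE_haar_box
        proof eventually_elim
          case (elim u)
          have "(\<lambda>n. g n u) \<longlonglongrightarrow> (\<Prod>i\<in>UNIV. indicator {a' $ i<..<b' $ i} (u $ i))"
            unfolding g_def using True elim
            by (intro tendsto_prod cos_bump_limit) (auto simp: mem_box_cart a'_def b'_def)
          also have "(\<Prod>i\<in>UNIV. indicator {a' $ i<..<b' $ i} (u $ i)) = (indicator (box a b) u :: real)"
            using elim by (auto simp: indicator_def mem_box_cart a'_def b'_def)
          finally show ?case by (intro tendsto_intros)
        qed
      qed simp
      have "(\<integral>u. g n u * (B + r u) \<partial>haar) = (\<integral>u. g n u * (B + s u) \<partial>haar)" for n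
      proof -
        have "(\<integral>u. g n u * (B + q u) \<partial>haar) = (\<integral>u. g n u * B \<partial>haar) + (\<integral>u. g n u * q u \<partial>haar)"
          if [measurable]: "q \<in> borel_measurable borel" and b: "\<And>u. \<bar>q u\<bar> \<le> B" for q
        proof -
          have "\<bar>g n u * q u\<bar> \<le> 1 * B" for u
            unfolding abs_mult using g01[of n u] b[of u] by (intro mult_mono) auto
          then have "integrable haar (\<lambda>u. g n u * q u)"
            using torus_cont_measurable[OF g[of n]] by (intro haar_integrable_bounded) auto
          moreover have "integrable haar (\<lambda>u. g n u * B)"
            using g[of n] by (intro haar_integrable torus_cont_mult) auto
          ultimately show ?thesis by (simp add: distrib_left)
        qed
        then show ?thesis using eq[OF g[of n]] B by simp
      qed
      then show ?thesis
        using lim[of r] lim[of s] B by (auto intro: LIMSEQ_unique)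
    next
      case False
      then obtain i where "b' $ i \<le> a' $ i" by (auto simp: not_less)
      have "AE u in haar. indicator (box a b) u = (0 :: real)"
        using AE_haar_box
      proof eventually_elim
        case (elim u)
        have "\<not> (a $ i < u $ i \<and> u $ i < b $ i)"
        proof -
          have "0 < u $ i" "u $ i < 1" using elim by (auto simp: mem_box_cart)
          then show ?thesis
            using \<open>b' $ i \<le> a' $ i\<close> by (auto simp: a'_def b'_def min_def max_def split: if_splits)
        qed
        then have "u \<notin> box a b" unfolding mem_box_cart by blast
        then show ?case by simp
      qed
      then have "(\<integral>u. indicator (box a b) u * (B + q u) \<partial>haar) = 0" for q :: "real ^ 'd \<Rightarrow> real"
        by (intro integral_eq_zero_AE) (auto elim: eventually_mono)
      then show ?thesis by simp
    qed
  qed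
  have "\<nu> r = \<nu> s"
  proof (rule measure_eqI_generator_eq)
    let ?E = "range (\<lambda>(a, b). box a b :: (real ^ 'd) set)"
    show "Int_stable ?E"
      by (auto simp: Int_stable_def box_Int_box)
    show "?E \<subseteq> Pow UNIV" "sets (\<nu> r) = sigma_sets UNIV ?E" "sets (\<nu> s) = sigma_sets UNIV ?E"
      by (simp_all add: borel_eq_box)
    let ?A = "\<lambda>n :: nat. box (- (real n *\<^sub>R One)) (real n *\<^sub>R One) :: (real ^ 'd) set"
    show "range ?A \<subseteq> ?E" "(\<Union>i. ?A i) = UNIV"
      unfolding UN_box_eq_UNIV by auto
    show "emeasure (\<nu> r) (?A i) \<noteq> \<infinity>" for i using em[of r] B by simp
    show "emeasure (\<nu> r) X = emeasure (\<nu> s) X" if "X \<in> ?E" for X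
      using that box em[of r] em[of s] B by auto
  qed
  then have "AE u in lborel. ennreal (B + r u) * indicator unit_cube u = ennreal (B + s u) * indicator unit_cube u"
    unfolding \<nu>_def by (subst (asm) sigma_finite_measure.density_unique_iff[OF sigma_finite_lborel]) auto
  then have "AE u in lborel. u \<in> unit_cube \<longrightarrow> r u = s u"
  proof eventually_elim
    case (elim u)
    have "0 \<le> B + r u" "0 \<le> B + s u" using B(1)[of u] B(2)[of u] by linarith+
    with elim show ?case by (auto simp: indicator_def)
  qed
  then show ?thesis by (subst AE_restrict_space_iff) auto
qed

subsection \<open>The heat flow on trigonometric polynomials\<close>

text \<open>From 1 - cos(a h) = 2 sin(a h / 2)^2 and the derivative of the sine at 0.\<close>

lemma tendsto_one_minus_cos:
  "((\<lambda>h. (1 - cos (a * h)) / h\<^sup>2) \<longlongrightarrow> a\<^sup>2 / 2) (at (0 :: real))"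
proof -
  have "((\<lambda>h. sin (a / 2 * h)) has_real_derivative a / 2) (at 0)"
    by (auto intro!: derivative_eq_intros)
  then have "((\<lambda>h. sin (a / 2 * h) / h) \<longlongrightarrow> a / 2) (at 0)"
    by (simp add: DERIV_def)
  then have "((\<lambda>h. 2 * (sin (a / 2 * h) / h)\<^sup>2) \<longlongrightarrow> 2 * (a / 2)\<^sup>2) (at 0)"
    by (intro tendsto_mult[OF tendsto_const] tendsto_power)
  moreover have "2 * (sin (a / 2 * h) / h)\<^sup>2 = (1 - cos (a * h)) / h\<^sup>2" for h
    using cos_double_sin[of "a / 2 * h"] by (simp add: power_divide)
  ultimately have "((\<lambda>h. (1 - cos (a * h)) / h\<^sup>2) \<longlongrightarrow> 2 * (a / 2)\<^sup>2) (at 0)"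
    by (simp only:)
  then show ?thesis by (simp add: power_divide)
qed

text \<open>Taylor expansion with Lagrange remainder on each side of 0; the first-order terms cancel
  in the sum. Two intermediate points remain, one per side, which is just as good once h tends to
  0.\<close>

lemma second_difference:
  fixes \<phi> \<phi>' \<phi>'' :: "real \<Rightarrow> real"
  assumes "\<And>x. (\<phi> has_real_derivative \<phi>' x) (at x)" "\<And>x. (\<phi>' has_real_derivative \<phi>'' x) (at x)" and "0 < h"
  obtains x y where "\<bar>x\<bar> \<le> h" "\<bar>y\<bar> \<le> h" "\<phi> h + \<phi> (- h) - 2 * \<phi> 0 = h\<^sup>2 / 2 * (\<phi>'' x + \<phi>'' y)"
proof -
  define d where "d m = (if m = 0 then \<phi> else if m = 1 then \<phi>' else \<phi>'')" for m :: nat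
  have d: "\<forall>m t. m < 2 \<and> - h \<le> t \<and> t \<le> h \<longrightarrow> DERIV (d m) t :> d (Suc m) t"
    using assms by (auto simp: d_def less_2_cases_iff)
  have ex: "\<exists>t. (if x < 0 then x < t \<and> t < 0 else 0 < t \<and> t < x) \<and>
      \<phi> x = (\<Sum>m<2. d m 0 / fact m * (x - 0) ^ m) + d 2 t / fact 2 * (x - 0) ^ 2"
    if "- h \<le> x" "x \<le> h" "x \<noteq> 0" for x
    by (rule Taylor[OF _ _ d]) (use that assms(3) in \<open>auto simp: d_def\<close>)
  obtain x where "0 < x" "x < h" "\<phi> h = \<phi> 0 + \<phi>' 0 * h + \<phi>'' x / 2 * h\<^sup>2"
    using ex[of h] assms(3) by (auto simp: d_def numeral_2_eq_2)
  moreover obtain y where "- h < y" "y < 0" "\<phi> (- h) = \<phi> 0 - \<phi>' 0 * h + \<phi>'' y / 2 * h\<^sup>2"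
    using ex[of "- h"] assms(3) by (auto simp: d_def numeral_2_eq_2)
  ultimately show thesis using that[of x y] by (auto simp: algebra_simps)
qed

section \<open>Averaging over one jump, its Fourier symbol, and the heat flow of modes\<close>

locale symmetric_jump =
  fixes p :: "(int ^ 'd) pmf"
  assumes symmetric: "\<And>z. pmf p (- z) = pmf p z"
    and finite_support: "finite (set_pmf p)"
begin

lemma sum_pmf_one: "(\<Sum>z\<in>set_pmf p. pmf p z) = 1"
  using finite_support by (simp add: sum_pmf_eq_1)

text \<open>Symmetry of \<open>p\<close> enters all later arguments through this reindexing.\<close>

lemma sum_reflect: "(\<Sum>z\<in>set_pmf p. pmf p z * f (- z)) = (\<Sum>z\<in>set_pmf p. pmf p z * f z)"
proof -
  have "bij_betw uminus (set_pmf p) (set_pmf p)"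
    by (rule bij_betw_byWitness[where f' = uminus]) (auto simp: set_pmf_iff symmetric)
  from sum.reindex_bij_betw[OF this, of "\<lambda>z. pmf p z * f z"]
  show ?thesis by (simp add: symmetric)
qed

text \<open>The eigenvalue of minus one half of the Laplacian with matrix C at the mode k, that is,
  half the quadratic form of C at 2 pi k.\<close>

definition rate :: "int ^ 'd \<Rightarrow> real" where
  "rate k = 2 * pi\<^sup>2 * (\<Sum>z\<in>set_pmf p. pmf p z * (real_vec k \<bullet> real_vec z)\<^sup>2)"

text \<open>Transition operator of the random walk with steps scaled by h. Two scales occur: h = 1/N
  for the lattice, and h = sqrt(t/n) for the central limit theorem.\<close>

definition avg :: "real \<Rightarrow> (real ^ 'd \<Rightarrow> real) \<Rightarrow> real ^ 'd \<Rightarrow> real" where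
  "avg h g u = (\<Sum>z\<in>set_pmf p. pmf p z * g (u + h *\<^sub>R real_vec z))"

text \<open>The characteristic function of \<open>p\<close> at frequency 2 pi h k; only the cosine
  part is kept because symmetry kills the sine part.\<close>

definition char :: "real \<Rightarrow> int ^ 'd \<Rightarrow> real" where
  "char h k = (\<Sum>z\<in>set_pmf p. pmf p z * cos (2 * pi * (real_vec k \<bullet> real_vec z) * h))"

lemma rate_nonneg: "0 \<le> rate k"
  by (auto simp: rate_def intro!: mult_nonneg_nonneg sum_nonneg)

text \<open>The addition formula splits the average into a cosine and a sine sum; the latter is odd
  under reflection of the jump and vanishes.\<close>

lemma avg_mode: "avg h (\<lambda>u. mode k a u) u = char h k * mode k a u"
proof -
  define c where "c z = 2 * pi * (real_vec k \<bullet> real_vec z) * h" for z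
  define b where "b = 2 * pi * (real_vec k \<bullet> u) + a"
  have "(\<Sum>z\<in>set_pmf p. pmf p z * sin (c (- z))) = (\<Sum>z\<in>set_pmf p. pmf p z * sin (c z))"
    by (rule sum_reflect)
  then have sin: "(\<Sum>z\<in>set_pmf p. pmf p z * sin (c z)) = 0"
    by (simp add: c_def real_vec_minus sum_negf)
  have "avg h (mode k a) u = (\<Sum>z\<in>set_pmf p. pmf p z * cos (c z + b))"
    by (auto simp: avg_def mode_def c_def b_def inner_add_right algebra_simps intro!: sum.cong)
  also have "\<dots> = (\<Sum>z\<in>set_pmf p. pmf p z * cos (c z)) * cos b - (\<Sum>z\<in>set_pmf p. pmf p z * sin (c z)) * sin b"
    by (simp add: cos_add right_diff_distrib sum_subtractf sum_distrib_right mult.assoc)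
  also have "\<dots> = char h k * mode k a u"
    unfolding sin by (simp add: char_def c_def mode_def b_def)
  finally show ?thesis by simp
qed

lemma abs_char_le: "\<bar>char h k\<bar> \<le> 1"
proof -
  have "\<bar>char h k\<bar> \<le> (\<Sum>z\<in>set_pmf p. pmf p z * 1)"
    unfolding char_def by (intro order.trans[OF sum_abs] sum_mono) (auto simp: abs_mult intro!: mult_left_le)
  then show ?thesis by (simp add: sum_pmf_one)
qed

lemma tendsto_char: "((\<lambda>h. (1 - char h k) / h\<^sup>2) \<longlongrightarrow> rate k) (at 0)"
proof -
  have eq: "(1 - char h k) / h\<^sup>2 = (\<Sum>z\<in>set_pmf p. pmf p z * ((1 - cos (2 * pi * (real_vec k \<bullet> real_vec z) * h)) / h\<^sup>2))" for h
    by (simp add: char_def right_diff_distrib diff_divide_distrib sum_subtractf sum_divide_distrib[symmetric] sum_pmf_one)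
  have "((\<lambda>h. (1 - char h k) / h\<^sup>2) \<longlongrightarrow> (\<Sum>z\<in>set_pmf p. pmf p z * ((2 * pi * (real_vec k \<bullet> real_vec z))\<^sup>2 / 2))) (at 0)"
    unfolding eq by (intro tendsto_intros tendsto_one_minus_cos)
  also have "(\<Sum>z\<in>set_pmf p. pmf p z * ((2 * pi * (real_vec k \<bullet> real_vec z))\<^sup>2 / 2)) = rate k"
    by (auto simp: rate_def sum_distrib_left power_mult_distrib intro!: sum.cong)
  finally show ?thesis .
qed

lemma tendsto_char_lattice: "(\<lambda>N. (real N)\<^sup>2 * (1 - char (1 / real N) k)) \<longlonglongrightarrow> rate k"
proof -
  have "filterlim (\<lambda>N. 1 / real N) (at 0) sequentially"
    by (auto simp: filterlim_at lim_1_over_n intro: eventually_mono[OF eventually_gt_at_top[of 0]])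
  from filterlim_compose[OF tendsto_char this] show ?thesis
    by (simp add: power_divide mult.commute)
qed

text \<open>For numbers of modulus at most 1, the difference of n-th powers is at most n times the
  difference of the bases. The base \<open>char (sqrt (t / real n)) k\<close> and exp(- rate t / n)
  agree up to o(1/n), and the n-th power of the second is the limit itself. At t = 0 the punctured
  limit at 0 is not applicable, hence the case split.\<close>

lemma tendsto_char_power:
  assumes "0 \<le> t"
  shows "(\<lambda>n. char (sqrt (t / real n)) k ^ n) \<longlonglongrightarrow> exp (- rate k * t)"
proof (cases "t = 0")
  case True
  then show ?thesis by (simp add: char_def sum_pmf_one)
next
  case False
  with assms have t: "0 < t" by simp
  define x where "x n = char (sqrt (t / real n)) k" for n
  define y where "y n = exp (- rate k * t / real n)" for n
  have lim0: "(\<lambda>n. t / real n) \<longlonglongrightarrow> 0" by (rule lim_const_over_n)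
  then have "(\<lambda>n. sqrt (t / real n)) \<longlonglongrightarrow> 0"
    using tendsto_real_sqrt by fastforce
  then have "filterlim (\<lambda>n. sqrt (t / real n)) (at 0) sequentially"
    using t by (auto simp: filterlim_at intro: eventually_mono[OF eventually_gt_at_top[of 0]])
  from tendsto_mult[OF tendsto_const[of t] filterlim_compose[OF tendsto_char this], of k]
  have "(\<lambda>n. t * ((1 - x n) / (sqrt (t / real n))\<^sup>2)) \<longlonglongrightarrow> t * rate k"
    by (simp add: x_def)
  then have 1: "(\<lambda>n. real n * (1 - x n)) \<longlonglongrightarrow> t * rate k"
    using t by (simp add: mult.commute)
  have "((\<lambda>h. exp (- rate k * t * h)) has_real_derivative - rate k * t) (at 0)"
    by (auto intro!: derivative_eq_intros)
  then have "((\<lambda>h. (exp (- rate k * t * h) - 1) / h) \<longlongrightarrow> - rate k * t) (at 0)"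
    by (simp add: DERIV_def)
  moreover have "filterlim (\<lambda>N. 1 / real N) (at 0) sequentially"
    by (auto simp: filterlim_at lim_1_over_n intro: eventually_mono[OF eventually_gt_at_top[of 0]])
  ultimately have "(\<lambda>n. (exp (- rate k * t * (1 / real n)) - 1) / (1 / real n)) \<longlonglongrightarrow> - rate k * t"
    by (rule filterlim_compose)
  then have 2: "(\<lambda>n. real n * (y n - 1)) \<longlonglongrightarrow> - rate k * t"
    by (simp add: y_def mult.commute)
  have "(\<lambda>n. \<bar>real n * (1 - x n) + real n * (y n - 1)\<bar>) \<longlonglongrightarrow> \<bar>t * rate k + - rate k * t\<bar>"
    by (intro tendsto_intros 1 2)
  then have "(\<lambda>n. real n * \<bar>x n - y n\<bar>) \<longlonglongrightarrow> \<bar>t * rate k + - rate k * t\<bar>"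
  proof (rule Lim_transform_eventually)
    have "real n * (1 - x n) + real n * (y n - 1) = real n * (y n - x n)" for n
      by (simp add: algebra_simps)
    then show "\<forall>\<^sub>F n in sequentially. \<bar>real n * (1 - x n) + real n * (y n - 1)\<bar> = real n * \<bar>x n - y n\<bar>"
      by (simp add: abs_mult abs_minus_commute)
  qed
  then have "(\<lambda>n. real n * \<bar>x n - y n\<bar>) \<longlonglongrightarrow> 0" by (simp add: mult.commute)
  moreover have "norm (x n ^ n - y n ^ n) \<le> real n * \<bar>x n - y n\<bar>" for n
  proof -
    have "norm (x n) \<le> 1" using abs_char_le by (simp add: x_def)
    moreover have "norm (y n) \<le> 1" using t rate_nonneg[of k] by (simp add: y_def)
    ultimately show ?thesis using norm_power_diff[of "x n" "y n" n] by simp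
  qed
  ultimately have "(\<lambda>n. x n ^ n - y n ^ n) \<longlonglongrightarrow> 0"
    by (auto intro!: Lim_null_comparison[of _ "\<lambda>n. real n * \<bar>x n - y n\<bar>"])
  moreover have "(\<lambda>n. y n ^ n) \<longlonglongrightarrow> exp (- rate k * t)"
    by (rule tendsto_eventually, rule eventually_mono[OF eventually_gt_at_top[of 0]])
      (simp add: y_def exp_of_nat_mult[symmetric])
  ultimately have "(\<lambda>n. (x n ^ n - y n ^ n) + y n ^ n) \<longlonglongrightarrow> 0 + exp (- rate k * t)"
    by (rule tendsto_add)
  then show ?thesis by (simp add: x_def)
qed

text \<open>A relation, because one function has many presentations as a sum of modes. That the flow
  depends on the function alone at times t \<ge> 0 is the case b = 0 of
  \<open>heat_flow_diff_le\<close>.\<close>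

inductive heat_flow :: "(real ^ 'd \<Rightarrow> real) \<Rightarrow> (real \<Rightarrow> real ^ 'd \<Rightarrow> real) \<Rightarrow> bool" where
  heat_mode: "heat_flow (\<lambda>u. c * mode k a u) (\<lambda>t u. c * exp (- rate k * t) * mode k a u)"
| heat_add: "heat_flow g h \<Longrightarrow> heat_flow g' h' \<Longrightarrow> heat_flow (\<lambda>u. g u + g' u) (\<lambda>t u. h t u + h' t u)"

lemma heat_flow_exists: "trig_poly g \<Longrightarrow> \<exists>h. heat_flow g h"
  by (induction rule: trig_poly.induct) (blast intro: heat_mode heat_add)+

lemma heat_flow_scale: "heat_flow g h \<Longrightarrow> heat_flow (\<lambda>u. c * g u) (\<lambda>t u. c * h t u)"
proof (induction rule: heat_flow.induct)
  case (heat_mode c' k a)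
  show ?case using heat_flow.heat_mode[of "c * c'" k a] by (simp add: mult.assoc)
qed (auto simp: distrib_left intro: heat_flow.heat_add)

lemma heat_flow_diff:
  "heat_flow g h \<Longrightarrow> heat_flow g' h' \<Longrightarrow> heat_flow (\<lambda>u. g u - g' u) (\<lambda>t u. h t u - h' t u)"
  using heat_add[OF _ heat_flow_scale[of g' h' "-1"], of g h] by simp

lemma heat_flow_0: "heat_flow g h \<Longrightarrow> h 0 = g"
  by (induction rule: heat_flow.induct) (auto simp: fun_eq_iff)

lemma heat_flow_torus_cont: "heat_flow g h \<Longrightarrow> h t \<in> torus_cont"
  by (induction rule: heat_flow.induct) auto

lemma heat_flow_continuous: "heat_flow g h \<Longrightarrow> continuous_on UNIV (\<lambda>(t, u). h t u)"
proof (induction rule: heat_flow.induct)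
  case (heat_mode c k a)
  show ?case unfolding mode_def case_prod_beta by (intro continuous_intros)
next
  case (heat_add g h g' h')
  then show ?case unfolding case_prod_beta by (intro continuous_intros)
qed

text \<open>Discrete maximum principle: the weights are nonnegative and sum to 1.\<close>

lemma avg_iter_le:
  assumes "\<And>u. g u \<le> b"
  shows "(avg h ^^ n) g u \<le> b"
proof (induction n arbitrary: u)
  case (Suc n)
  have "(avg h ^^ Suc n) g u \<le> (\<Sum>z\<in>set_pmf p. pmf p z * b)"
    unfolding funpow.simps comp_def avg_def by (intro sum_mono mult_left_mono Suc[unfolded avg_def]) auto
  also have "\<dots> = b" by (simp add: sum_distrib_right[symmetric] sum_pmf_one)
  finally show ?case .
qed (use assms in simp)

lemma avg_scale: "avg h (\<lambda>u. c * g u) = (\<lambda>u. c * avg h g u)"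
  by (auto simp: avg_def sum_distrib_left fun_eq_iff intro!: sum.cong)

lemma avg_iter_add: "(avg h ^^ n) (\<lambda>u. f u + g u) u = (avg h ^^ n) f u + (avg h ^^ n) g u"
  by (induction n arbitrary: u) (auto simp: avg_def sum.distrib distrib_left)

lemma avg_iter_mode: "(avg h ^^ n) (\<lambda>u. c * mode k a u) = (\<lambda>u. c * char h k ^ n * mode k a u)"
proof (induction n)
  case (Suc n)
  have "(avg h ^^ Suc n) (\<lambda>u. c * mode k a u) = (\<lambda>u. c * char h k ^ n * avg h (\<lambda>u. mode k a u) u)"
    by (simp add: Suc avg_scale)
  then show ?case by (simp add: avg_mode mult_ac)
qed simp

text \<open>The central limit theorem in Fourier form; it transfers positivity of \<^const>\<open>avg\<close> to the
  heat flow.\<close>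

lemma heat_flow_limit:
  assumes "heat_flow g h" "0 \<le> t"
  shows "(\<lambda>n. (avg (sqrt (t / real n)) ^^ n) g u) \<longlonglongrightarrow> h t u"
  using assms(1)
proof (induction rule: heat_flow.induct)
  case (heat_mode c k a)
  show ?case unfolding avg_iter_mode
    using assms(2) by (intro tendsto_intros tendsto_char_power)
qed (auto simp: avg_iter_add intro: tendsto_add)

text \<open>The maximum principle survives the limit of averages. No ellipticity enters, so
  directions in which C degenerates are harmless.\<close>

lemma heat_flow_le:
  assumes "heat_flow g h" "0 \<le> t" "\<And>u. g u \<le> b"
  shows "h t u \<le> b"
  using heat_flow_limit[OF assms(1,2)] by (rule LIMSEQ_le_const2) (auto intro: avg_iter_le assms)

text \<open>The sup-norm contraction through which the flow extends from trigonometric polynomials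
  to continuous data.\<close>

lemma heat_flow_diff_le:
  assumes "heat_flow g h" "heat_flow g' h'" "0 \<le> t" "\<And>u. \<bar>g u - g' u\<bar> \<le> b"
  shows "\<bar>h t u - h' t u\<bar> \<le> b"
proof -
  have "h t u - h' t u \<le> b" "h' t u - h t u \<le> b"
    using heat_flow_le[OF heat_flow_diff[OF assms(1,2)] assms(3), of b u]
      heat_flow_le[OF heat_flow_diff[OF assms(2,1)] assms(3), of b u] assms(4)
    by (auto simp: abs_le_iff)
  then show ?thesis by linarith
qed

text \<open>\<open>avg\<close> is self-adjoint: a shift by z/N on \<open>g\<close> becomes a shift
  by -z/N on the mode, and reflecting z restores the average, of which the mode is an
  eigenfunction.\<close>

lemma integral_avg_mode:
  assumes g: "g \<in> torus_cont" and N: "0 < N"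
  shows "(\<integral>u. avg (1 / real N) g u * mode k a u \<partial>haar) = char (1 / real N) k * (\<integral>u. g u * mode k a u \<partial>haar)"
proof -
  let ?m = "mode k a"
  have shift: "(\<integral>u. g (u + point N z) * ?m u \<partial>haar) = (\<integral>u. g u * ?m (u + point N (- z)) \<partial>haar)" for z
  proof -
    have "(\<lambda>u. g u * ?m (u + point N (- z))) \<in> torus_cont"
      using g by (intro torus_cont_mult torus_cont_shift) auto
    from integral_shift[OF this N, of z] show ?thesis
      by (simp add: point_def real_vec_minus)
  qed
  have "(\<integral>u. avg (1 / real N) g u * ?m u \<partial>haar) = (\<integral>u. (\<Sum>z\<in>set_pmf p. pmf p z * (g (u + point N z) * ?m u)) \<partial>haar)"
    by (simp add: avg_def point_def sum_distrib_right mult.assoc)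
  also have "\<dots> = (\<Sum>z\<in>set_pmf p. pmf p z * (\<integral>u. g (u + point N z) * ?m u \<partial>haar))"
    using g by (subst Bochner_Integration.integral_sum) (auto intro!: integrable_mult_right haar_integrable torus_cont_mult torus_cont_shift)
  also have "\<dots> = (\<Sum>z\<in>set_pmf p. pmf p z * (\<integral>u. g u * ?m (u + point N z) \<partial>haar))"
    unfolding shift by (rule sum_reflect)
  also have "\<dots> = (\<integral>u. (\<Sum>z\<in>set_pmf p. pmf p z * (g u * ?m (u + point N z))) \<partial>haar)"
    using g by (subst Bochner_Integration.integral_sum) (auto intro!: integrable_mult_right haar_integrable torus_cont_mult torus_cont_shift)
  also have "\<dots> = (\<integral>u. g u * avg (1 / real N) (\<lambda>u. ?m u) u \<partial>haar)"
    by (simp add: avg_def point_def sum_distrib_left mult_ac)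
  also have "\<dots> = char (1 / real N) k * (\<integral>u. g u * ?m u \<partial>haar)"
    by (simp add: avg_mode mult_ac flip: integral_mult_right_zero)
  finally show ?thesis .
qed

end

section \<open>One half of the Laplacian as the scaled limit of averages\<close>

lemma vec_eq_sum_axis: "v = (\<Sum>i\<in>UNIV. v $ i *\<^sub>R axis i (1 :: real))"
  by (simp add: vec_eq_iff axis_def if_distrib cong: if_cong)

lemma linear_axis_expansion:
  assumes "linear (D :: real ^ 'd \<Rightarrow> real)"
  shows "D v = (\<Sum>i\<in>UNIV. v $ i * D (axis i 1))"
  by (subst vec_eq_sum_axis[of v]) (simp add: linear_sum[OF assms] linear_cmul[OF assms])

lemma has_derivative_line:
  assumes "\<And>u. (g has_derivative D u) (at u)"
  shows "((\<lambda>h. g (u + h *\<^sub>R v)) has_real_derivative D (u + h *\<^sub>R v) v) (at h)"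
proof -
  have lin: "linear (D (u + h *\<^sub>R v))" using assms has_derivative_linear by blast
  have "((\<lambda>h. u + h *\<^sub>R v) has_derivative (\<lambda>s. s *\<^sub>R v)) (at h)"
    by (auto intro!: derivative_eq_intros)
  from has_derivative_compose[OF this assms]
  show ?thesis
    by (simp add: has_field_derivative_def linear_cmul[OF lin] mult_commute_abs)
qed

lemma partial_eq:
  assumes "\<And>u. (g has_derivative D u) (at u)"
  shows "partial i g u = D u (axis i 1)"
  using has_derivative_line[OF assms, of u "axis i 1" 0] by (simp add: partial_def DERIV_imp_deriv)

context symmetric_jump
begin

text \<open>\<open>F N\<close>, which is N^2 (avg g - g), is bounded on the cube and converges
  pointwise to half the Laplacian. Its integral against a mode is the integral of \<open>g\<close>
  against the mode times - N^2 (1 - char), which tends to - rate. This takes the place of two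
  integrations by parts.\<close>

lemma laplacian_integral_mode:
  assumes g: "g \<in> torus_cont"
    and D: "\<And>u. (g has_derivative D u) (at u)"
    and H: "\<And>j u. ((\<lambda>u. D u (axis j 1)) has_derivative H j u) (at u)"
    and cont: "\<And>i j. continuous_on UNIV (\<lambda>u. H j u (axis i 1))"
  shows "laplacian (covariance p) g u = (\<Sum>i\<in>UNIV. \<Sum>j\<in>UNIV. covariance p i j * H j u (axis i 1))" (is ?lap)
    and "(\<integral>u. 1 / 2 * laplacian (covariance p) g u * mode k a u \<partial>haar) = - rate k * (\<integral>u. g u * mode k a u \<partial>haar)" (is ?int)
proof -
  have p1: "partial j g = (\<lambda>u. D u (axis j 1))" for j
    by (rule ext) (rule partial_eq[OF D])
  have p2: "partial i (partial j g) u = H j u (axis i 1)" for i j u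
    unfolding p1 by (rule partial_eq[OF H])
  then show lap: "laplacian (covariance p) g u = (\<Sum>i\<in>UNIV. \<Sum>j\<in>UNIV. covariance p i j * H j u (axis i 1))" for u
    by (simp add: laplacian_def)
  \<comment> \<open>The second derivative of \<open>g\<close> at u in direction z. Averaging it over
    the jumps gives the Laplacian, since C averages the products z_i z_j.\<close>
  define S where "S z u = (\<Sum>i\<in>UNIV. \<Sum>j\<in>UNIV. real_of_int (z $ i) * real_of_int (z $ j) * H j u (axis i 1))" for z u
  have S_cont: "continuous_on UNIV (S z)" for z
    unfolding S_def by (intro continuous_intros cont)
  have lap_S: "laplacian (covariance p) g u = (\<Sum>z\<in>set_pmf p. pmf p z * S z u)" for u
  proof -
    have "laplacian (covariance p) g u
        = (\<Sum>i\<in>UNIV. \<Sum>j\<in>UNIV. \<Sum>z\<in>set_pmf p. pmf p z * (real_of_int (z $ i) * real_of_int (z $ j) * H j u (axis i 1)))"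
      unfolding lap covariance_def sum_distrib_right by (intro sum.cong refl) simp
    also have "\<dots> = (\<Sum>i\<in>UNIV. \<Sum>z\<in>set_pmf p. \<Sum>j\<in>UNIV. pmf p z * (real_of_int (z $ i) * real_of_int (z $ j) * H j u (axis i 1)))"
      by (intro sum.cong refl) (rule sum.swap)
    also have "\<dots> = (\<Sum>z\<in>set_pmf p. \<Sum>i\<in>UNIV. \<Sum>j\<in>UNIV. pmf p z * (real_of_int (z $ i) * real_of_int (z $ j) * H j u (axis i 1)))"
      by (rule sum.swap)
    also have "\<dots> = (\<Sum>z\<in>set_pmf p. pmf p z * S z u)"
      by (simp add: S_def sum_distrib_left)
    finally show ?thesis .
  qed
  have line2: "((\<lambda>h. D (u + h *\<^sub>R real_vec z) (real_vec z)) has_real_derivative S z (u + h *\<^sub>R real_vec z)) (at h)" for u z h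
  proof -
    have lin: "linear (D u)" for u using D has_derivative_linear by blast
    have linH: "linear (H j u)" for j u using H has_derivative_linear by blast
    have eq: "D u (real_vec z) = (\<Sum>j\<in>UNIV. real_of_int (z $ j) * D u (axis j 1))" for u
      by (subst linear_axis_expansion[OF lin]) simp
    have S: "S z u = (\<Sum>j\<in>UNIV. real_of_int (z $ j) * H j u (real_vec z))" for u
      unfolding S_def by (subst sum.swap) (simp add: linear_axis_expansion[OF linH, of _ _ "real_vec z"] sum_distrib_left mult_ac)
    show ?thesis
      unfolding eq S by (intro DERIV_sum DERIV_cmult has_derivative_line[OF H])
  qed
  let ?Q = "\<lambda>N u z. (real N)\<^sup>2 * (g (u + (1 / real N) *\<^sub>R real_vec z) + g (u - (1 / real N) *\<^sub>R real_vec z) - 2 * g u)"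
  have diff: "\<exists>x y. \<bar>x\<bar> \<le> 1 / real N \<and> \<bar>y\<bar> \<le> 1 / real N \<and>
      ?Q N u z
        = 1 / 2 * (S z (u + x *\<^sub>R real_vec z) + S z (u + y *\<^sub>R real_vec z))" if "0 < N" for N u z
  proof -
    have "0 < 1 / real N" using that by simp
    from second_difference[OF has_derivative_line[OF D, of u "real_vec z"] line2[of u z] this]
    obtain x y where xy: "\<bar>x\<bar> \<le> 1 / real N" "\<bar>y\<bar> \<le> 1 / real N"
      "g (u + (1 / real N) *\<^sub>R real_vec z) + g (u + (- (1 / real N)) *\<^sub>R real_vec z) - 2 * g (u + 0 *\<^sub>R real_vec z)
        = (1 / real N)\<^sup>2 / 2 * (S z (u + x *\<^sub>R real_vec z) + S z (u + y *\<^sub>R real_vec z))"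
      by metis
    have e: "u + (- (1 / real N)) *\<^sub>R real_vec z = u - (1 / real N) *\<^sub>R real_vec z" by simp
    have "?Q N u z
        = (real N)\<^sup>2 * ((1 / real N)\<^sup>2 / 2 * (S z (u + x *\<^sub>R real_vec z) + S z (u + y *\<^sub>R real_vec z)))"
      using xy(3) unfolding e by simp
    also have "\<dots> = 1 / 2 * (S z (u + x *\<^sub>R real_vec z) + S z (u + y *\<^sub>R real_vec z))"
      using that by (simp add: power_divide)
    finally show ?thesis using xy(1,2) by blast
  qed
  define F where "F N u = (real N)\<^sup>2 * (avg (1 / real N) g u - g u)" for N u
  \<comment> \<open>Averaging the jumps z and -z turns the one-sided increments into central second
    differences; this is the origin of the factor 1/2 in the equation.\<close>
  have F: "F N u = 1 / 2 * (\<Sum>z\<in>set_pmf p. pmf p z *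
      ?Q N u z)" for N u
  proof -
    have "(\<Sum>z\<in>set_pmf p. pmf p z * g (u - (1 / real N) *\<^sub>R real_vec z)) = avg (1 / real N) g u"
      using sum_reflect[of "\<lambda>z. g (u + (1 / real N) *\<^sub>R real_vec z)"] by (simp add: avg_def real_vec_minus)
    moreover have "(\<Sum>z\<in>set_pmf p. pmf p z * (2 * g u)) = 2 * g u"
      by (simp add: sum_distrib_right[symmetric] sum_pmf_one)
    ultimately have "(\<Sum>z\<in>set_pmf p. pmf p z *
      (g (u + (1 / real N) *\<^sub>R real_vec z) + g (u - (1 / real N) *\<^sub>R real_vec z) - 2 * g u)) = 2 * (avg (1 / real N) g u - g u)"
      by (simp add: distrib_left right_diff_distrib sum.distrib sum_subtractf avg_def)
    then show ?thesis
      unfolding F_def mult.left_commute[of _ "(real N)\<^sup>2"] sum_distrib_left[symmetric] by simp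
  qed
  have F_lim: "(\<lambda>N. F N u) \<longlonglongrightarrow> 1 / 2 * laplacian (covariance p) g u" for u
  proof -
    have "(\<lambda>N. ?Q N u z) \<longlonglongrightarrow> S z u" for z
    proof -
      obtain x y where xy: "\<And>N. 0 < N \<Longrightarrow> \<bar>x N\<bar> \<le> 1 / real N" "\<And>N. 0 < N \<Longrightarrow> \<bar>y N\<bar> \<le> 1 / real N"
        "\<And>N. 0 < N \<Longrightarrow> ?Q N u z
        = 1 / 2 * (S z (u + x N *\<^sub>R real_vec z) + S z (u + y N *\<^sub>R real_vec z))"
        using diff[of _ u z] by metis
      \<comment> \<open>The intermediate points of Taylor's formula are chosen afresh for each N and
        need not depend regularly on N; that they are squeezed to 0 and \<open>S z\<close> is
        continuous is enough.\<close>
      have null: "w \<longlonglongrightarrow> 0" if "\<And>N. 0 < N \<Longrightarrow> \<bar>w N\<bar> \<le> 1 / real N" for w :: "nat \<Rightarrow> real"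
        using that by (intro Lim_null_comparison[OF _ lim_1_over_n]) (auto intro!: eventually_mono[OF eventually_gt_at_top[of 0]])
      have lim: "(\<lambda>N. S z (u + w N *\<^sub>R real_vec z)) \<longlonglongrightarrow> S z u" if "\<And>N. 0 < N \<Longrightarrow> \<bar>w N\<bar> \<le> 1 / real N" for w
      proof -
        have "(\<lambda>N. u + w N *\<^sub>R real_vec z) \<longlonglongrightarrow> u + 0 *\<^sub>R real_vec z"
          by (intro tendsto_intros null that)
        then show ?thesis
          using continuous_on_tendsto_compose[OF S_cont[of z]] by simp
      qed
      have "(\<lambda>N. 1 / 2 * (S z (u + x N *\<^sub>R real_vec z) + S z (u + y N *\<^sub>R real_vec z))) \<longlonglongrightarrow> 1 / 2 * (S z u + S z u)"
        by (intro tendsto_intros lim xy)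
      then have "(\<lambda>N. 1 / 2 * (S z (u + x N *\<^sub>R real_vec z) + S z (u + y N *\<^sub>R real_vec z))) \<longlonglongrightarrow> S z u" by simp
      then show ?thesis
        by (rule Lim_transform_eventually) (auto intro!: eventually_mono[OF eventually_gt_at_top[of 0]] simp: xy(3))
    qed
    then show ?thesis
      unfolding F lap_S by (intro tendsto_intros)
  qed
  \<comment> \<open>Domination: the intermediate points stay within 1/N \<le> 1 of 0, so
    \<open>S z\<close> is evaluated on a compact set, and only finitely many z occur.\<close>
  have "\<exists>B. \<forall>z\<in>set_pmf p. \<forall>u\<in>unit_cube. \<forall>x. \<bar>x\<bar> \<le> 1 \<longrightarrow> \<bar>S z (u + x *\<^sub>R real_vec z)\<bar> \<le> B"
  proof -
    have "\<exists>B. \<forall>u\<in>unit_cube. \<forall>x. \<bar>x\<bar> \<le> 1 \<longrightarrow> \<bar>S z (u + x *\<^sub>R real_vec z)\<bar> \<le> B" for z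
    proof -
      have "compact ((\<lambda>(u, x). S z (u + x *\<^sub>R real_vec z)) ` (cbox 0 1 \<times> {-1..1}))"
        unfolding case_prod_beta
        by (intro compact_continuous_image compact_Times continuous_on_compose2[OF S_cont] continuous_intros) auto
      then obtain B where "\<And>w. w \<in> (\<lambda>(u, x). S z (u + x *\<^sub>R real_vec z)) ` (cbox 0 1 \<times> {-1..1}) \<Longrightarrow> norm w \<le> B"
        using compact_imp_bounded bounded_iff by metis
      then show ?thesis using unit_cube_subset
        by (intro exI[of _ B]) (fastforce simp: abs_le_iff)
    qed
    then obtain B where B: "\<And>z u x. u \<in> unit_cube \<Longrightarrow> \<bar>x\<bar> \<le> 1 \<Longrightarrow> \<bar>S z (u + x *\<^sub>R real_vec z)\<bar> \<le> B z" by metis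
    show ?thesis
      using B finite_support by (intro exI[of _ "\<Sum>z\<in>set_pmf p. \<bar>B z\<bar>"])
        (meson abs_ge_self abs_ge_zero member_le_sum order.trans)
  qed
  then obtain B where B: "\<And>z u x. z \<in> set_pmf p \<Longrightarrow> u \<in> unit_cube \<Longrightarrow> \<bar>x\<bar> \<le> 1 \<Longrightarrow> \<bar>S z (u + x *\<^sub>R real_vec z)\<bar> \<le> B"
    by blast
  have F_bound: "\<bar>F N u\<bar> \<le> 1 / 2 * B" if u: "u \<in> unit_cube" and N: "0 < N" for N u
  proof -
    have "\<bar>?Q N u z\<bar> \<le> B"
      if z: "z \<in> set_pmf p" for z
    proof -
      have "1 / real N \<le> 1" using N by simp
      then obtain x y where "\<bar>x\<bar> \<le> 1" "\<bar>y\<bar> \<le> 1" and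
        eq: "?Q N u z
        = 1 / 2 * (S z (u + x *\<^sub>R real_vec z) + S z (u + y *\<^sub>R real_vec z))"
        using diff[OF N, of u z] by (meson order.trans)
      then have "\<bar>S z (u + x *\<^sub>R real_vec z)\<bar> \<le> B" "\<bar>S z (u + y *\<^sub>R real_vec z)\<bar> \<le> B" using B z u by auto
      then have "\<bar>S z (u + x *\<^sub>R real_vec z) + S z (u + y *\<^sub>R real_vec z)\<bar> \<le> B + B"
        using abs_triangle_ineq by (rule order.trans[rotated, OF add_mono])
      then show ?thesis unfolding eq abs_mult by simp
    qed
    then have "\<bar>\<Sum>z\<in>set_pmf p. pmf p z *
      ?Q N u z\<bar> \<le> (\<Sum>z\<in>set_pmf p. pmf p z * B)"
      by (intro order.trans[OF sum_abs] sum_mono) (auto simp: abs_mult intro!: mult_left_mono)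
    also have "\<dots> = B" by (simp add: sum_distrib_right[symmetric] sum_pmf_one)
    finally show ?thesis unfolding F by simp
  qed
  have F_torus: "F N \<in> torus_cont" for N
    unfolding F_def avg_def
    by (intro torus_cont_mult torus_cont_diff torus_cont_sum torus_cont_const torus_cont_shift[OF g] g)
  have lap_meas: "(\<lambda>u. 1 / 2 * laplacian (covariance p) g u) \<in> borel_measurable borel"
    unfolding lap by (intro borel_measurable_continuous_onI continuous_intros cont)
  \<comment> \<open>Passing to \<open>Suc N\<close> keeps the scale positive, so that the bound on
    \<open>F\<close> covers every term of the sequence.\<close>
  have "(\<lambda>N. \<integral>u. F (Suc N) u * mode k a u \<partial>haar) \<longlonglongrightarrow> (\<integral>u. 1 / 2 * laplacian (covariance p) g u * mode k a u \<partial>haar)"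
  proof (rule integral_dominated_convergence[where w = "\<lambda>_. 1 / 2 * B"])
    show "(\<lambda>u. 1 / 2 * laplacian (covariance p) g u * mode k a u) \<in> borel_measurable haar"
      using haar_measurable[OF lap_meas] haar_measurable[OF torus_cont_measurable[OF mode_torus_cont]]
      by (rule borel_measurable_times)
    show "(\<lambda>u. F (Suc N) u * mode k a u) \<in> borel_measurable haar" for N
      by (intro haar_measurable torus_cont_measurable torus_cont_mult F_torus mode_torus_cont)
    show "AE u in haar. (\<lambda>N. F (Suc N) u * mode k a u) \<longlonglongrightarrow> 1 / 2 * laplacian (covariance p) g u * mode k a u"
      by (intro AE_I2 tendsto_mult[OF LIMSEQ_Suc[OF F_lim] tendsto_const])
    show "AE u in haar. norm (F (Suc N) u * mode k a u) \<le> 1 / 2 * B" for N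
    proof (rule AE_I2)
      fix u :: "real ^ 'd" assume "u \<in> space haar"
      then have "\<bar>F (Suc N) u\<bar> \<le> 1 / 2 * B" using F_bound by simp
      with abs_mode_le[of k a u] show "norm (F (Suc N) u * mode k a u) \<le> 1 / 2 * B"
        using mult_mono[of "\<bar>F (Suc N) u\<bar>" "1 / 2 * B" "\<bar>mode k a u\<bar>" 1] by (simp add: abs_mult)
    qed
  qed simp
  moreover have "(\<lambda>N. \<integral>u. F (Suc N) u * mode k a u \<partial>haar) \<longlonglongrightarrow> - rate k * (\<integral>u. g u * mode k a u \<partial>haar)"
  proof -
    have "(\<integral>u. F N u * mode k a u \<partial>haar) = - ((real N)\<^sup>2 * (1 - char (1 / real N) k)) * (\<integral>u. g u * mode k a u \<partial>haar)"
      if "0 < N" for N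
    proof -
      have avg: "avg (1 / real N) g \<in> torus_cont"
        unfolding avg_def by (intro torus_cont_mult torus_cont_sum torus_cont_const torus_cont_shift[OF g])
      have "(\<integral>u. F N u * mode k a u \<partial>haar)
          = (\<integral>u. (real N)\<^sup>2 * (avg (1 / real N) g u * mode k a u) - (real N)\<^sup>2 * (g u * mode k a u) \<partial>haar)"
        by (simp add: F_def algebra_simps)
      also have "\<dots> = (real N)\<^sup>2 * (\<integral>u. avg (1 / real N) g u * mode k a u \<partial>haar) - (real N)\<^sup>2 * (\<integral>u. g u * mode k a u \<partial>haar)"
        using g avg by (subst Bochner_Integration.integral_diff)
          (simp_all add: haar_integrable torus_cont_mult)
      finally show ?thesis unfolding integral_avg_mode[OF g that] by (simp add: algebra_simps)
    qed
    then have eq: "(\<integral>u. F (Suc N) u * mode k a u \<partial>haar) = - ((real (Suc N))\<^sup>2 * (1 - char (1 / real (Suc N)) k)) * (\<integral>u. g u * mode k a u \<partial>haar)" for N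
      by blast
    show ?thesis unfolding eq
      by (intro tendsto_intros LIMSEQ_Suc[OF tendsto_char_lattice])
  qed
  ultimately show ?int by (rule LIMSEQ_unique)
qed

end

section \<open>Integration over space-time and the weak identity for heat flows\<close>

abbreviation time_interval :: "real \<Rightarrow> real measure" where
  "time_interval t \<equiv> restrict_space lborel {0..t}"

lemma set_integral_time: "(LINT s:{0..t}|lborel. f s) = integral\<^sup>L (time_interval t) f" for f :: "_ \<Rightarrow> real"
  by (simp add: integral_restrict_space set_lebesgue_integral_def)

lemma finite_measure_time: "finite_measure (time_interval t)"
  by (intro finite_measureI) (auto simp: space_restrict_space emeasure_restrict_space emeasure_lborel_Icc_eq)

interpretation time_space: pair_sigma_finite "time_interval t" "haar :: (real ^ 'd) measure"
  by (intro pair_sigma_finite.intro finite_measure.sigma_finite_measure finite_measure_time haar.finite_measure_axioms)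

lemma finite_measure_time_space: "finite_measure (time_interval t \<Otimes>\<^sub>M (haar :: (real ^ 'd) measure))"
  by (intro finite_measure_pair_measure finite_measure_time haar.finite_measure_axioms)

lemma space_time_space: "space (time_interval t \<Otimes>\<^sub>M haar) = {0..t} \<times> unit_cube"
  by (simp add: space_pair_measure space_restrict_space)

lemma time_space_measurable:
  assumes "f \<in> borel_measurable borel"
  shows "f \<in> borel_measurable (time_interval t \<Otimes>\<^sub>M haar)"
proof -
  have fst: "(\<lambda>z. fst z) \<in> borel_measurable (time_interval t \<Otimes>\<^sub>M haar)"
    by (rule measurable_compose[OF measurable_fst]) (intro measurable_restrict_space1, simp)
  have snd: "(\<lambda>z. snd z) \<in> borel_measurable (time_interval t \<Otimes>\<^sub>M haar)"
    by (rule measurable_compose[OF measurable_snd]) (intro measurable_restrict_space1, simp)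
  have "(\<lambda>z. (fst z, snd z)) \<in> measurable (time_interval t \<Otimes>\<^sub>M haar) (borel \<Otimes>\<^sub>M borel)"
    using fst snd by (rule measurable_Pair)
  then have "(\<lambda>z. z) \<in> borel_measurable (time_interval t \<Otimes>\<^sub>M haar)"
    by (simp add: borel_prod)
  from measurable_compose[OF this assms] show ?thesis .
qed

lemma time_space_integrable:
  fixes f :: "real \<times> (real ^ 'd) \<Rightarrow> real"
  assumes "f \<in> borel_measurable borel" "\<And>s u. 0 \<le> s \<Longrightarrow> s \<le> t \<Longrightarrow> u \<in> unit_cube \<Longrightarrow> \<bar>f (s, u)\<bar> \<le> B"
  shows "integrable (time_interval t \<Otimes>\<^sub>M haar) f"
  by (rule finite_measure.integrable_const_bound[OF finite_measure_time_space, where B = B])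
    (use assms in \<open>auto simp: space_time_space time_space_measurable intro!: AE_I2\<close>)

lemma time_space_bounded:
  fixes f :: "real \<Rightarrow> real ^ 'd \<Rightarrow> real"
  assumes "continuous_on UNIV (\<lambda>(s, u). f s u)"
  obtains B where "0 \<le> B" "\<And>s u. 0 \<le> s \<Longrightarrow> s \<le> t \<Longrightarrow> u \<in> unit_cube \<Longrightarrow> \<bar>f s u\<bar> \<le> B"
proof -
  have "compact ((\<lambda>(s, u). f s u) ` ({0..t} \<times> cbox 0 1))"
    by (intro compact_continuous_image compact_Times compact_Icc compact_cbox continuous_on_subset[OF assms]) auto
  then obtain B where B: "\<And>w. w \<in> (\<lambda>(s, u). f s u) ` ({0..t} \<times> cbox 0 1) \<Longrightarrow> norm w \<le> B"
    using compact_imp_bounded bounded_iff by metis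
  have "\<bar>f s u\<bar> \<le> \<bar>B\<bar>" if "0 \<le> s" "s \<le> t" "u \<in> unit_cube" for s u
    using B[of "f s u"] unit_cube_subset that by force
  then show thesis using that[of "\<bar>B\<bar>"] by simp
qed

text \<open>Test functions are controlled at nonnegative times only. Freezing time at 0 for negative
  s gives a continuous function on all of space-time, to which Borel measurability and compactness
  arguments apply directly.\<close>

lemma continuous_clamp:
  assumes "continuous_on ({0..} \<times> UNIV) (\<lambda>(s, u). f s u)"
  shows "continuous_on UNIV (\<lambda>(s :: real, u). f (max 0 s) u)"
proof -
  have "continuous_on UNIV (\<lambda>z. (\<lambda>(s, u). f s u) (max 0 (fst z), snd z))"
    by (rule continuous_on_compose2[OF assms]) (auto intro!: continuous_intros)
  then show ?thesis by (simp add: case_prod_beta)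
qed

text \<open>Makes derivatives within the half line unique, so that \<open>vector_derivative\<close>
  can be evaluated from any derivative exhibited, even at the boundary time 0.\<close>

lemma at_within_atLeast_neq_bot: "0 \<le> s \<Longrightarrow> at s within {0 :: real..} \<noteq> bot"
  using at_le[of "{s<..}" "{0..}" s] trivial_limit_at_right_real[of s]
  by (metis atLeast_iff bot_unique greaterThan_iff less_imp_le order.trans subsetI)

context symmetric_jump
begin

text \<open>Distils a test function into what the weak identity uses: a continuous time derivative
  \<open>T\<close>, a continuous half Laplacian \<open>L\<close>, and the pairing of
  \<open>L\<close> with modes.\<close>

lemma test_function_data:
  assumes "test_function G"
  obtains T L where
    "continuous_on ({0..} \<times> UNIV) (\<lambda>(s, u). T s u)" "continuous_on ({0..} \<times> UNIV) (\<lambda>(s, u). L s u)"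
    "\<And>s u. 0 \<le> s \<Longrightarrow> ((\<lambda>r. G r u) has_vector_derivative T s u) (at s within {0..})"
    "\<And>s u. 0 \<le> s \<Longrightarrow> vector_derivative (\<lambda>r. G r u) (at s within {0..}) + 1 / 2 * laplacian (covariance p) (G s) u = T s u + L s u"
    "\<And>s k a. 0 \<le> s \<Longrightarrow> (\<integral>u. L s u * mode k a u \<partial>haar) = - rate k * (\<integral>u. G s u * mode k a u \<partial>haar)"
    "continuous_on ({0..} \<times> UNIV) (\<lambda>(s, u). G s u)" "\<And>s. 0 \<le> s \<Longrightarrow> G s \<in> torus_cont"
proof -
  let ?S = "{0::real..} \<times> (UNIV :: (real ^ 'd) set)"
  obtain D H where D: "\<And>z. z \<in> ?S \<Longrightarrow> ((\<lambda>(s, u). G s u) has_derivative D z) (at z within ?S)"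
    and H: "\<And>v z. z \<in> ?S \<Longrightarrow> ((\<lambda>z. D z v) has_derivative H z v) (at z within ?S)"
    and cont: "\<And>v w. continuous_on ?S (\<lambda>z. H z v w)"
    and per: "\<And>s. 0 \<le> s \<Longrightarrow> periodic (G s)"
    using assms unfolding test_function_def C2_on_def by blast
  have contD: "continuous_on ?S (\<lambda>z. D z v)" for v
    using H by (rule has_derivative_continuous_on)
  have contG: "continuous_on ?S (\<lambda>(s, u). G s u)"
    using D by (rule has_derivative_continuous_on)
  \<comment> \<open>A slice of constant time lies inside the domain, so spatial derivatives are full
    ones even at s = 0, although the joint derivative there is one-sided in time.\<close>
  have space: "((\<lambda>u. F (s, u)) has_derivative (\<lambda>w. F' (0, w))) (at u)"
    if "0 \<le> s" "(F has_derivative F') (at (s, u) within ?S)" for F :: "_ \<Rightarrow> real" and F' s u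
  proof -
    have 1: "((\<lambda>u. (s, u)) has_derivative (\<lambda>w. (0, w))) (at u)"
      by (auto intro!: derivative_eq_intros)
    have "(F has_derivative F') (at (s, u) within (\<lambda>u. (s, u)) ` UNIV)"
      by (rule has_derivative_subset[OF that(2)]) (use that(1) in auto)
    from has_derivative_in_compose[OF 1 this] show ?thesis .
  qed
  have Dg: "(G s has_derivative (\<lambda>w. D (s, u) (0, w))) (at u)" if "0 \<le> s" for s u
    using space[OF that D, of u] that by simp
  have Hg: "((\<lambda>u. D (s, u) (0, axis j 1)) has_derivative (\<lambda>w. H (s, u) (0, axis j 1) (0, w))) (at u)" if "0 \<le> s" for s u j
    using space[OF that H[of _ "(0, axis j 1)"], of u] that by simp
  have slice: "continuous_on UNIV (\<lambda>u. F (s, u))" if "0 \<le> s" "continuous_on ?S F" for F :: "_ \<Rightarrow> real" and s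
    by (rule continuous_on_compose2[OF that(2)]) (use that(1) in \<open>auto intro!: continuous_intros\<close>)
  have torus: "G s \<in> torus_cont" if "0 \<le> s" for s
    using slice[OF that contG] per[OF that] by (simp add: torus_cont_def)
  define T where "T s u = D (s, u) (1, 0)" for s u
  \<comment> \<open>Expressed through \<open>H\<close>, for which joint continuity is known, and
    only afterwards identified with the \<open>laplacian\<close> built from iterated
    \<open>deriv\<close>.\<close>
  define L where "L s u = 1 / 2 * (\<Sum>i\<in>UNIV. \<Sum>j\<in>UNIV. covariance p i j * H (s, u) (0, axis j 1) (0, axis i 1))" for s u
  have lap: "L s u = 1 / 2 * laplacian (covariance p) (G s) u" if "0 \<le> s" for s u
    using laplacian_integral_mode(1)[OF torus Dg Hg slice[OF _ cont]] that by (simp add: L_def)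
  have T: "((\<lambda>r. G r u) has_vector_derivative T s u) (at s within {0..})" if "0 \<le> s" for s u
  proof -
    have 1: "((\<lambda>r. (r, u)) has_derivative (\<lambda>h. (h, 0))) (at s within {0..})"
      by (auto intro!: derivative_eq_intros)
    have "((\<lambda>(s, u). G s u) has_derivative D (s, u)) (at (s, u) within (\<lambda>r. (r, u)) ` {0..})"
      by (rule has_derivative_subset[OF D]) (use that in auto)
    from has_derivative_in_compose[OF 1 this]
    have "((\<lambda>r. G r u) has_derivative (\<lambda>h. D (s, u) (h, 0))) (at s within {0..})" by simp
    moreover have "D (s, u) (h, 0) = h *\<^sub>R T s u" for h
    proof -
      have "linear (D (s, u))" using D[of "(s, u)"] that has_derivative_linear by blast
      from linear_cmul[OF this, of h "(1, 0)"] show ?thesis by (simp add: T_def)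
    qed
    ultimately show ?thesis by (simp add: has_vector_derivative_def)
  qed
  show thesis
  proof (rule that[of T L])
    show "continuous_on ?S (\<lambda>(s, u). T s u)" using contD[of "(1, 0)"] by (simp add: T_def case_prod_beta)
    show "continuous_on ?S (\<lambda>(s, u). L s u)"
      unfolding L_def case_prod_beta prod.collapse by (intro continuous_intros cont)
    show "((\<lambda>r. G r u) has_vector_derivative T s u) (at s within {0..})" if "0 \<le> s" for s u
      using T[OF that] .
    show "vector_derivative (\<lambda>r. G r u) (at s within {0..}) + 1 / 2 * laplacian (covariance p) (G s) u = T s u + L s u"
      if "0 \<le> s" for s u
    proof -
      show ?thesis
        using vector_derivative_within[OF at_within_atLeast_neq_bot[OF that] T[OF that]] lap[OF that] by simp
    qed
    show "(\<integral>u. L s u * mode k a u \<partial>haar) = - rate k * (\<integral>u. G s u * mode k a u \<partial>haar)" if "0 \<le> s" for s k a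
      unfolding lap[OF that] by (rule laplacian_integral_mode(2)[OF torus Dg Hg slice[OF _ cont]]) (use that in simp_all)
  qed (use contG torus in auto)
qed

text \<open>For a single mode with time factor e, integrating in space replaces L by - rate times G.
  Then, at fixed u, the integrand (T - rate G) e is the time derivative of G e, and the fundamental
  theorem of calculus leaves the boundary terms. Both sides are linear in the flow.\<close>

lemma heat_flow_weak:
  fixes G T L :: "real \<Rightarrow> real ^ 'd \<Rightarrow> real"
  assumes contT: "continuous_on ({0..} \<times> UNIV) (\<lambda>(s, u). T s u)"
    and contL: "continuous_on ({0..} \<times> UNIV) (\<lambda>(s, u). L s u)"
    and contG: "continuous_on ({0..} \<times> UNIV) (\<lambda>(s, u). G s u)"
    and T: "\<And>s u. 0 \<le> s \<Longrightarrow> ((\<lambda>r. G r u) has_vector_derivative T s u) (at s within {0..})"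
    and L: "\<And>s k a. 0 \<le> s \<Longrightarrow> (\<integral>u. L s u * mode k a u \<partial>haar) = - rate k * (\<integral>u. G s u * mode k a u \<partial>haar)"
    and G: "\<And>s. 0 \<le> s \<Longrightarrow> G s \<in> torus_cont"
    and flow: "heat_flow g h" and t: "0 \<le> t"
  shows "(\<integral>u. G t u * h t u \<partial>haar) - (\<integral>u. G 0 u * g u \<partial>haar) =
    (\<integral>(s, u). (T (max 0 s) u + L (max 0 s) u) * h s u \<partial>(time_interval t \<Otimes>\<^sub>M haar))"
  using flow
proof (induction rule: heat_flow.induct)
  case (heat_mode c k a)
  let ?P = "time_interval t \<Otimes>\<^sub>M (haar :: (real ^ 'd) measure)"
  define e where "e s = c * exp (- rate k * s)" for s
  have ct: "continuous_on UNIV (\<lambda>(s, u). T (max 0 s) u)" "continuous_on UNIV (\<lambda>(s, u). L (max 0 s) u)"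
      "continuous_on UNIV (\<lambda>(s, u). G (max 0 s) u)"
    using continuous_clamp[OF contT] continuous_clamp[OF contL] continuous_clamp[OF contG] by simp_all
  note ct' = ct[unfolded case_prod_beta]
  have int: "integrable ?P (\<lambda>(s, u). F s u)" if F: "continuous_on UNIV (\<lambda>(s, u). F s u)" for F :: "real \<Rightarrow> real ^ 'd \<Rightarrow> real"
  proof -
    obtain B where "\<And>s u. 0 \<le> s \<Longrightarrow> s \<le> t \<Longrightarrow> u \<in> unit_cube \<Longrightarrow> \<bar>F s u\<bar> \<le> B"
      using time_space_bounded[OF F] by metis
    then show ?thesis
      by (intro time_space_integrable[of _ t B] borel_measurable_continuous_onI F) simp
  qed
  have m: "continuous_on S (\<lambda>z. mode k a (snd z))" for S :: "(real \<times> (real ^ 'd)) set"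
    unfolding mode_def by (intro continuous_intros)
  have i1: "integrable ?P (\<lambda>(s, u). (T (max 0 s) u + L (max 0 s) u) * (e s * mode k a u))"
    by (intro int) (auto simp: case_prod_beta e_def intro!: continuous_intros ct' m)
  have i2: "integrable ?P (\<lambda>(s, u). (T (max 0 s) u - rate k * G (max 0 s) u) * e s * mode k a u)"
    by (intro int) (auto simp: case_prod_beta e_def intro!: continuous_intros ct' m)
  have sl: "integrable haar (\<lambda>u. F u * mode k a u)" if "continuous_on UNIV F" for F
  proof -
    have "compact (F ` cbox 0 1)"
      using that by (intro compact_continuous_image) (auto intro: continuous_on_subset)
    then obtain B where B: "\<And>x. x \<in> F ` cbox 0 1 \<Longrightarrow> norm x \<le> B"
      using compact_imp_bounded bounded_iff by metis
    show ?thesis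
    proof (rule haar.integrable_const_bound[of _ B])
      show "AE u in haar. norm (F u * mode k a u) \<le> B"
      proof (rule AE_I2)
        fix u :: "real ^ 'd" assume "u \<in> space haar"
        then have "\<bar>F u\<bar> \<le> B" using B unit_cube_subset by auto
        with abs_mode_le[of k a u] show "norm (F u * mode k a u) \<le> B"
          using mult_mono[of "\<bar>F u\<bar>" B "\<bar>mode k a u\<bar>" 1] by (simp add: abs_mult)
      qed
      show "(\<lambda>u. F u * mode k a u) \<in> borel_measurable haar"
        using that by (intro haar_measurable borel_measurable_times borel_measurable_continuous_onI torus_cont_measurable mode_torus_cont)
    qed
  qed
  have slice: "continuous_on UNIV (\<lambda>u. F s u)" if "continuous_on UNIV (\<lambda>(s, u). F s u)" for F :: "real \<Rightarrow> real ^ 'd \<Rightarrow> real" and s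
  proof -
    have "continuous_on UNIV (\<lambda>u. (\<lambda>(s, u). F s u) (s, u))"
      by (rule continuous_on_compose2[OF that]) (auto intro!: continuous_intros)
    then show ?thesis by simp
  qed
  have iT: "integrable haar (\<lambda>u. T (max 0 s) u * mode k a u)" "integrable haar (\<lambda>u. L (max 0 s) u * mode k a u)"
      "integrable haar (\<lambda>u. G (max 0 s) u * mode k a u)" for s
    using sl[OF slice[OF ct(1), of s]] sl[OF slice[OF ct(2), of s]] sl[OF slice[OF ct(3), of s]] by simp_all
  have "(\<integral>(s, u). (T (max 0 s) u + L (max 0 s) u) * (e s * mode k a u) \<partial>?P)
      = (\<integral>s. \<integral>u. (T (max 0 s) u + L (max 0 s) u) * (e s * mode k a u) \<partial>haar \<partial>time_interval t)"
    using time_space.integral_fst[OF i1] by simp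
  also have "\<dots> = (\<integral>s. \<integral>u. (T (max 0 s) u - rate k * G (max 0 s) u) * e s * mode k a u \<partial>haar \<partial>time_interval t)"
  proof (rule Bochner_Integration.integral_cong[OF refl])
    fix s
    have "(\<integral>u. (T (max 0 s) u + L (max 0 s) u) * (e s * mode k a u) \<partial>haar)
        = (\<integral>u. e s * (T (max 0 s) u * mode k a u) + e s * (L (max 0 s) u * mode k a u) \<partial>haar)"
      by (simp add: algebra_simps)
    also have "\<dots> = e s * (\<integral>u. T (max 0 s) u * mode k a u \<partial>haar) + e s * (\<integral>u. L (max 0 s) u * mode k a u \<partial>haar)"
      by (subst Bochner_Integration.integral_add) (auto intro!: integrable_mult_right iT)
    also have "\<dots> = e s * (\<integral>u. T (max 0 s) u * mode k a u \<partial>haar) - e s * rate k * (\<integral>u. G (max 0 s) u * mode k a u \<partial>haar)"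
      by (subst L) auto
    also have "\<dots> = (\<integral>u. e s * (T (max 0 s) u * mode k a u) - e s * rate k * (G (max 0 s) u * mode k a u) \<partial>haar)"
      by (subst Bochner_Integration.integral_diff) (auto intro!: integrable_mult_right iT)
    also have "\<dots> = (\<integral>u. (T (max 0 s) u - rate k * G (max 0 s) u) * e s * mode k a u \<partial>haar)"
      by (simp add: algebra_simps)
    finally show "(\<integral>u. (T (max 0 s) u + L (max 0 s) u) * (e s * mode k a u) \<partial>haar)
      = (\<integral>u. (T (max 0 s) u - rate k * G (max 0 s) u) * e s * mode k a u \<partial>haar)" .
  qed
  \<comment> \<open>The replacement of L needs the space integral inside, the fundamental theorem
    needs the time integral inside; Fubini passes from one order to the other.\<close>
  also have "\<dots> = (\<integral>u. \<integral>s. (T (max 0 s) u - rate k * G (max 0 s) u) * e s * mode k a u \<partial>time_interval t \<partial>haar)"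
    using time_space.Fubini_integral[OF i2] by simp
  also have "\<dots> = (\<integral>u. G t u * (e t * mode k a u) - G 0 u * (c * mode k a u) \<partial>haar)"
  proof (intro Bochner_Integration.integral_cong refl)
    fix u
    let ?f = "\<lambda>s. (T (max 0 s) u - rate k * G (max 0 s) u) * e s"
    have slice': "continuous_on S (\<lambda>s. F s u)" if "continuous_on UNIV (\<lambda>(s, u). F s u)" for F :: "real \<Rightarrow> real ^ 'd \<Rightarrow> real" and S
    proof -
      have "continuous_on S (\<lambda>s. (\<lambda>(s, u). F s u) (s, u))"
        by (rule continuous_on_compose2[OF that]) (auto intro!: continuous_intros)
      then show ?thesis by simp
    qed
    have "integral\<^sup>L lborel (\<lambda>s. indicator {0..t} s *\<^sub>R ?f s) = G t u * e t - G 0 u * e 0"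
    proof (rule integral_FTC_atLeastAtMost[OF t])
      fix s assume s: "0 \<le> s" "s \<le> t"
      have "((\<lambda>r. G r u) has_real_derivative T s u) (at s within {0..t})"
        using has_vector_derivative_within_subset[OF T[OF s(1)], of "{0..t}"]
        by (simp add: has_real_derivative_iff_has_vector_derivative)
      then have "((\<lambda>s. G s u * e s) has_real_derivative ?f s) (at s within {0..t})"
        unfolding e_def using s by (auto intro!: derivative_eq_intros simp: algebra_simps)
      then show "((\<lambda>s. G s u * e s) has_vector_derivative ?f s) (at s within {0..t})"
        by (simp add: has_real_derivative_iff_has_vector_derivative)
    next
      show "continuous_on {0..t} ?f"
        unfolding e_def by (intro continuous_intros slice' ct)
    qed
    then have I: "(\<integral>s. ?f s \<partial>time_interval t) = G t u * e t - G 0 u * e 0"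
      by (simp add: integral_restrict_space)
    show "(\<integral>s. ?f s * mode k a u \<partial>time_interval t) = G t u * (e t * mode k a u) - G 0 u * (c * mode k a u)"
      unfolding integral_mult_left_zero I by (simp add: e_def algebra_simps)
  qed
  also have "\<dots> = (\<integral>u. G t u * (e t * mode k a u) \<partial>haar) - (\<integral>u. G 0 u * (c * mode k a u) \<partial>haar)"
    using G[OF t] G[of 0] by (intro Bochner_Integration.integral_diff) (auto intro!: haar_integrable torus_cont_mult torus_cont_const mode_torus_cont)
  finally show ?case by (simp add: e_def)
next
  case (heat_add g h g' h')
  let ?P = "time_interval t \<Otimes>\<^sub>M (haar :: (real ^ 'd) measure)"
  have i: "integrable ?P (\<lambda>(s, u). (T (max 0 s) u + L (max 0 s) u) * h s u)" if "heat_flow g h" for g h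
  proof -
    have c: "continuous_on UNIV (\<lambda>(s, u). (T (max 0 s) u + L (max 0 s) u) * h s u)"
      using continuous_clamp[OF contT] continuous_clamp[OF contL] heat_flow_continuous[OF that]
      unfolding case_prod_beta by (intro continuous_intros)
    obtain B where "\<And>s u. 0 \<le> s \<Longrightarrow> s \<le> t \<Longrightarrow> u \<in> unit_cube \<Longrightarrow> \<bar>(T (max 0 s) u + L (max 0 s) u) * h s u\<bar> \<le> B"
      using time_space_bounded[OF c] by metis
    then show ?thesis
      by (intro time_space_integrable[of _ t B] borel_measurable_continuous_onI c) simp
  qed
  have hc: "h t \<in> torus_cont" "h' t \<in> torus_cont" "g \<in> torus_cont" "g' \<in> torus_cont"
    using heat_add.hyps heat_flow_torus_cont heat_flow_0 by metis+
  have "(\<integral>(s, u). (T (max 0 s) u + L (max 0 s) u) * (h s u + h' s u) \<partial>?P)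
     = (\<integral>z. (case z of (s, u) \<Rightarrow> (T (max 0 s) u + L (max 0 s) u) * h s u) + (case z of (s, u) \<Rightarrow> (T (max 0 s) u + L (max 0 s) u) * h' s u) \<partial>?P)"
    by (intro Bochner_Integration.integral_cong refl) (auto simp: distrib_left)
  also have "\<dots> = (\<integral>(s, u). (T (max 0 s) u + L (max 0 s) u) * h s u \<partial>?P) + (\<integral>(s, u). (T (max 0 s) u + L (max 0 s) u) * h' s u \<partial>?P)"
    using i[OF heat_add.hyps(1)] i[OF heat_add.hyps(2)] by (rule Bochner_Integration.integral_add)
  also have "\<dots> = (\<integral>u. G t u * (h t u + h' t u) \<partial>haar) - (\<integral>u. G 0 u * (g u + g' u) \<partial>haar)"
    unfolding heat_add.IH[symmetric] distrib_left
    using hc G[OF t] G[of 0] by (subst (1 2) Bochner_Integration.integral_add) (auto intro!: haar_integrable torus_cont_mult)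
  finally show ?case ..
qed

end

subsection \<open>Existence and uniqueness of bounded weak solutions\<close>

context symmetric_jump
begin

text \<open>Flows of approximating trigonometric polynomials are uniformly Cauchy by the
  contraction, and the weak identity passes to their limit by dominated convergence. Continuity and
  sign of this particular solution are recorded because uniqueness then carries them, almost
  everywhere, to every other one.\<close>

lemma bounded_weak_solution_exists:
  assumes \<rho>0: "\<rho>0 \<in> torus_cont"
  obtains \<sigma> where "bounded_weak_solution (covariance p) \<rho>0 \<sigma>"
    "\<And>t. 0 \<le> t \<Longrightarrow> \<sigma> t \<in> torus_cont"
    "\<And>t u. 0 \<le> t \<Longrightarrow> (\<And>v. 0 \<le> \<rho>0 v) \<Longrightarrow> 0 \<le> \<sigma> t u"
proof -
  have "\<exists>q h. heat_flow q h \<and> (\<forall>u. \<bar>\<rho>0 u - q u\<bar> < 1 / (real n + 1))" for n :: nat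
  proof -
    obtain q where "trig_poly q" "\<And>u. \<bar>\<rho>0 u - q u\<bar> < 1 / (real n + 1)"
      using trig_poly_dense[OF \<rho>0, of "1 / (real n + 1)"] by auto
    then show ?thesis using heat_flow_exists by blast
  qed
  then obtain q h where flow: "\<And>n. heat_flow (q n) (h n)" and q: "\<And>n u. \<bar>\<rho>0 u - q n u\<bar> < 1 / (real n + 1)"
    by metis
  have small: "(\<lambda>n. 1 / (real n + 1)) \<longlonglongrightarrow> 0"
    using LIMSEQ_inverse_real_of_nat by (simp add: inverse_eq_divide add.commute)
  have cauchy: "\<bar>h n t u - h m t u\<bar> \<le> 1 / (real n + 1) + 1 / (real m + 1)" if "0 \<le> t" for n m t u
  proof (rule heat_flow_diff_le[OF flow flow that])
    show "\<bar>q n u - q m u\<bar> \<le> 1 / (real n + 1) + 1 / (real m + 1)" for u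
      using q[of u n] q[of u m] by linarith
  qed
  \<comment> \<open>At negative times the sequence may diverge and the value is arbitrary; therefore
    measurability below is shown for the version with time clamped at 0.\<close>
  define \<sigma> where "\<sigma> t u = lim (\<lambda>n. h n t u)" for t u
  have lim: "(\<lambda>n. h n t u) \<longlonglongrightarrow> \<sigma> t u" if "0 \<le> t" for t u
  proof -
    have "Cauchy (\<lambda>n. h n t u)"
    proof (rule metric_CauchyI)
      fix e :: real assume "0 < e"
      then have "\<forall>\<^sub>F n in sequentially. 1 / (real n + 1) < e / 2"
        using small by (intro order_tendstoD(2)) auto
      then obtain M where M: "\<And>n. M \<le> n \<Longrightarrow> 1 / (real n + 1) < e / 2"
        by (auto simp: eventually_sequentially)
      show "\<exists>M. \<forall>m\<ge>M. \<forall>n\<ge>M. dist (h m t u) (h n t u) < e"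
      proof (intro exI[of _ M] allI impI)
        fix m n assume "M \<le> m" "M \<le> n"
        then show "dist (h m t u) (h n t u) < e"
          using cauchy[OF that, of m u n] M[of m] M[of n] by (simp add: dist_real_def)
      qed
    qed
    then show ?thesis
      unfolding \<sigma>_def by (simp add: Cauchy_convergent_iff convergent_LIMSEQ_iff)
  qed
  have unif: "\<bar>\<sigma> t u - h m t u\<bar> \<le> 1 / (real m + 1)" if "0 \<le> t" for t u m
  proof (rule LIMSEQ_le)
    show "(\<lambda>n. \<bar>h n t u - h m t u\<bar>) \<longlonglongrightarrow> \<bar>\<sigma> t u - h m t u\<bar>"
      by (intro tendsto_intros lim that)
    show "(\<lambda>n. 1 / (real n + 1) + 1 / (real m + 1)) \<longlonglongrightarrow> 1 / (real m + 1)"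
      using tendsto_add[OF small tendsto_const] by simp
  qed (use cauchy that in auto)
  obtain B where B: "0 \<le> B" "\<And>u. \<bar>\<rho>0 u\<bar> \<le> B"
    using torus_cont_bounded[OF \<rho>0] by blast
  have h_bound: "\<bar>h n t u\<bar> \<le> B + 1" if "0 \<le> t" for n t u
  proof -
    have "1 / (real n + 1) \<le> 1" by simp
    then have "q n u \<le> B + 1" "- q n u \<le> B + 1" for u
      using q[of u n] B(2)[of u] by linarith+
    then have "h n t u \<le> B + 1" "-1 * h n t u \<le> B + 1"
      using heat_flow_le[OF flow that, of n "B + 1" u]
        heat_flow_le[OF heat_flow_scale[OF flow] that, of "-1" n "B + 1" u] by auto
    then show ?thesis by (simp add: abs_le_iff)
  qed
  have \<sigma>_bound: "\<bar>\<sigma> t u\<bar> \<le> B + 1" if "0 \<le> t" for t u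
    using tendsto_rabs[OF lim[OF that]] by (rule LIMSEQ_le_const2) (use h_bound that in auto)
  have \<sigma>_torus: "\<sigma> t \<in> torus_cont" if "0 \<le> t" for t
  proof -
    have "uniform_limit UNIV (\<lambda>n. h n t) (\<sigma> t) sequentially"
    proof (rule uniform_limitI)
      fix e :: real assume "0 < e"
      then have "\<forall>\<^sub>F n in sequentially. 1 / (real n + 1) < e"
        using small by (intro order_tendstoD(2)) auto
      then show "\<forall>\<^sub>F n in sequentially. \<forall>u\<in>UNIV. dist (h n t u) (\<sigma> t u) < e"
      proof eventually_elim
        case (elim n)
        then show ?case using unif[OF that, of _ n]
          by (auto simp: dist_real_def abs_minus_commute intro: order.strict_trans1)
      qed
    qed
    then have "continuous_on UNIV (\<sigma> t)"
      by (rule uniform_limit_theorem[rotated])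
        (use heat_flow_torus_cont[OF flow] in \<open>auto simp: torus_cont_def\<close>)
    moreover have "\<sigma> t (u + real_vec z) = \<sigma> t u" for u z
      using heat_flow_torus_cont[OF flow] by (simp add: \<sigma>_def torus_cont_def periodic_def)
    ultimately show ?thesis by (simp add: torus_cont_def periodic_def)
  qed
  have \<sigma>_nonneg: "0 \<le> \<sigma> t u" if "0 \<le> t" "\<And>v. 0 \<le> \<rho>0 v" for t u
  proof -
    \<comment> \<open>\<open>q n\<close> lies above -1/(n+1) because the profile is nonnegative; the
      maximum principle for the negated flow keeps this lower bound, which disappears in the
      limit.\<close>
    have "- h n t u \<le> 1 / (real n + 1)" for n
    proof -
      have "-1 * q n v \<le> 1 / (real n + 1)" for v
        using q[of v n] that(2)[of v] by linarith
      from heat_flow_le[OF heat_flow_scale[OF flow] that(1) this] show ?thesis by simp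
    qed
    then have "- \<sigma> t u \<le> 0"
      by (intro LIMSEQ_le[OF tendsto_minus[OF lim[OF that(1)]] small]) auto
    then show ?thesis by simp
  qed
  have h_meas: "(\<lambda>z. h n (max 0 (fst z)) (snd z)) \<in> borel_measurable borel" for n
  proof -
    have "continuous_on UNIV (\<lambda>(s, u). h n (max 0 s) u)"
      by (intro continuous_clamp continuous_on_subset[OF heat_flow_continuous[OF flow]]) auto
    then show ?thesis
      by (intro borel_measurable_continuous_onI) (simp add: case_prod_beta)
  qed
  have \<sigma>_meas: "(\<lambda>z. \<sigma> (max 0 (fst z)) (snd z)) \<in> borel_measurable borel"
    by (rule borel_measurable_LIMSEQ_real[OF _ h_meas]) (auto intro: lim)
  have "bounded_weak_solution (covariance p) \<rho>0 \<sigma>"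
    unfolding bounded_weak_solution_def set_integral_unit_cube set_integral_time
  proof (intro conjI allI impI)
    have "(\<lambda>z. \<sigma> (max 0 (fst z)) (snd z)) \<in> borel_measurable (restrict_space borel ({0..} \<times> UNIV))"
      using \<sigma>_meas by (rule measurable_restrict_space1)
    then show "(\<lambda>(t, u). \<sigma> t u) \<in> borel_measurable (restrict_space borel ({0..} \<times> UNIV))"
      by (rule measurable_cong[THEN iffD1, rotated]) (auto simp: space_restrict_space)
    show "periodic (\<sigma> t)" if "0 \<le> t" for t
      using \<sigma>_torus[OF that] by (simp add: torus_cont_def)
    show "\<exists>K. \<forall>t\<ge>0. \<forall>u. \<bar>\<sigma> t u\<bar> \<le> K"
      using \<sigma>_bound by blast
    fix G :: "real \<Rightarrow> real ^ 'd \<Rightarrow> real" and t :: real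
    assume "test_function G" and t: "0 \<le> t"
    from this(1) obtain T L where
      contT: "continuous_on ({0..} \<times> UNIV) (\<lambda>(s, u). T s u)" and contL: "continuous_on ({0..} \<times> UNIV) (\<lambda>(s, u). L s u)"
      and T: "\<And>s u. 0 \<le> s \<Longrightarrow> ((\<lambda>r. G r u) has_vector_derivative T s u) (at s within {0..})"
      and TL: "\<And>s u. 0 \<le> s \<Longrightarrow> vector_derivative (\<lambda>r. G r u) (at s within {0..}) + 1 / 2 * laplacian (covariance p) (G s) u = T s u + L s u"
      and L: "\<And>s k a. 0 \<le> s \<Longrightarrow> (\<integral>u. L s u * mode k a u \<partial>haar) = - rate k * (\<integral>u. G s u * mode k a u \<partial>haar)"
      and contG: "continuous_on ({0..} \<times> UNIV) (\<lambda>(s, u). G s u)" and G: "\<And>s. 0 \<le> s \<Longrightarrow> G s \<in> torus_cont"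
      by (rule test_function_data) blast
    let ?P = "time_interval t \<Otimes>\<^sub>M (haar :: (real ^ 'd) measure)"
    define W where "W s u = T (max 0 s) u + L (max 0 s) u" for s u
    have contW: "continuous_on UNIV (\<lambda>(s, u). W s u)"
      using continuous_clamp[OF contT] continuous_clamp[OF contL]
      unfolding case_prod_beta W_def by (intro continuous_intros)
    obtain K where K: "0 \<le> K" "\<And>s u. 0 \<le> s \<Longrightarrow> s \<le> t \<Longrightarrow> u \<in> unit_cube \<Longrightarrow> \<bar>W s u\<bar> \<le> K"
      using time_space_bounded[OF contW, of t] by metis
    have W_meas: "(\<lambda>z. W (fst z) (snd z)) \<in> borel_measurable borel"
      using contW by (intro borel_measurable_continuous_onI) (simp add: case_prod_beta)
    have eq: "(\<integral>u. G t u * h n t u \<partial>haar) - (\<integral>u. G 0 u * q n u \<partial>haar) = (\<integral>z. W (fst z) (snd z) * h n (max 0 (fst z)) (snd z) \<partial>?P)" for n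
    proof -
      have "(\<integral>z. W (fst z) (snd z) * h n (max 0 (fst z)) (snd z) \<partial>?P) = (\<integral>(s, u). W s u * h n s u \<partial>?P)"
        by (intro Bochner_Integration.integral_cong refl) (auto simp: space_time_space)
      then show ?thesis
        using heat_flow_weak[OF contT contL contG T L G flow t] by (simp add: W_def)
    qed
    have lhs: "(\<lambda>n. \<integral>u. F u * f n u \<partial>haar) \<longlonglongrightarrow> (\<integral>u. F u * f' u \<partial>haar)"
      if "F \<in> torus_cont" "\<And>n. f n \<in> torus_cont" "f' \<in> torus_cont" "\<And>n u. \<bar>f n u\<bar> \<le> B + 1" "\<And>u. (\<lambda>n. f n u) \<longlonglongrightarrow> f' u" for F f f'
    proof -
      obtain b where b: "0 \<le> b" "\<And>u. \<bar>F u\<bar> \<le> b"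
        using torus_cont_bounded[OF \<open>F \<in> torus_cont\<close>] by blast
      show ?thesis
      proof (rule integral_dominated_convergence[where w = "\<lambda>_. b * (B + 1)"])
        show "(\<lambda>u. F u * f' u) \<in> borel_measurable haar" "(\<lambda>u. F u * f n u) \<in> borel_measurable haar" for n
          using that by (auto intro!: haar_measurable torus_cont_measurable torus_cont_mult)
        show "AE u in haar. (\<lambda>n. F u * f n u) \<longlonglongrightarrow> F u * f' u"
          using that(5) by (intro AE_I2 tendsto_mult tendsto_const)
        show "AE u in haar. norm (F u * f n u) \<le> b * (B + 1)" for n
          unfolding real_norm_def abs_mult using b that(4) by (intro AE_I2 mult_mono) auto
      qed simp
    qed
    have "(\<lambda>n. (\<integral>u. G t u * h n t u \<partial>haar) - (\<integral>u. G 0 u * q n u \<partial>haar)) \<longlonglongrightarrow>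
      (\<integral>u. G t u * \<sigma> t u \<partial>haar) - (\<integral>u. G 0 u * \<rho>0 u \<partial>haar)"
    proof (intro tendsto_diff lhs G t order.refl \<sigma>_torus \<rho>0 h_bound lim heat_flow_torus_cont[OF flow])
      show "q n \<in> torus_cont" for n
        using heat_flow_torus_cont[OF flow] heat_flow_0[OF flow] by metis
      show "\<bar>q n u\<bar> \<le> B + 1" for n u
        using h_bound[of 0 n u] heat_flow_0[OF flow] by simp
      show "(\<lambda>n. q n u) \<longlonglongrightarrow> \<rho>0 u" for u
      proof (rule LIM_zero_cancel, rule Lim_null_comparison[OF _ small])
        show "\<forall>\<^sub>F n in sequentially. norm (q n u - \<rho>0 u) \<le> 1 / (real n + 1)"
          using q[of u] by (intro always_eventually) (auto simp: abs_minus_commute less_imp_le)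
      qed
    qed
    moreover have "(\<lambda>n. \<integral>z. W (fst z) (snd z) * h n (max 0 (fst z)) (snd z) \<partial>?P) \<longlonglongrightarrow>
      (\<integral>z. W (fst z) (snd z) * \<sigma> (max 0 (fst z)) (snd z) \<partial>?P)"
    proof (rule integral_dominated_convergence[where w = "\<lambda>_. K * (B + 1)"])
      show "(\<lambda>z. W (fst z) (snd z) * \<sigma> (max 0 (fst z)) (snd z)) \<in> borel_measurable ?P"
        "(\<lambda>z. W (fst z) (snd z) * h n (max 0 (fst z)) (snd z)) \<in> borel_measurable ?P" for n
        by (intro time_space_measurable borel_measurable_times W_meas \<sigma>_meas h_meas)+
      show "AE z in ?P. (\<lambda>n. W (fst z) (snd z) * h n (max 0 (fst z)) (snd z)) \<longlonglongrightarrow> W (fst z) (snd z) * \<sigma> (max 0 (fst z)) (snd z)"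
        by (intro AE_I2 tendsto_mult tendsto_const lim) simp
      show "AE z in ?P. norm (W (fst z) (snd z) * h n (max 0 (fst z)) (snd z)) \<le> K * (B + 1)" for n
        unfolding real_norm_def abs_mult using K h_bound B(1)
        by (intro AE_I2 mult_mono) (auto simp: space_time_space)
      show "integrable ?P (\<lambda>_. K * (B + 1))"
        by (rule time_space_integrable[where B = "\<bar>K * (B + 1)\<bar>"]) auto
    qed
    ultimately have limit: "(\<integral>u. G t u * \<sigma> t u \<partial>haar) - (\<integral>u. G 0 u * \<rho>0 u \<partial>haar)
        = (\<integral>z. W (fst z) (snd z) * \<sigma> (max 0 (fst z)) (snd z) \<partial>?P)"
      unfolding eq by (rule LIMSEQ_unique)
    have int: "integrable ?P (\<lambda>(s, u). W s u * \<sigma> (max 0 s) u)"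
    proof (rule time_space_integrable[where B = "K * (B + 1)"])
      show "(\<lambda>(s, u). W s u * \<sigma> (max 0 s) u) \<in> borel_measurable borel"
        unfolding case_prod_beta by (intro borel_measurable_times W_meas \<sigma>_meas)
      show "\<bar>case (s, u) of (s, u) \<Rightarrow> W s u * \<sigma> (max 0 s) u\<bar> \<le> K * (B + 1)" if "0 \<le> s" "s \<le> t" "u \<in> unit_cube" for s u
        unfolding prod.case abs_mult using K \<sigma>_bound that by (intro mult_mono) auto
    qed
    have "(\<integral>s. \<integral>u. (vector_derivative (\<lambda>r. G r u) (at s within {0..}) + 1 / 2 * laplacian (covariance p) (G s) u) * \<sigma> s u \<partial>haar \<partial>time_interval t)
       = (\<integral>s. \<integral>u. W s u * \<sigma> (max 0 s) u \<partial>haar \<partial>time_interval t)"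
    proof (rule Bochner_Integration.integral_cong[OF refl])
      fix s assume "s \<in> space (time_interval t)"
      then have s: "0 \<le> s" by (simp add: space_restrict_space)
      show "(\<integral>u. (vector_derivative (\<lambda>r. G r u) (at s within {0..}) + 1 / 2 * laplacian (covariance p) (G s) u) * \<sigma> s u \<partial>haar)
        = (\<integral>u. W s u * \<sigma> (max 0 s) u \<partial>haar)"
        unfolding TL[OF s] using s by (simp add: W_def)
    qed
    also have "\<dots> = (\<integral>z. W (fst z) (snd z) * \<sigma> (max 0 (fst z)) (snd z) \<partial>?P)"
      using time_space.integral_fst[OF int] by (simp add: split_beta')
    finally show "(\<integral>u. G t u * \<sigma> t u \<partial>haar) - (\<integral>u. G 0 u * \<rho>0 u \<partial>haar)
      = (\<integral>s. \<integral>u. (vector_derivative (\<lambda>r. G r u) (at s within {0..}) + 1 / 2 * laplacian (covariance p) (G s) u) * \<sigma> s u \<partial>haar \<partial>time_interval t)"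
      using limit by simp
  qed
  then show thesis using that \<sigma>_torus \<sigma>_nonneg by blast
qed

text \<open>The link between the eigenvalue seen by the random walk and the coefficients of the
  limiting equation.\<close>

lemma half_covariance_form:
  "1 / 2 * (\<Sum>i\<in>UNIV. \<Sum>j\<in>UNIV. covariance p i j * (2 * pi * real_of_int (k $ i)) * (2 * pi * real_of_int (k $ j))) = rate k"
proof -
  have "(real_vec k \<bullet> real_vec z)\<^sup>2
      = (\<Sum>i\<in>UNIV. \<Sum>j\<in>UNIV. real_of_int (k $ i) * real_of_int (z $ i) * (real_of_int (k $ j) * real_of_int (z $ j)))" for z
    by (simp add: power2_eq_square inner_vec_def sum_product)
  then have "rate k = (\<Sum>z\<in>set_pmf p. \<Sum>i\<in>UNIV. \<Sum>j\<in>UNIV. 2 * pi\<^sup>2 * (pmf p z *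
      (real_of_int (k $ i) * real_of_int (z $ i) * (real_of_int (k $ j) * real_of_int (z $ j)))))"
    by (simp only: rate_def sum_distrib_left)
  also have "\<dots> = (\<Sum>i\<in>UNIV. \<Sum>z\<in>set_pmf p. \<Sum>j\<in>UNIV. 2 * pi\<^sup>2 * (pmf p z *
      (real_of_int (k $ i) * real_of_int (z $ i) * (real_of_int (k $ j) * real_of_int (z $ j)))))"
    by (rule sum.swap)
  also have "\<dots> = (\<Sum>i\<in>UNIV. \<Sum>j\<in>UNIV. \<Sum>z\<in>set_pmf p. 2 * pi\<^sup>2 * (pmf p z *
      (real_of_int (k $ i) * real_of_int (z $ i) * (real_of_int (k $ j) * real_of_int (z $ j)))))"
    by (intro sum.cong refl) (rule sum.swap)
  also have "\<dots> = 1 / 2 * (\<Sum>i\<in>UNIV. \<Sum>j\<in>UNIV. covariance p i j * (2 * pi * real_of_int (k $ i)) * (2 * pi * real_of_int (k $ j)))"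
    unfolding covariance_def sum_distrib_left sum_distrib_right by (intro sum.cong refl) (simp add: power2_eq_square)
  finally show ?thesis ..
qed

text \<open>Testing with the backward heat flow of a Fourier mode.\<close>

lemma weak_solution_mode:
  assumes sol: "bounded_weak_solution (covariance p) \<rho>0 \<rho>" and t: "0 \<le> t"
  shows "(\<integral>u. mode k a u * \<rho> t u \<partial>haar) = exp (- rate k * t) * (\<integral>u. mode k a u * \<rho>0 u \<partial>haar)"
proof -
  define \<kappa> where "\<kappa> = (2 * pi) *\<^sub>R real_vec k"
  define l where "l = rate k"
  \<comment> \<open>The time derivative contributes l G and the half Laplacian - l G, so the right
    side of the weak identity vanishes. At s = t this is the mode, at s = 0 the mode times exp(- l
    t).\<close>
  define G where "G s u = exp (l * (s - t)) * cos (\<kappa> \<bullet> u + a)" for s and u :: "real ^ 'd"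
  have G_mode: "G s u = exp (l * (s - t)) * mode k a u" for s u
    by (simp add: G_def mode_def \<kappa>_def)
  let ?E = "\<lambda>z :: real \<times> (real ^ 'd). exp (l * (fst z - t))"
    and ?S = "\<lambda>z :: real \<times> (real ^ 'd). sin (\<kappa> \<bullet> snd z + a)" and ?C = "\<lambda>z :: real \<times> (real ^ 'd). cos (\<kappa> \<bullet> snd z + a)"
  have "C2_on ({0..} \<times> UNIV) (\<lambda>(s, u). G s u)"
    unfolding C2_on_def
  proof (intro exI conjI ballI allI)
    fix z :: "real \<times> (real ^ 'd)" assume "z \<in> {0..} \<times> UNIV"
    show "((\<lambda>(s, u). G s u) has_derivative (\<lambda>v. l * fst v * ?E z * ?C z
        - (\<kappa> \<bullet> snd v) * ?E z * ?S z)) (at z within {0..} \<times> UNIV)"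
      unfolding G_def case_prod_beta
      by (auto intro!: derivative_eq_intros simp: algebra_simps)
  next
    fix v z :: "real \<times> (real ^ 'd)" assume "z \<in> {0..} \<times> UNIV"
    show "((\<lambda>z. l * fst v * ?E z * ?C z
        - (\<kappa> \<bullet> snd v) * ?E z * ?S z) has_derivative
      (\<lambda>w. l * fst v * (l * fst w * ?E z * ?C z - (\<kappa> \<bullet> snd w) * ?E z * ?S z)
        - (\<kappa> \<bullet> snd v) * (l * fst w * ?E z * ?S z + (\<kappa> \<bullet> snd w) * ?E z * ?C z)))
      (at z within {0..} \<times> UNIV)"
      by (auto intro!: derivative_eq_intros simp: algebra_simps)
  next
    fix v w :: "real \<times> (real ^ 'd)"
    show "continuous_on ({0..} \<times> UNIV) (\<lambda>z. l * fst v * (l * fst w * ?E z * ?C z - (\<kappa> \<bullet> snd w) * ?E z * ?S z)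
        - (\<kappa> \<bullet> snd v) * (l * fst w * ?E z * ?S z + (\<kappa> \<bullet> snd w) * ?E z * ?C z))"
      by (intro continuous_intros)
  qed
  moreover have "periodic (G s)" for s
    unfolding periodic_def G_mode by (simp add: mode_periodic)
  ultimately have "test_function G" by (simp add: test_function_def)
  then have eq: "(\<integral>u. G t u * \<rho> t u \<partial>haar) - (\<integral>u. G 0 u * \<rho>0 u \<partial>haar)
      = (\<integral>s. \<integral>u. (vector_derivative (\<lambda>r. G r u) (at s within {0..}) + 1 / 2 * laplacian (covariance p) (G s) u) * \<rho> s u \<partial>haar \<partial>time_interval t)"
    using sol t unfolding bounded_weak_solution_def set_integral_unit_cube set_integral_time by blast
  have "vector_derivative (\<lambda>r. G r u) (at s within {0..}) + 1 / 2 * laplacian (covariance p) (G s) u = 0" if s: "0 \<le> s" for s u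
  proof -
    have "((\<lambda>r. G r u) has_real_derivative l * G s u) (at s within {0..})"
      unfolding G_def by (auto intro!: derivative_eq_intros)
    then have "((\<lambda>r. G r u) has_vector_derivative l * G s u) (at s within {0..})"
      by (simp add: has_real_derivative_iff_has_vector_derivative)
    then have 1: "vector_derivative (\<lambda>r. G r u) (at s within {0..}) = l * G s u"
      by (rule vector_derivative_within[OF at_within_atLeast_neq_bot[OF s]])
    have "(G s has_derivative (\<lambda>w. - (exp (l * (s - t)) * sin (\<kappa> \<bullet> u + a) * (\<kappa> \<bullet> w)))) (at u)" for u
      unfolding G_def by (auto intro!: derivative_eq_intros simp: algebra_simps)
    from partial_eq[OF this] have p1: "partial j (G s) = (\<lambda>u. - (exp (l * (s - t)) * sin (\<kappa> \<bullet> u + a) * \<kappa> $ j))" for j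
      by (auto simp: inner_axis)
    have "((\<lambda>u. - (exp (l * (s - t)) * sin (\<kappa> \<bullet> u + a) * \<kappa> $ j)) has_derivative
        (\<lambda>w. - (exp (l * (s - t)) * cos (\<kappa> \<bullet> u + a) * (\<kappa> \<bullet> w) * \<kappa> $ j))) (at u)" for u j
      by (auto intro!: derivative_eq_intros simp: algebra_simps)
    from partial_eq[OF this] have "partial i (partial j (G s)) u = - G s u * \<kappa> $ i * \<kappa> $ j" for i j
      unfolding p1 by (simp add: inner_axis G_def)
    then have "laplacian (covariance p) (G s) u = - G s u * (\<Sum>i\<in>UNIV. \<Sum>j\<in>UNIV. covariance p i j * \<kappa> $ i * \<kappa> $ j)"
      by (simp add: laplacian_def sum_distrib_left mult_ac sum_negf)
    also have "\<dots> = - 2 * G s u * l"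
      using half_covariance_form[of k] by (simp add: \<kappa>_def l_def)
    finally show ?thesis using 1 by simp
  qed
  then have "(\<integral>s. \<integral>u. (vector_derivative (\<lambda>r. G r u) (at s within {0..}) + 1 / 2 * laplacian (covariance p) (G s) u) * \<rho> s u \<partial>haar \<partial>time_interval t)
      = (\<integral>s. 0 \<partial>time_interval t)"
    by (intro Bochner_Integration.integral_cong[OF refl]) (simp add: space_restrict_space)
  then have "(\<integral>u. G t u * \<rho> t u \<partial>haar) = (\<integral>u. G 0 u * \<rho>0 u \<partial>haar)"
    using eq by simp
  then show ?thesis by (simp add: G_mode l_def mult.assoc mult.commute[of t])
qed

lemma weak_solution_borel:
  assumes "bounded_weak_solution C \<rho>0 \<rho>" "0 \<le> t"
  shows "\<rho> t \<in> borel_measurable borel"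
proof -
  have "(\<lambda>u. (t, u)) \<in> measurable borel (restrict_space borel ({0..} \<times> UNIV))"
    using assms(2) by (intro measurable_restrict_space2 borel_measurable_continuous_onI continuous_intros) auto
  moreover have "(\<lambda>(t, u). \<rho> t u) \<in> borel_measurable (restrict_space borel ({0..} \<times> UNIV))"
    using assms(1) by (simp add: bounded_weak_solution_def)
  ultimately have "(\<lambda>u. case (t, u) of (t, u) \<Rightarrow> \<rho> t u) \<in> borel_measurable borel"
    by (rule measurable_compose)
  then show ?thesis by simp
qed

text \<open>Equal Fourier coefficients give equal pairings with trigonometric polynomials, and by
  density with all continuous functions. Solutions are only bounded and measurable, so equality
  almost everywhere is the natural conclusion.\<close>

lemma weak_solution_unique:
  assumes \<rho>: "bounded_weak_solution (covariance p) \<rho>0 \<rho>" and \<sigma>: "bounded_weak_solution (covariance p) \<rho>0 \<sigma>" and t: "0 \<le> t"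
  shows "AE u in haar. \<rho> t u = \<sigma> t u"
proof -
  obtain K K' where "\<And>u. \<bar>\<rho> t u\<bar> \<le> K" "\<And>u. \<bar>\<sigma> t u\<bar> \<le> K'"
    using \<rho> \<sigma> t unfolding bounded_weak_solution_def by metis
  then have b: "\<bar>\<rho> t u\<bar> \<le> max K K'" "\<bar>\<sigma> t u\<bar> \<le> max K K'" for u
    by (meson le_max_iff_disj)+
  note m = weak_solution_borel[OF \<rho> t] weak_solution_borel[OF \<sigma> t]
  have K0: "0 \<le> max K K'" using b(1)[of 0] by linarith
  have int: "integrable haar (\<lambda>u. g u * r u)" if "g \<in> torus_cont" "r \<in> borel_measurable borel" "\<And>u. \<bar>r u\<bar> \<le> max K K'" for g r
  proof -
    obtain B where "0 \<le> B" "\<And>u. \<bar>g u\<bar> \<le> B" using torus_cont_bounded[OF \<open>g \<in> torus_cont\<close>] by blast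
    then have "\<bar>g u * r u\<bar> \<le> B * max K K'" for u
      unfolding abs_mult using that(3) by (intro mult_mono) auto
    then show ?thesis
      by (intro haar_integrable_bounded borel_measurable_times that(2) torus_cont_measurable[OF that(1)])
  qed
  have trig: "q \<in> torus_cont \<and> (\<integral>u. q u * \<rho> t u \<partial>haar) = (\<integral>u. q u * \<sigma> t u \<partial>haar)" if "trig_poly q" for q
    using that
  proof (induction rule: trig_poly.induct)
    case (trig_mode c k a)
    show ?case
      using weak_solution_mode[OF \<rho> t] weak_solution_mode[OF \<sigma> t]
      by (auto simp: mult.assoc intro: torus_cont_mult)
  next
    case (trig_add g h)
    then show ?case using int[OF _ m(1) b(1)] int[OF _ m(2) b(2)]
      by (auto simp: distrib_right intro: torus_cont_add)
  qed
  have "(\<integral>u. g u * \<rho> t u \<partial>haar) = (\<integral>u. g u * \<sigma> t u \<partial>haar)" if g: "g \<in> torus_cont" for g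
  proof (rule ccontr)
    let ?d = "\<bar>(\<integral>u. g u * \<rho> t u \<partial>haar) - (\<integral>u. g u * \<sigma> t u \<partial>haar)\<bar>"
    assume "(\<integral>u. g u * \<rho> t u \<partial>haar) \<noteq> (\<integral>u. g u * \<sigma> t u \<partial>haar)"
    \<comment> \<open>Each of the two solutions contributes an error of at most this tolerance times
      max K K', in total \<open>?d\<close> times a factor below 1. The added 1 keeps the quotient
      meaningful when the bound is 0.\<close>
    then have "0 < ?d / (2 * (max K K' + 1))"
      using K0 by (intro divide_pos_pos) auto
    then obtain q where q: "trig_poly q" "\<And>u. \<bar>g u - q u\<bar> < ?d / (2 * (max K K' + 1))"
      using trig_poly_dense[OF g] by blast
    have qt: "q \<in> torus_cont" using trig[OF q(1)] by blast
    have close: "\<bar>(\<integral>u. g u * r u \<partial>haar) - (\<integral>u. q u * r u \<partial>haar)\<bar> \<le> ?d / (2 * (max K K' + 1)) * max K K'"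
      if r: "r \<in> borel_measurable borel" "\<And>u. \<bar>r u\<bar> \<le> max K K'" for r
    proof -
      have "(\<integral>u. g u * r u \<partial>haar) - (\<integral>u. q u * r u \<partial>haar) = (\<integral>u. (g u - q u) * r u \<partial>haar)"
        using int[OF g r] int[OF qt r] by (simp add: left_diff_distrib)
      also have "\<bar>\<dots>\<bar> \<le> (\<integral>u. \<bar>(g u - q u) * r u\<bar> \<partial>haar)"
        by (rule integral_abs_bound)
      also have "\<dots> \<le> (\<integral>u. ?d / (2 * (max K K' + 1)) * max K K' \<partial>(haar :: (real ^ 'd) measure))"
      proof (rule Bochner_Integration.integral_mono)
        show "integrable haar (\<lambda>u. \<bar>(g u - q u) * r u\<bar>)"
          by (intro integrable_abs int torus_cont_diff g qt r)
        show "\<bar>(g u - q u) * r u\<bar> \<le> ?d / (2 * (max K K' + 1)) * max K K'" for u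
          unfolding abs_mult using q(2)[of u] r(2)[of u] by (intro mult_mono) auto
      qed simp
      finally show ?thesis using haar.prob_space[where ?'a = 'd] by simp
    qed
    have "?d \<le> 2 * (?d / (2 * (max K K' + 1)) * max K K')"
      using close[OF m(1) b(1)] close[OF m(2) b(2)] trig[OF q(1)] by linarith
    also have "\<dots> < ?d" using \<open>0 < ?d / (2 * (max K K' + 1))\<close> K0
      by (simp add: field_simps zero_less_mult_iff)
    finally show False by simp
  qed
  then show ?thesis by (rule haar_AE_unique[OF m b])
qed

end

subsection \<open>Finite Markov chains\<close>

text \<open>\<open>linear\<close> and \<open>local\<close> together say that on S the generator is a
  finite matrix: its value at a state of S depends only on the function on S. The ambient type may
  be infinite, as it is for configurations on Z^d.\<close>

locale finite_markov_chain =
  fixes S :: "'s set" and A :: "('s \<Rightarrow> real) \<Rightarrow> 's \<Rightarrow> real" and \<mu> :: "'s pmf"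
    and M :: "'w measure" and X :: "real \<Rightarrow> 'w \<Rightarrow> 's"
  assumes chain: "markov_chain S A \<mu> M X"
    and finite_states: "finite S"
    and init: "set_pmf \<mu> \<subseteq> S"
    and linear: "A (\<lambda>\<xi>. a * F \<xi> + G \<xi>) \<zeta> = a * A F \<zeta> + A G \<zeta>"
    and local: "(\<And>\<xi>. \<xi> \<in> S \<Longrightarrow> F \<xi> = G \<xi>) \<Longrightarrow> \<zeta> \<in> S \<Longrightarrow> A F \<zeta> = A G \<zeta>"
begin

lemma zero: "A (\<lambda>\<xi>. 0) \<zeta> = 0"
  using linear[of 1 "\<lambda>_. 0" "\<lambda>_. 0" \<zeta>] by simp

lemma linear_sum: "finite I \<Longrightarrow> A (\<lambda>\<xi>. \<Sum>i\<in>I. c i * F i \<xi>) \<zeta> = (\<Sum>i\<in>I. c i * A (F i) \<zeta>)"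
  by (induction I rule: finite_induct) (simp_all add: zero linear)

lemma scale: "A (\<lambda>\<xi>. c * F \<xi>) \<zeta> = c * A F \<zeta>"
  using linear[of c F "\<lambda>_. 0" \<zeta>] by (simp add: zero)

lemma indicator_expansion: "\<xi> \<in> S \<Longrightarrow> (\<Sum>\<zeta>\<in>S. F \<zeta> * indicator {\<zeta>} \<xi>) = (F \<xi> :: real)"
  using finite_states by (simp add: indicator_def if_distrib cong: if_cong)

text \<open>Matrix powers act by their entries. This joins iterates on a general observable to
  iterates on indicators, from which \<open>transition_prob\<close> is built.\<close>

lemma power_expansion:
  "\<xi> \<in> S \<Longrightarrow> (A ^^ k) F \<xi> = (\<Sum>\<zeta>\<in>S. F \<zeta> * (A ^^ k) (indicator {\<zeta>}) \<xi>)"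
proof (induction k arbitrary: \<xi>)
  case 0
  then show ?case by (simp add: indicator_expansion)
next
  case (Suc k)
  have "(A ^^ Suc k) F \<xi> = A (\<lambda>\<xi>. \<Sum>\<zeta>\<in>S. F \<zeta> * (A ^^ k) (indicator {\<zeta>}) \<xi>) \<xi>"
    unfolding funpow.simps comp_def by (intro local Suc)
  also have "\<dots> = (\<Sum>\<zeta>\<in>S. F \<zeta> * (A ^^ Suc k) (indicator {\<zeta>}) \<xi>)"
    by (simp add: linear_sum[OF finite_states])
  finally show ?case .
qed

text \<open>A crude operator norm, the sum of all absolute matrix entries; it serves only to make
  the exponential series converge.\<close>

definition bound :: real where
  "bound = (\<Sum>\<zeta>\<in>S. \<Sum>\<xi>\<in>S. \<bar>A (indicator {\<zeta>}) \<xi>\<bar>)"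

lemma power_bound:
  assumes "\<And>\<xi>. \<xi> \<in> S \<Longrightarrow> \<bar>F \<xi>\<bar> \<le> D" "0 \<le> D"
  shows "\<xi> \<in> S \<Longrightarrow> \<bar>(A ^^ k) F \<xi>\<bar> \<le> bound ^ k * D"
proof (induction k arbitrary: \<xi>)
  case 0
  then show ?case using assms by simp
next
  case (Suc k)
  have "\<bar>A ((A ^^ k) F) \<xi>\<bar> = \<bar>\<Sum>\<zeta>\<in>S. (A ^^ k) F \<zeta> * A (indicator {\<zeta>}) \<xi>\<bar>"
    using power_expansion[OF Suc.prems, of 1 "(A ^^ k) F"] by simp
  also have "\<dots> \<le> (\<Sum>\<zeta>\<in>S. (bound ^ k * D) * \<bar>A (indicator {\<zeta>}) \<xi>\<bar>)"
    by (intro order.trans[OF sum_abs] sum_mono) (auto simp: abs_mult intro!: mult_right_mono Suc.IH)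
  also have "\<dots> \<le> (bound ^ k * D) * bound"
    unfolding sum_distrib_left[symmetric]
  proof (rule mult_left_mono)
    show "(\<Sum>\<zeta>\<in>S. \<bar>A (indicator {\<zeta>}) \<xi>\<bar>) \<le> bound"
      unfolding bound_def using Suc.prems finite_states
      by (intro sum_mono member_le_sum[of \<xi> S "\<lambda>\<xi>. \<bar>A (indicator {_}) \<xi>\<bar>"]) auto
    have "0 \<le> bound" unfolding bound_def by (intro sum_nonneg) auto
    then show "0 \<le> bound ^ k * D" using assms(2) by simp
  qed
  finally show ?case by (simp add: mult_ac)
qed

definition moment :: "('s \<Rightarrow> real) \<Rightarrow> nat \<Rightarrow> real" where
  "moment F k = (\<Sum>\<xi>\<in>S. pmf \<mu> \<xi> * (A ^^ k) F \<xi>)"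

text \<open>The pairing of the initial law with exp(t A) F, as a power series in t. It makes sense
  for every real t, so it can be differentiated at 0 too; it equals an expectation for t \<ge>
  0.\<close>

definition mean :: "('s \<Rightarrow> real) \<Rightarrow> real \<Rightarrow> real" where
  "mean F t = (\<Sum>k. t ^ k / fact k * moment F k)"

lemma summable_power: "\<xi> \<in> S \<Longrightarrow> summable (\<lambda>k. t ^ k / fact k * (A ^^ k) F \<xi>)"
proof -
  assume \<xi>: "\<xi> \<in> S"
  define D where "D = (\<Sum>\<xi>\<in>S. \<bar>F \<xi>\<bar>)"
  have D: "\<bar>F \<xi>\<bar> \<le> D" if "\<xi> \<in> S" for \<xi>
    unfolding D_def using that finite_states by (intro member_le_sum) auto
  have D0: "0 \<le> D" unfolding D_def by (intro sum_nonneg) auto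
  have pb: "\<bar>(A ^^ k) F \<xi>\<bar> \<le> bound ^ k * D" for k
    by (rule power_bound) (use D D0 \<xi> in auto)
  show ?thesis
  proof (rule summable_comparison_test')
    show "summable (\<lambda>k. inverse (fact k) * (\<bar>t\<bar> * bound) ^ k * D)"
      by (intro summable_mult2 summable_exp)
    show "norm (t ^ k / fact k * (A ^^ k) F \<xi>) \<le> inverse (fact k) * (\<bar>t\<bar> * bound) ^ k * D" for k
      using mult_left_mono[OF pb[of k], of "\<bar>t\<bar> ^ k / fact k"]
      by (simp add: abs_mult power_abs power_mult_distrib divide_inverse mult_ac)
  qed
qed

lemma summable_moment: "summable (\<lambda>k. t ^ k / fact k * moment F k)"
proof -
  have "summable (\<lambda>k. \<Sum>\<xi>\<in>S. pmf \<mu> \<xi> * (t ^ k / fact k * (A ^^ k) F \<xi>))"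
    by (intro summable_sum summable_mult summable_power)
  then show ?thesis by (simp add: moment_def sum_distrib_left mult_ac)
qed

text \<open>Kolmogorov's equation, by termwise differentiation of an everywhere convergent power
  series: differentiating shifts the exponent of A by one.\<close>

lemma mean_derivative: "(mean F has_real_derivative mean (A F) t) (at t)"
proof -
  define c where "c k = moment F k / fact k" for k
  have "summable (\<lambda>k. c k * y ^ k)" for y
    using summable_moment[of y F] by (simp add: c_def mult_ac)
  then have "((\<lambda>x. \<Sum>k. c k * x ^ k) has_real_derivative (\<Sum>k. diffs c k * t ^ k)) (at t)"
    by (rule termdiffs_strong_converges_everywhere)
  moreover have "diffs c k = moment (A F) k / fact k" for k
    by (simp add: diffs_def c_def moment_def funpow_swap1 del: of_nat_Suc)
  moreover have "mean F = (\<lambda>x. \<Sum>k. c k * x ^ k)"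
    by (auto simp: mean_def c_def mult_ac)
  ultimately show ?thesis by (simp add: mean_def mult_ac)
qed

lemma prob_space_M: "prob_space M"
  using chain by (simp add: markov_chain_def)

sublocale prob_space M by (rule prob_space_M)

lemma measurable_X: "0 \<le> t \<Longrightarrow> X t \<in> measurable M (count_space S)"
  using chain by (simp add: markov_chain_def)

lemma X_in_S: "0 \<le> t \<Longrightarrow> \<omega> \<in> space M \<Longrightarrow> X t \<omega> \<in> S"
  using measurable_space[OF measurable_X] by fastforce

lemma measurable_fun_X: "0 \<le> t \<Longrightarrow> (\<lambda>\<omega>. F (X t \<omega>)) \<in> measurable M (count_space UNIV)"
  by (rule measurable_compose[OF measurable_X]) auto

lemma borel_fun_X: "0 \<le> t \<Longrightarrow> (\<lambda>\<omega>. F (X t \<omega>) :: real) \<in> borel_measurable M"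
  by (rule measurable_compose[OF measurable_X]) auto

lemma integrable_fun_X:
  assumes "0 \<le> t"
  shows "integrable M (\<lambda>\<omega>. F (X t \<omega>) :: real)"
proof (rule integrable_const_bound)
  show "AE \<omega> in M. norm (F (X t \<omega>)) \<le> (\<Sum>\<xi>\<in>S. \<bar>F \<xi>\<bar>)"
    using X_in_S[OF assms] finite_states
    by (intro AE_I2) (simp add: member_le_sum[of _ S "\<lambda>\<xi>. \<bar>F \<xi>\<bar>"])
qed (rule borel_fun_X[OF assms])

lemma joint_law:
  assumes "0 \<le> t" "\<xi> \<in> S" "\<zeta> \<in> S"
  shows "prob {\<omega> \<in> space M. X 0 \<omega> = \<xi> \<and> X t \<omega> = \<zeta>} = pmf \<mu> \<xi> * transition_prob A t \<xi> \<zeta>"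
proof -
  define s where "s i = (if i = 0 then 0 else t)" for i :: nat
  define x where "x i = (if i = 0 then \<xi> else \<zeta>)" for i :: nat
  have "prob {\<omega> \<in> space M. \<forall>i\<le>1. X (s i) \<omega> = x i} = pmf \<mu> (x 0) * (\<Prod>i<1. transition_prob A (s (Suc i) - s i) (x i) (x (Suc i)))"
    using chain assms unfolding markov_chain_def
    by (elim conjE allE[of _ "1 :: nat"] allE[of _ s] allE[of _ x]) (auto simp: s_def x_def)
  moreover have "(\<forall>i\<le>1. X (s i) \<omega> = x i) \<longleftrightarrow> X 0 \<omega> = \<xi> \<and> X t \<omega> = \<zeta>" for \<omega>
    by (auto simp: s_def x_def le_Suc_eq)
  ultimately show ?thesis by (simp add: s_def x_def)
qed

text \<open>Split according to the values at times 0 and t, insert the two-time law, and resum the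
  kernel series; all state sums are finite, so they commute with the series.\<close>

lemma expectation_mean:
  assumes t: "0 \<le> t"
  shows "expectation (\<lambda>\<omega>. F (X t \<omega>)) = mean F t"
proof -
  let ?E = "\<lambda>\<xi> \<zeta>. {\<omega> \<in> space M. X 0 \<omega> = \<xi> \<and> X t \<omega> = \<zeta>}"
  have E: "?E \<xi> \<zeta> \<in> sets M" for \<xi> \<zeta>
  proof -
    have "{\<omega> \<in> space M. X r \<omega> = x} \<in> sets M" if "0 \<le> r" for r x
      using measurable_sets[OF measurable_fun_X[OF that, of "\<lambda>y. y = x"], of "{True}"]
      by (simp add: vimage_def Int_def conj_commute)
    then show ?thesis using t by (intro sets.sets_Collect_conj) auto
  qed
  have "expectation (\<lambda>\<omega>. F (X t \<omega>)) = expectation (\<lambda>\<omega>. \<Sum>\<xi>\<in>S. \<Sum>\<zeta>\<in>S. F \<zeta> * indicator (?E \<xi> \<zeta>) \<omega>)"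
  proof (rule Bochner_Integration.integral_cong[OF refl])
    fix \<omega> assume \<omega>: "\<omega> \<in> space M"
    have "(\<Sum>\<xi>\<in>S. \<Sum>\<zeta>\<in>S. F \<zeta> * indicator (?E \<xi> \<zeta>) \<omega>)
        = (\<Sum>\<xi>\<in>S. indicator {\<xi>} (X 0 \<omega>) * (\<Sum>\<zeta>\<in>S. F \<zeta> * indicator {\<zeta>} (X t \<omega>)))"
      unfolding sum_distrib_left using \<omega> by (intro sum.cong refl) (auto simp: indicator_def)
    also have "\<dots> = (\<Sum>\<xi>\<in>S. F (X t \<omega>) * indicator {\<xi>} (X 0 \<omega>))"
      using X_in_S[OF t \<omega>] by (simp add: indicator_expansion mult.commute)
    also have "\<dots> = F (X t \<omega>)"
      using X_in_S[OF order.refl \<omega>] indicator_expansion[of "X 0 \<omega>" "\<lambda>_. F (X t \<omega>)"] by simp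
    finally show "F (X t \<omega>) = (\<Sum>\<xi>\<in>S. \<Sum>\<zeta>\<in>S. F \<zeta> * indicator (?E \<xi> \<zeta>) \<omega>)" ..
  qed
  also have "\<dots> = (\<Sum>\<xi>\<in>S. \<Sum>\<zeta>\<in>S. F \<zeta> * prob (?E \<xi> \<zeta>))"
    using E by (simp add: Bochner_Integration.integral_sum less_top[symmetric])
  also have "\<dots> = (\<Sum>\<xi>\<in>S. pmf \<mu> \<xi> * (\<Sum>\<zeta>\<in>S. F \<zeta> * transition_prob A t \<xi> \<zeta>))"
    using joint_law[OF t] by (simp add: sum_distrib_left mult_ac)
  also have "\<dots> = (\<Sum>\<xi>\<in>S. pmf \<mu> \<xi> * (\<Sum>k. t ^ k / fact k * (A ^^ k) F \<xi>))"
  proof (intro sum.cong refl arg_cong2[where f = "(*)"])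
    fix \<xi> assume \<xi>: "\<xi> \<in> S"
    have "(\<Sum>\<zeta>\<in>S. F \<zeta> * transition_prob A t \<xi> \<zeta>) = (\<Sum>\<zeta>\<in>S. \<Sum>k. F \<zeta> * (t ^ k / fact k * (A ^^ k) (indicator {\<zeta>}) \<xi>))"
      unfolding transition_prob_def by (intro sum.cong refl suminf_mult[symmetric] summable_power \<xi>)
    also have "\<dots> = (\<Sum>k. \<Sum>\<zeta>\<in>S. F \<zeta> * (t ^ k / fact k * (A ^^ k) (indicator {\<zeta>}) \<xi>))"
      by (intro suminf_sum[symmetric] summable_mult summable_power \<xi>)
    also have "\<dots> = (\<Sum>k. t ^ k / fact k * (A ^^ k) F \<xi>)"
      by (simp add: power_expansion[OF \<xi>, of _ F] sum_distrib_left mult_ac)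
    finally show "(\<Sum>\<zeta>\<in>S. F \<zeta> * transition_prob A t \<xi> \<zeta>) = (\<Sum>k. t ^ k / fact k * (A ^^ k) F \<xi>)" .
  qed
  also have "\<dots> = (\<Sum>\<xi>\<in>S. \<Sum>k. pmf \<mu> \<xi> * (t ^ k / fact k * (A ^^ k) F \<xi>))"
    by (intro sum.cong refl suminf_mult[symmetric] summable_power)
  also have "\<dots> = (\<Sum>k. \<Sum>\<xi>\<in>S. pmf \<mu> \<xi> * (t ^ k / fact k * (A ^^ k) F \<xi>))"
    by (intro suminf_sum[symmetric] summable_mult summable_power)
  also have "\<dots> = mean F t"
    by (simp add: mean_def moment_def sum_distrib_left mult_ac)
  finally show ?thesis .
qed

lemma mean_0: "mean F 0 = measure_pmf.expectation \<mu> F"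
proof -
  have "mean F 0 = moment F 0"
    unfolding mean_def by (subst suminf_finite[of "{0}"]) auto
  also have "\<dots> = measure_pmf.expectation \<mu> F"
    unfolding moment_def using finite_states init
    by (subst integral_measure_pmf_real[of S]) (auto simp: mult_ac)
  finally show ?thesis .
qed

lemma eigenfunction_expectation:
  assumes "\<And>\<xi>. \<xi> \<in> S \<Longrightarrow> A F \<xi> = - l * F \<xi>" and "0 \<le> t"
  shows "expectation (\<lambda>\<omega>. F (X t \<omega>)) = exp (- l * t) * measure_pmf.expectation \<mu> F"
proof -
  have pow: "(A ^^ k) F \<xi> = (- l) ^ k * F \<xi>" if "\<xi> \<in> S" for k \<xi>
    using that
  proof (induction k arbitrary: \<xi>)
    case (Suc k)
    have "A ((A ^^ k) F) \<xi> = A (\<lambda>\<xi>. (- l) ^ k * F \<xi>) \<xi>"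
      using Suc by (intro local)
    then show ?case using assms(1)[OF Suc.prems] by (simp add: scale)
  qed simp
  then have mk: "moment F k = (- l) ^ k * moment F 0" for k
    by (simp add: moment_def sum_distrib_left mult_ac)
  have "t ^ k / fact k * moment F k = inverse (fact k) * (- l * t) ^ k * moment F 0" for k
    unfolding mk[of k] power_mult_distrib by (simp only: divide_inverse mult_ac)
  then have "mean F t = (\<Sum>k. inverse (fact k) * (- l * t) ^ k * moment F 0)"
    unfolding mean_def by (intro suminf_cong)
  also have "\<dots> = exp (- l * t) * moment F 0"
    unfolding suminf_mult2[OF summable_exp, symmetric] exp_def by (simp add: divide_inverse mult.commute)
  also have "moment F 0 = measure_pmf.expectation \<mu> F"
    unfolding mean_0[symmetric] mean_def by (subst suminf_finite[of "{0}"]) auto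
  finally show ?thesis using expectation_mean[OF assms(2)] by simp
qed

text \<open>Here 2 F A F = -2 l F^2, so c bounds the squared-gradient term. Gronwall's argument:
  exp(2 l s) (E F(X_s)^2 - c s) does not increase, as its derivative is at most -2 l c s exp(2 l s).
  Hence the second moment at t is at most its initial value damped by exp(-2 l t), plus c t. The
  squared mean is damped by exactly the same factor, so subtraction leaves a damped initial variance
  plus c t.\<close>

lemma eigenfunction_variance:
  assumes eigen: "\<And>\<xi>. \<xi> \<in> S \<Longrightarrow> A F \<xi> = - l * F \<xi>" and t: "0 \<le> t" and l: "0 \<le> l" and c: "0 \<le> c"
    and square: "\<And>\<xi>. \<xi> \<in> S \<Longrightarrow> A (\<lambda>\<xi>. (F \<xi>)\<^sup>2) \<xi> \<le> - 2 * l * (F \<xi>)\<^sup>2 + c"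
  shows "variance (\<lambda>\<omega>. F (X t \<omega>)) \<le> measure_pmf.variance \<mu> F + c * t"
proof -
  let ?Q = "\<lambda>\<xi>. (F \<xi>)\<^sup>2"
  define w where "w s = exp (2 * l * s) * (mean ?Q s - c * s)" for s
  have "w t \<le> w 0"
  proof (rule DERIV_nonpos_imp_nonincreasing[OF t])
    fix s assume s: "0 \<le> s" "s \<le> t"
    have "mean (A ?Q) s = expectation (\<lambda>\<omega>. A ?Q (X s \<omega>))"
      by (rule expectation_mean[OF s(1), symmetric])
    also have "\<dots> \<le> expectation (\<lambda>\<omega>. - 2 * l * ?Q (X s \<omega>) + c)"
      using square[OF X_in_S[OF s(1)]]
      by (intro Bochner_Integration.integral_mono integrable_fun_X[OF s(1)] integrable_fun_X[OF s(1), of "\<lambda>x. - 2 * l * ?Q x + c"])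
    also have "\<dots> = - 2 * l * mean ?Q s + c"
      using expectation_mean[OF s(1), of ?Q] integrable_fun_X[OF s(1), of ?Q] by (simp add: prob_space)
    finally have le: "mean (A ?Q) s \<le> - 2 * l * mean ?Q s + c" .
    have "(w has_real_derivative exp (2 * l * s) * (mean (A ?Q) s - c + 2 * l * (mean ?Q s - c * s))) (at s)"
      unfolding w_def by (auto intro!: derivative_eq_intros mean_derivative simp: algebra_simps)
    moreover have "exp (2 * l * s) * (mean (A ?Q) s - c + 2 * l * (mean ?Q s - c * s)) \<le> 0"
    proof (rule mult_nonneg_nonpos)
      have "0 \<le> 2 * l * (c * s)" using l c s by simp
      then show "mean (A ?Q) s - c + 2 * l * (mean ?Q s - c * s) \<le> 0"
        using le by (simp add: algebra_simps)
    qed simp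
    ultimately show "\<exists>y. (w has_real_derivative y) (at s) \<and> y \<le> 0" by blast
  qed
  then have "mean ?Q t - c * t \<le> exp (- (2 * l * t)) * mean ?Q 0"
    by (simp add: w_def exp_minus field_simps)
  moreover have "expectation (\<lambda>\<omega>. F (X t \<omega>)) = exp (- l * t) * measure_pmf.expectation \<mu> F"
    using eigen t by (rule eigenfunction_expectation)
  then have "(expectation (\<lambda>\<omega>. F (X t \<omega>)))\<^sup>2 = exp (- (2 * l * t)) * (measure_pmf.expectation \<mu> F)\<^sup>2"
    by (simp add: power_mult_distrib flip: exp_double)
  moreover have "variance (\<lambda>\<omega>. F (X t \<omega>)) = mean ?Q t - (expectation (\<lambda>\<omega>. F (X t \<omega>)))\<^sup>2"
    using expectation_mean[OF t, of ?Q] integrable_fun_X[OF t, of ?Q] integrable_fun_X[OF t, of F]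
    by (subst variance_eq) auto
  moreover have var: "measure_pmf.variance \<mu> F = mean ?Q 0 - (measure_pmf.expectation \<mu> F)\<^sup>2"
  proof -
    have "finite (set_pmf \<mu>)" using init finite_states finite_subset by blast
    then show ?thesis
      by (subst measure_pmf.variance_eq) (auto intro: integrable_measure_pmf_finite simp: mean_0)
  qed
  moreover from var have "exp (- (2 * l * t)) * mean ?Q 0
      = exp (- (2 * l * t)) * measure_pmf.variance \<mu> F + exp (- (2 * l * t)) * (measure_pmf.expectation \<mu> F)\<^sup>2"
    by (simp add: distrib_left[symmetric])
  ultimately have "variance (\<lambda>\<omega>. F (X t \<omega>)) \<le> exp (- (2 * l * t)) * measure_pmf.variance \<mu> F + c * t"
    by linarith
  moreover have "exp (- (2 * l * t)) * measure_pmf.variance \<mu> F \<le> 1 * measure_pmf.variance \<mu> F"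
    using l t by (intro mult_right_mono) auto
  ultimately show ?thesis by simp
qed

end

subsection \<open>The exclusion process\<close>

definition empirical_mean :: "nat \<Rightarrow> (real ^ 'd \<Rightarrow> real) \<Rightarrow> (int ^ 'd \<Rightarrow> bool) \<Rightarrow> real" where
  "empirical_mean N g \<eta> = (\<Sum>x\<in>sites N. g (point N x) * of_bool (\<eta> x)) / real N ^ CARD('d)"

lemma exchange_configs: "\<eta> \<in> configs N \<Longrightarrow> x \<in> sites N \<Longrightarrow> y \<in> sites N \<Longrightarrow> exchange \<eta> x y \<in> configs N"
  by (auto simp: configs_def exchange_def)

lemma finite_configs: "finite (configs N :: (int ^ 'd \<Rightarrow> bool) set)"
proof -
  have "configs N \<subseteq> (\<lambda>A x. x \<in> A) ` Pow (sites N :: (int ^ 'd) set)"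
  proof
    fix \<eta> :: "int ^ 'd \<Rightarrow> bool" assume "\<eta> \<in> configs N"
    then show "\<eta> \<in> (\<lambda>A x. x \<in> A) ` Pow (sites N)"
      by (intro image_eqI[of _ _ "{x. \<eta> x}"]) (auto simp: configs_def)
  qed
  then show ?thesis by (rule finite_subset) simp
qed

text \<open>Exchanging a particle with a hole alters just two summands, so the change is the
  increment of g along the jump, divided by N^d.\<close>

lemma empirical_mean_exchange:
  fixes g :: "real ^ 'd \<Rightarrow> real"
  assumes "x \<in> sites N" "y \<in> sites N" "\<eta> x" "\<not> \<eta> y"
  shows "empirical_mean N g (exchange \<eta> x y) - empirical_mean N g \<eta> = (g (point N y) - g (point N x)) / real N ^ CARD('d)"
proof -
  have "x \<noteq> y" using assms by auto
  have "(\<Sum>w\<in>sites N. g (point N w) * of_bool (exchange \<eta> x y w))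
      = (\<Sum>w\<in>sites N. g (point N w) * of_bool (\<eta> w) + ((if w = y then g (point N w) else 0) - (if w = x then g (point N w) else 0)))"
    using assms \<open>x \<noteq> y\<close> by (intro sum.cong) (auto simp: exchange_def)
  also have "\<dots> = (\<Sum>w\<in>sites N. g (point N w) * of_bool (\<eta> w)) + (g (point N y) - g (point N x))"
    using assms by (simp add: sum.distrib sum_subtractf)
  finally show ?thesis
    by (simp add: empirical_mean_def diff_divide_distrib add_divide_distrib)
qed

lemma abs_cos_diff_le: "\<bar>cos a - cos b\<bar> \<le> \<bar>a - b :: real\<bar>"
proof -
  have "\<bar>cos a - cos b\<bar> = 2 * (\<bar>sin ((a + b) / 2)\<bar> * \<bar>sin ((b - a) / 2)\<bar>)"
    by (simp add: cos_diff_cos abs_mult)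
  also have "\<dots> \<le> 2 * (1 * \<bar>(b - a) / 2\<bar>)"
    by (intro mult_left_mono mult_mono abs_sin_x_le_abs_x) auto
  finally show ?thesis by simp
qed

lemma exclusion_generator_linear:
  "exclusion_generator p N (\<lambda>\<xi>. a * F \<xi> + G \<xi>) \<zeta> = a * exclusion_generator p N F \<zeta> + exclusion_generator p N G \<zeta>"
  unfolding exclusion_generator_def sum_distrib_left sum.distrib[symmetric]
  by (intro sum.cong refl) (simp add: algebra_simps)

lemma exclusion_generator_local:
  assumes "0 < N" "\<And>\<xi>. \<xi> \<in> configs N \<Longrightarrow> F \<xi> = G \<xi>" "\<zeta> \<in> configs N"
  shows "exclusion_generator p N F \<zeta> = exclusion_generator p N G \<zeta>"
proof -
  have "F (exchange \<zeta> x (wrap N (x + y))) = G (exchange \<zeta> x (wrap N (x + y)))" if "x \<in> sites N" for x y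
    by (intro assms(2) exchange_configs assms(3) that wrap_sites assms(1))
  then show ?thesis
    unfolding exclusion_generator_def assms(2)[OF assms(3)] by (intro sum.cong refl) simp
qed

context symmetric_jump
begin

text \<open>Change of variables for the image law of \<open>p\<close>: jumps are summed over Z^d
  instead of residues, where reflection is available. It holds for every positive N, also when
  several jumps have the same residue.\<close>

lemma exclusion_generator_eq:
  assumes "0 < N"
  shows "exclusion_generator p N F \<eta> = (\<Sum>x\<in>sites N. \<Sum>z\<in>set_pmf p. pmf p z *
    (of_bool (\<eta> x) * (1 - of_bool (\<eta> (wrap N (x + z)))) * (F (exchange \<eta> x (wrap N (x + z))) - F \<eta>)))"
proof -
  have "(\<Sum>y\<in>sites N. h y * pmf (map_pmf (wrap N) p) y) = (\<Sum>z\<in>set_pmf p. pmf p z * h (wrap N z))" for h :: "_ \<Rightarrow> real"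
  proof -
    have "(\<Sum>y\<in>sites N. h y * pmf (map_pmf (wrap N) p) y) = measure_pmf.expectation (map_pmf (wrap N) p) h"
      using assms wrap_sites by (subst integral_measure_pmf_real[of "sites N"]) auto
    also have "\<dots> = (\<Sum>z\<in>set_pmf p. h (wrap N z) * pmf p z)"
      using finite_support by (subst integral_map_pmf, subst integral_measure_pmf_real[of "set_pmf p"]) auto
    finally show ?thesis by (simp add: mult.commute)
  qed
  note this[of "\<lambda>y. of_bool (\<eta> x) * (1 - of_bool (\<eta> (wrap N (x + y)))) * (F (exchange \<eta> x (wrap N (x + y))) - F \<eta>)" for x]
  then show ?thesis
    unfolding exclusion_generator_def wrap_add_wrap by (intro sum.cong[OF refl]) (simp only: mult_ac)
qed

lemma generator_empirical_mean:
  fixes \<eta> :: "int ^ 'd \<Rightarrow> bool"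
  assumes N: "0 < N"
  shows "exclusion_generator p N (empirical_mean N (mode k a)) \<eta> = - (1 - char (1 / real N) k) * empirical_mean N (mode k a) \<eta>"
proof -
  define g where "g x = mode k a (point N x)" for x
  define e where "e x = (of_bool (\<eta> x) :: real)" for x
  define D where "D = real N ^ CARD('d)"
  have eq: "of_bool (\<eta> x) * (1 - of_bool (\<eta> y)) * (empirical_mean N (mode k a) (exchange \<eta> x y) - empirical_mean N (mode k a) \<eta>)
      = (e x * (g y - g x) - e x * e y * (g y - g x)) / D" if "x \<in> sites N" "y \<in> sites N" for x y
    using empirical_mean_exchange[OF that, of \<eta> "mode k a"] by (auto simp: e_def g_def D_def)
  \<comment> \<open>The part quadratic in the occupation variables. Reindexing the sites by the
    shift z shows that it is odd in z, so it cancels against the even weights of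
    \<open>p\<close>.\<close>
  define T where "T z = (\<Sum>x\<in>sites N. e x * e (wrap N (x + z)) * (g (wrap N (x + z)) - g x))" for z
  have T_neg: "T (- z) = - T z" for z
  proof -
    have "T (- z) = (\<Sum>x\<in>sites N. e (wrap N (x + z)) * e (wrap N (wrap N (x + z) + - z)) * (g (wrap N (wrap N (x + z) + - z)) - g (wrap N (x + z))))"
      unfolding T_def by (rule sum.reindex_bij_betw[OF bij_betw_wrap_add[OF N], symmetric])
    also have "\<dots> = (\<Sum>x\<in>sites N. - (e x * e (wrap N (x + z)) * (g (wrap N (x + z)) - g x)))"
    proof (intro sum.cong refl)
      fix x :: "int ^ 'd" assume "x \<in> sites N"
      then have "wrap N (wrap N (x + z) + - z) = x"
        unfolding wrap_add_wrap by (simp add: wrap_eq)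
      then show "e (wrap N (x + z)) * e (wrap N (wrap N (x + z) + - z)) * (g (wrap N (wrap N (x + z) + - z)) - g (wrap N (x + z)))
        = - (e x * e (wrap N (x + z)) * (g (wrap N (x + z)) - g x))"
        by (simp add: algebra_simps)
    qed
    finally show ?thesis by (simp add: T_def sum_negf)
  qed
  have "(\<Sum>z\<in>set_pmf p. pmf p z * T z) = - (\<Sum>z\<in>set_pmf p. pmf p z * T z)"
    using sum_reflect[of T] by (simp add: T_neg sum_negf)
  then have "(\<Sum>z\<in>set_pmf p. pmf p z * T z) = 0" by simp
  then have zero: "(\<Sum>x\<in>sites N. \<Sum>z\<in>set_pmf p. pmf p z * (e x * e (wrap N (x + z)) * (g (wrap N (x + z)) - g x))) = 0"
    unfolding T_def sum_distrib_left by (subst sum.swap)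
  have eigen: "(\<Sum>z\<in>set_pmf p. pmf p z * (g (wrap N (x + z)) - g x)) = - (1 - char (1 / real N) k) * g x" for x
  proof -
    have "g (wrap N (x + z)) = mode k a (point N x + (1 / real N) *\<^sub>R real_vec z)" for z
      using periodic_wrap[of "mode k a" N "x + z"] N mode_torus_cont[of k a]
      by (simp add: g_def torus_cont_def point_add point_def scaleR_add_right real_vec_add)
    then have "(\<Sum>z\<in>set_pmf p. pmf p z * g (wrap N (x + z))) = char (1 / real N) k * g x"
      using avg_mode[of "1 / real N" k a "point N x"] by (simp add: avg_def g_def)
    then show ?thesis
      by (simp add: right_diff_distrib sum_subtractf sum_distrib_right[symmetric] sum_pmf_one left_diff_distrib)
  qed
  have "exclusion_generator p N (empirical_mean N (mode k a)) \<eta>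
      = (\<Sum>x\<in>sites N. \<Sum>z\<in>set_pmf p. pmf p z * ((e x * (g (wrap N (x + z)) - g x) - e x * e (wrap N (x + z)) * (g (wrap N (x + z)) - g x)) / D))"
    unfolding exclusion_generator_eq[OF N] by (intro sum.cong refl arg_cong2[where f = "(*)"] eq wrap_sites N)
  also have "\<dots> = ((\<Sum>x\<in>sites N. \<Sum>z\<in>set_pmf p. pmf p z * (e x * (g (wrap N (x + z)) - g x)))
      - (\<Sum>x\<in>sites N. \<Sum>z\<in>set_pmf p. pmf p z * (e x * e (wrap N (x + z)) * (g (wrap N (x + z)) - g x)))) / D"
    by (simp only: sum_divide_distrib sum_subtractf[symmetric] diff_divide_distrib times_divide_eq_right right_diff_distrib)
  also have "\<dots> = (\<Sum>x\<in>sites N. e x * (\<Sum>z\<in>set_pmf p. pmf p z * (g (wrap N (x + z)) - g x))) / D"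
    unfolding zero by (simp add: sum_distrib_left mult_ac)
  also have "\<dots> = - (1 - char (1 / real N) k) * empirical_mean N (mode k a) \<eta>"
    unfolding eigen by (simp add: empirical_mean_def g_def e_def D_def sum_distrib_left mult_ac)
  finally show ?thesis .
qed

text \<open>Expand the increment of the square as 2 F (F' - F) + (F' - F)^2. The first part gives
  the eigenvalue. A jump z changes F by at most 2 pi |k . z| / (N N^d); squaring, averaging over z
  and summing over N^d sites yields 2 rate / (N^2 N^d).\<close>

lemma generator_empirical_mean_square:
  fixes \<eta> :: "int ^ 'd \<Rightarrow> bool"
  assumes N: "0 < N"
  shows "exclusion_generator p N (\<lambda>\<xi>. (empirical_mean N (mode k a) \<xi>)\<^sup>2) \<eta>
    \<le> - 2 * (1 - char (1 / real N) k) * (empirical_mean N (mode k a) \<eta>)\<^sup>2 + 2 * rate k / ((real N)\<^sup>2 * real N ^ CARD('d))"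
proof -
  let ?F = "empirical_mean N (mode k a)"
  define D where "D = real N ^ CARD('d)"
  have D: "0 < D" using N by (simp add: D_def)
  define \<beta> where "\<beta> z = (2 * pi * (real_vec k \<bullet> real_vec z))\<^sup>2 / (real N)\<^sup>2" for z
  have term_le: "of_bool (\<eta> x) * (1 - of_bool (\<eta> y)) * ((?F (exchange \<eta> x y))\<^sup>2 - (?F \<eta>)\<^sup>2)
      \<le> 2 * ?F \<eta> * (of_bool (\<eta> x) * (1 - of_bool (\<eta> y)) * (?F (exchange \<eta> x y) - ?F \<eta>)) + \<beta> z / D\<^sup>2"
    if "x \<in> sites N" and y: "y = wrap N (x + z)" for x y z
  proof (cases "\<eta> x \<and> \<not> \<eta> y")
    case True
    have ysite: "y \<in> sites N" using y N wrap_sites by simp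
    have "(?F (exchange \<eta> x y))\<^sup>2 - (?F \<eta>)\<^sup>2 = 2 * ?F \<eta> * (?F (exchange \<eta> x y) - ?F \<eta>) + (?F (exchange \<eta> x y) - ?F \<eta>)\<^sup>2"
      by (simp add: power2_eq_square algebra_simps)
    moreover have "(?F (exchange \<eta> x y) - ?F \<eta>)\<^sup>2 \<le> \<beta> z / D\<^sup>2"
    proof -
      have "mode k a (point N y) = mode k a (point N x + point N z)"
        unfolding y using periodic_wrap[of "mode k a" N "x + z"] N mode_torus_cont[of k a]
        by (simp add: torus_cont_def point_add)
      then have "\<bar>mode k a (point N y) - mode k a (point N x)\<bar> \<le> \<bar>2 * pi * (real_vec k \<bullet> point N z)\<bar>"
        using abs_cos_diff_le[of "2 * pi * (real_vec k \<bullet> (point N x + point N z)) + a" "2 * pi * (real_vec k \<bullet> point N x) + a"]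
        by (simp add: mode_def inner_add_right algebra_simps)
      then have "(mode k a (point N y) - mode k a (point N x))\<^sup>2 \<le> (2 * pi * (real_vec k \<bullet> point N z))\<^sup>2"
        by (simp only: abs_le_square_iff)
      also have "\<dots> = \<beta> z"
        by (simp add: \<beta>_def point_def power_mult_distrib power_divide)
      finally show ?thesis
        unfolding empirical_mean_exchange[OF that(1) ysite conjunct1[OF True] conjunct2[OF True]] power_divide D_def[symmetric]
        using D by (intro divide_right_mono) auto
    qed
    ultimately show ?thesis using True by simp
  next
    case False
    have "0 \<le> \<beta> z / D\<^sup>2" by (simp add: \<beta>_def)
    then show ?thesis using False by auto
  qed
  have "exclusion_generator p N (\<lambda>\<xi>. (?F \<xi>)\<^sup>2) \<eta> \<le> (\<Sum>x\<in>sites N. \<Sum>z\<in>set_pmf p. pmf p z *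
      (2 * ?F \<eta> * (of_bool (\<eta> x) * (1 - of_bool (\<eta> (wrap N (x + z)))) * (?F (exchange \<eta> x (wrap N (x + z))) - ?F \<eta>)) + \<beta> z / D\<^sup>2))"
    unfolding exclusion_generator_eq[OF N] by (intro sum_mono mult_left_mono term_le) auto
  also have "\<dots> = 2 * ?F \<eta> * exclusion_generator p N ?F \<eta> + (\<Sum>x\<in>(sites N :: (int ^ 'd) set). \<Sum>z\<in>set_pmf p. pmf p z * (\<beta> z / D\<^sup>2))"
    unfolding exclusion_generator_eq[OF N] distrib_left sum.distrib sum_distrib_left
    by (intro arg_cong2[where f = "(+)"] sum.cong refl) (simp add: mult_ac)
  also have "(\<Sum>x\<in>(sites N :: (int ^ 'd) set). \<Sum>z\<in>set_pmf p. pmf p z * (\<beta> z / D\<^sup>2)) = 2 * rate k / ((real N)\<^sup>2 * D)"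
  proof -
    have "(\<Sum>z\<in>set_pmf p. pmf p z * (\<beta> z / D\<^sup>2)) = 2 * rate k / ((real N)\<^sup>2 * D\<^sup>2)"
      by (simp add: \<beta>_def rate_def sum_divide_distrib sum_distrib_left power_mult_distrib mult_ac)
    then show ?thesis using card_sites[OF N, where ?'d = 'd] D
      by (simp add: D_def[symmetric] power2_eq_square)
  qed
  also have "2 * ?F \<eta> * exclusion_generator p N ?F \<eta> = - 2 * (1 - char (1 / real N) k) * (?F \<eta>)\<^sup>2"
    unfolding generator_empirical_mean[OF N] by (simp add: power2_eq_square algebra_simps)
  finally show ?thesis by (simp add: D_def)
qed

end

section \<open>Moments of the product Bernoulli initial law\<close>

lemma expectation_local_equilibrium:
  assumes "\<And>u. \<rho>0 u \<in> {0..1}" "x \<in> sites N"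
  shows "measure_pmf.expectation (local_equilibrium \<rho>0 N) (\<lambda>\<eta>. of_bool (\<eta> x)) = \<rho>0 (point N x)"
proof -
  have "measure_pmf.expectation (local_equilibrium \<rho>0 N) (\<lambda>\<eta>. of_bool (\<eta> x) :: real)
      = measure_pmf.expectation (map_pmf (\<lambda>\<eta>. \<eta> x) (local_equilibrium \<rho>0 N)) of_bool"
    by simp
  also have "map_pmf (\<lambda>\<eta>. \<eta> x) (local_equilibrium \<rho>0 N) = bernoulli_pmf (\<rho>0 (point N x))"
    unfolding local_equilibrium_def using assms(2) by (simp add: Pi_pmf_component)
  finally show ?thesis using assms(1)[of "point N x"] by simp
qed

lemma set_local_equilibrium: "set_pmf (local_equilibrium \<rho>0 N) \<subseteq> configs N"
  using set_Pi_pmf_subset[OF sites_finite] unfolding local_equilibrium_def configs_def by fast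

lemma integrable_local_equilibrium: "integrable (measure_pmf (local_equilibrium \<rho>0 N)) (F :: _ \<Rightarrow> real)"
  using set_local_equilibrium finite_configs by (intro integrable_measure_pmf_finite) (rule finite_subset)

lemma covariance_local_equilibrium:
  assumes \<rho>0: "\<And>u. \<rho>0 u \<in> {0..1}" and xy: "x \<in> sites N" "y \<in> sites N" "x \<noteq> y"
  shows "measure_pmf.expectation (local_equilibrium \<rho>0 N)
    (\<lambda>\<eta>. (of_bool (\<eta> x) - \<rho>0 (point N x)) * (of_bool (\<eta> y) - \<rho>0 (point N y))) = 0"
proof -
  let ?E = "measure_pmf.expectation (local_equilibrium \<rho>0 N)"
  \<comment> \<open>The product of two occupation variables is padded with factors 1 to a product
    over all sites, the shape in which independence under \<open>Pi_pmf\<close> applies.\<close>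
  define h where "h w b = (if w = x \<or> w = y then of_bool b else 1 :: real)" for w b
  have "(\<Prod>w\<in>sites N. h w (\<eta> w)) = (\<Prod>w\<in>{x, y}. h w (\<eta> w))" for \<eta>
    using xy by (intro prod.mono_neutral_right) (auto simp: h_def)
  then have h: "of_bool (\<eta> x) * of_bool (\<eta> y) = (\<Prod>w\<in>sites N. h w (\<eta> w))" for \<eta>
    using xy by (simp add: h_def)
  have "?E (\<lambda>\<eta>. of_bool (\<eta> x) * of_bool (\<eta> y)) = (\<Prod>w\<in>sites N. measure_pmf.expectation (bernoulli_pmf (\<rho>0 (point N w))) (h w))"
    unfolding local_equilibrium_def h
    by (rule expectation_prod_Pi_pmf) (auto intro: integrable_measure_pmf_finite simp: h_def)
  also have "\<dots> = (\<Prod>w\<in>{x, y}. measure_pmf.expectation (bernoulli_pmf (\<rho>0 (point N w))) (h w))"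
  proof (intro prod.mono_neutral_right ballI)
    fix w assume "w \<in> sites N - {x, y}"
    then have "h w = (\<lambda>_. 1)" by (auto simp: h_def fun_eq_iff)
    then show "measure_pmf.expectation (bernoulli_pmf (\<rho>0 (point N w))) (h w) = 1" by simp
  qed (use xy in auto)
  also have "\<dots> = \<rho>0 (point N x) * \<rho>0 (point N y)"
    using xy \<rho>0[of "point N x"] \<rho>0[of "point N y"] by (simp add: h_def)
  finally have E2: "?E (\<lambda>\<eta>. of_bool (\<eta> x) * of_bool (\<eta> y)) = \<rho>0 (point N x) * \<rho>0 (point N y)" .
  have "?E (\<lambda>\<eta>. (of_bool (\<eta> x) - \<rho>0 (point N x)) * (of_bool (\<eta> y) - \<rho>0 (point N y)))
      = ?E (\<lambda>\<eta>. of_bool (\<eta> x) * of_bool (\<eta> y) - \<rho>0 (point N x) * of_bool (\<eta> y) - \<rho>0 (point N y) * of_bool (\<eta> x)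
          + \<rho>0 (point N x) * \<rho>0 (point N y))"
    by (intro Bochner_Integration.integral_cong refl) (simp only: algebra_simps)
  also have "\<dots> = ?E (\<lambda>\<eta>. of_bool (\<eta> x) * of_bool (\<eta> y)) - \<rho>0 (point N x) * ?E (\<lambda>\<eta>. of_bool (\<eta> y))
      - \<rho>0 (point N y) * ?E (\<lambda>\<eta>. of_bool (\<eta> x)) + \<rho>0 (point N x) * \<rho>0 (point N y)"
    by (simp add: integrable_local_equilibrium)
  also have "\<dots> = 0"
    unfolding E2 expectation_local_equilibrium[OF \<rho>0 xy(1)] expectation_local_equilibrium[OF \<rho>0 xy(2)] by simp
  finally show ?thesis .
qed

lemma expectation_empirical_mean:
  fixes g :: "real ^ 'd \<Rightarrow> real"
  assumes "\<And>u. \<rho>0 u \<in> {0..1}"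
  shows "measure_pmf.expectation (local_equilibrium \<rho>0 N) (empirical_mean N g)
    = (\<Sum>x\<in>sites N. g (point N x) * \<rho>0 (point N x)) / real N ^ CARD('d)"
  unfolding empirical_mean_def
proof -
  have "measure_pmf.expectation (local_equilibrium \<rho>0 N) (\<lambda>\<eta>. \<Sum>x\<in>sites N. g (point N x) * of_bool (\<eta> x))
      = (\<Sum>x\<in>sites N. measure_pmf.expectation (local_equilibrium \<rho>0 N) (\<lambda>\<eta>. g (point N x) * of_bool (\<eta> x)))"
    by (rule Bochner_Integration.integral_sum) (rule integrable_local_equilibrium)
  also have "\<dots> = (\<Sum>x\<in>sites N. g (point N x) * \<rho>0 (point N x))"
    by (intro sum.cong refl) (simp only: integral_mult_right_zero expectation_local_equilibrium[OF assms])
  finally show "measure_pmf.expectation (local_equilibrium \<rho>0 N) (\<lambda>\<eta>. (\<Sum>x\<in>sites N. g (point N x) * of_bool (\<eta> x)) / real N ^ CARD('d))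
    = (\<Sum>x\<in>sites N. g (point N x) * \<rho>0 (point N x)) / real N ^ CARD('d)"
    by (simp only: integral_divide_zero)
qed

text \<open>Independence removes the off-diagonal covariances; the N^d diagonal terms are at most 1
  each, against the normalisation N^(2d).\<close>

lemma variance_empirical_mean:
  fixes g :: "real ^ 'd \<Rightarrow> real"
  assumes \<rho>0: "\<And>u. \<rho>0 u \<in> {0..1}" and g: "\<And>u. \<bar>g u\<bar> \<le> 1" and N: "0 < N"
  shows "measure_pmf.variance (local_equilibrium \<rho>0 N) (empirical_mean N g) \<le> 1 / real N ^ CARD('d)"
proof -
  let ?\<mu> = "local_equilibrium \<rho>0 N"
  define D where "D = real N ^ CARD('d)"
  have D: "0 < D" using N by (simp add: D_def)
  define Y where "Y x \<eta> = g (point N x) * (of_bool (\<eta> x) - \<rho>0 (point N x))" for x and \<eta> :: "int ^ 'd \<Rightarrow> bool"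
  have "empirical_mean N g \<eta> - measure_pmf.expectation ?\<mu> (empirical_mean N g) = (\<Sum>x\<in>sites N. Y x \<eta>) / D" for \<eta>
    unfolding expectation_empirical_mean[OF \<rho>0]
    by (simp add: empirical_mean_def Y_def D_def right_diff_distrib sum_subtractf diff_divide_distrib)
  then have "measure_pmf.variance ?\<mu> (empirical_mean N g)
      = measure_pmf.expectation ?\<mu> (\<lambda>\<eta>. (\<Sum>x\<in>sites N. \<Sum>y\<in>sites N. Y x \<eta> * Y y \<eta>)) / D\<^sup>2"
    by (simp add: power_divide power2_eq_square sum_product)
  also have "measure_pmf.expectation ?\<mu> (\<lambda>\<eta>. (\<Sum>x\<in>sites N. \<Sum>y\<in>sites N. Y x \<eta> * Y y \<eta>))
      = (\<Sum>x\<in>sites N. \<Sum>y\<in>sites N. measure_pmf.expectation ?\<mu> (\<lambda>\<eta>. Y x \<eta> * Y y \<eta>))"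
    by (simp add: Bochner_Integration.integral_sum integrable_local_equilibrium)
  also have "\<dots> \<le> (\<Sum>x\<in>(sites N :: (int ^ 'd) set). \<Sum>y\<in>sites N. if x = y then 1 else 0)"
  proof (intro sum_mono)
    fix x y :: "int ^ 'd" assume xy: "x \<in> sites N" "y \<in> sites N"
    show "measure_pmf.expectation ?\<mu> (\<lambda>\<eta>. Y x \<eta> * Y y \<eta>) \<le> (if x = y then 1 else 0)"
    proof (cases "x = y")
      case True
      have "\<bar>of_bool b - \<rho>0 (point N x)\<bar> \<le> 1" for b
        using \<rho>0[of "point N x"] by (cases b) auto
      then have "\<bar>Y x \<eta>\<bar> \<le> 1 * 1" for \<eta>
        unfolding Y_def abs_mult using g by (intro mult_mono) auto
      then have "Y x \<eta> * Y x \<eta> \<le> 1" for \<eta>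
        using abs_square_le_1[of "Y x \<eta>"] by (simp add: power2_eq_square)
      then have "measure_pmf.expectation ?\<mu> (\<lambda>\<eta>. Y x \<eta> * Y x \<eta>) \<le> measure_pmf.expectation ?\<mu> (\<lambda>\<eta>. 1)"
        by (intro Bochner_Integration.integral_mono integrable_local_equilibrium)
      then show ?thesis using True by simp
    next
      case False
      have "Y x \<eta> * Y y \<eta> = (g (point N x) * g (point N y)) * ((of_bool (\<eta> x) - \<rho>0 (point N x)) * (of_bool (\<eta> y) - \<rho>0 (point N y)))" for \<eta>
        by (simp add: Y_def)
      moreover have "measure_pmf.expectation ?\<mu> (\<lambda>\<eta>. (of_bool (\<eta> x) - \<rho>0 (point N x)) * (of_bool (\<eta> y) - \<rho>0 (point N y))) = 0"
        by (intro covariance_local_equilibrium \<rho>0 xy False)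
      ultimately show ?thesis using False by simp
    qed
  qed
  also have "\<dots> = D"
    using card_sites[OF N, where ?'d = 'd] by (simp add: D_def)
  finally have "measure_pmf.variance ?\<mu> (empirical_mean N g) \<le> D / D\<^sup>2"
    using D by (simp add: divide_right_mono)
  then show ?thesis using D by (simp add: power2_eq_square D_def)
qed

context symmetric_jump
begin

text \<open>In the variance the time N^2 t cancels the N^(-2) of the squared gradient, leaving order
  N^(-d). In the mean the same factor turns 1 - char into its limit \<open>rate\<close>, while the
  initial mean is a Riemann sum.\<close>

lemma empirical_mean_mode_converges:
  fixes M :: "nat \<Rightarrow> 'w measure"
  assumes \<rho>0: "\<rho>0 \<in> torus_cont" "\<And>u. \<rho>0 u \<in> {0..1}"
    and exclusion: "\<And>N. 0 < N \<Longrightarrow>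
      markov_chain (configs N) (exclusion_generator p N) (local_equilibrium \<rho>0 N) (M N) (\<eta> N)"
    and t: "0 \<le> t" and \<epsilon>: "0 < \<epsilon>"
  shows "(\<lambda>N. measure (M N) {\<omega> \<in> space (M N).
      \<epsilon> < \<bar>empirical_mean N (mode k a) (\<eta> N ((real N)\<^sup>2 * t) \<omega>) - exp (- rate k * t) * (\<integral>u. mode k a u * \<rho>0 u \<partial>haar)\<bar>}) \<longlonglongrightarrow> 0"
proof -
  define L where "L = exp (- rate k * t) * (\<integral>u. mode k a u * \<rho>0 u \<partial>haar)"
  define m where "m N = exp (- (1 - char (1 / real N) k) * ((real N)\<^sup>2 * t)) *
    ((\<Sum>x\<in>sites N. mode k a (point N x) * \<rho>0 (point N x)) / real N ^ CARD('d))" for N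
  \<comment> \<open>Chebyshev bound at level \<epsilon>/2; the other half of \<epsilon> absorbs the
    distance between the mean \<open>m N\<close> and its limit.\<close>
  define b where "b N = (1 / real N ^ CARD('d) + 2 * rate k / ((real N)\<^sup>2 * real N ^ CARD('d)) * ((real N)\<^sup>2 * t)) / (\<epsilon> / 2)\<^sup>2" for N
  have "(\<lambda>N. exp (- ((real N)\<^sup>2 * (1 - char (1 / real N) k)) * t)) \<longlonglongrightarrow> exp (- rate k * t)"
    by (intro tendsto_intros tendsto_char_lattice)
  then have "(\<lambda>N. exp (- (1 - char (1 / real N) k) * ((real N)\<^sup>2 * t))) \<longlonglongrightarrow> exp (- rate k * t)"
    by (rule Lim_transform_eventually) (simp add: algebra_simps)
  then have m: "m \<longlonglongrightarrow> L"
    unfolding m_def L_def using \<rho>0(1) by (intro tendsto_mult riemann_sum torus_cont_mult mode_torus_cont)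
  have bound: "measure (M N) {\<omega> \<in> space (M N). \<epsilon> < \<bar>empirical_mean N (mode k a) (\<eta> N ((real N)\<^sup>2 * t) \<omega>) - L\<bar>} \<le> b N"
    if N: "0 < N" and close: "\<bar>m N - L\<bar> < \<epsilon> / 2" for N
  proof -
    let ?F = "empirical_mean N (mode k a)" and ?T = "(real N)\<^sup>2 * t"
    interpret chain: finite_markov_chain "configs N" "exclusion_generator p N" "local_equilibrium \<rho>0 N" "M N" "\<eta> N"
      by unfold_locales (auto simp: exclusion[OF N] finite_configs exclusion_generator_linear
          intro: exclusion_generator_local[OF N] set_local_equilibrium[THEN subsetD])
    have T: "0 \<le> ?T" using t by simp
    have l: "0 \<le> 1 - char (1 / real N) k" using abs_char_le[of "1 / real N" k] by (simp add: abs_le_iff)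
    note eigen = generator_empirical_mean[OF N, of k a]
    have mean: "chain.expectation (\<lambda>\<omega>. ?F (\<eta> N ?T \<omega>)) = m N"
      using chain.eigenfunction_expectation[of ?F "1 - char (1 / real N) k", OF _ T] eigen
      by (simp add: m_def expectation_empirical_mean[OF \<rho>0(2)])
    have "chain.variance (\<lambda>\<omega>. ?F (\<eta> N ?T \<omega>)) \<le> measure_pmf.variance (local_equilibrium \<rho>0 N) ?F
        + 2 * rate k / ((real N)\<^sup>2 * real N ^ CARD('d)) * ?T"
      by (rule chain.eigenfunction_variance[of _ "1 - char (1 / real N) k"])
        (use eigen generator_empirical_mean_square[OF N] T l rate_nonneg in auto)
    also have "\<dots> \<le> 1 / real N ^ CARD('d) + 2 * rate k / ((real N)\<^sup>2 * real N ^ CARD('d)) * ?T"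
      using variance_empirical_mean[OF \<rho>0(2) abs_mode_le N] by simp
    finally have var: "chain.variance (\<lambda>\<omega>. ?F (\<eta> N ?T \<omega>)) / (\<epsilon> / 2)\<^sup>2 \<le> b N"
      unfolding b_def by (intro divide_right_mono) auto
    have rv: "(\<lambda>\<omega>. ?F (\<eta> N ?T \<omega>)) \<in> borel_measurable (M N)"
      by (rule chain.borel_fun_X[OF T])
    have "measure (M N) {\<omega> \<in> space (M N). \<epsilon> < \<bar>?F (\<eta> N ?T \<omega>) - L\<bar>}
        \<le> measure (M N) {\<omega> \<in> space (M N). \<epsilon> / 2 \<le> \<bar>?F (\<eta> N ?T \<omega>) - m N\<bar>}"
    proof (rule chain.finite_measure_mono)
      show "{\<omega> \<in> space (M N). \<epsilon> < \<bar>?F (\<eta> N ?T \<omega>) - L\<bar>} \<subseteq> {\<omega> \<in> space (M N). \<epsilon> / 2 \<le> \<bar>?F (\<eta> N ?T \<omega>) - m N\<bar>}"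
        using close by safe linarith
      show "{\<omega> \<in> space (M N). \<epsilon> / 2 \<le> \<bar>?F (\<eta> N ?T \<omega>) - m N\<bar>} \<in> sets (M N)"
        using rv by measurable
    qed
    also have "\<dots> \<le> chain.variance (\<lambda>\<omega>. ?F (\<eta> N ?T \<omega>)) / (\<epsilon> / 2)\<^sup>2"
      using chain.Chebyshev_inequality[OF rv, of "\<epsilon> / 2"] chain.integrable_fun_X[OF T, of "\<lambda>\<xi>. (?F \<xi>)\<^sup>2"] \<epsilon>
      by (simp add: mean)
    finally show ?thesis using var by linarith
  qed
  have b0: "b \<longlonglongrightarrow> 0"
  proof -
    have inv: "(\<lambda>N. (1 / real N) ^ CARD('d)) \<longlonglongrightarrow> 0"
    proof -
      have "(\<lambda>N. (1 / real N) ^ CARD('d)) \<longlonglongrightarrow> 0 ^ CARD('d)"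
        by (intro tendsto_power lim_1_over_n)
      moreover have "(0 :: real) ^ CARD('d) = 0" by simp
      ultimately show ?thesis by (simp only:)
    qed
    have "(\<lambda>N. (1 + 2 * rate k * t) * (1 / real N) ^ CARD('d) / (\<epsilon> / 2)\<^sup>2) \<longlonglongrightarrow> (1 + 2 * rate k * t) * 0 / (\<epsilon> / 2)\<^sup>2"
      using \<epsilon> by (intro tendsto_divide tendsto_mult tendsto_const inv) auto
    then have "(\<lambda>N. (1 + 2 * rate k * t) * (1 / real N) ^ CARD('d) / (\<epsilon> / 2)\<^sup>2) \<longlonglongrightarrow> 0" by simp
    then show ?thesis
      by (rule Lim_transform_eventually)
        (auto intro!: eventually_mono[OF eventually_gt_at_top[of 0]] simp: b_def power_divide add_divide_distrib distrib_right)
  qed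
  have "\<forall>\<^sub>F N in sequentially. \<bar>m N - L\<bar> < \<epsilon> / 2"
    using tendstoD[OF m, of "\<epsilon> / 2"] \<epsilon> by (simp add: dist_real_def)
  then have "\<forall>\<^sub>F N in sequentially. norm (measure (M N) {\<omega> \<in> space (M N). \<epsilon> < \<bar>empirical_mean N (mode k a) (\<eta> N ((real N)\<^sup>2 * t) \<omega>) - L\<bar>}) \<le> b N"
    using eventually_gt_at_top[of 0] by eventually_elim (use bound in auto)
  then show ?thesis
    unfolding L_def[symmetric] using b0 by (rule Lim_null_comparison)
qed

end

subsection \<open>Convergence of the empirical measure\<close>

text \<open>A union bound in the limit. All conditions are asked at positive N, since nothing is
  known about \<open>M 0\<close> and limits ignore a single index.\<close>

lemma tendsto_measure_UN_null:
  fixes M :: "nat \<Rightarrow> 'w measure"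
  assumes "\<And>N. 0 < N \<Longrightarrow> prob_space (M N)" "finite I"
    and sub: "\<And>N. 0 < N \<Longrightarrow> A N \<subseteq> (\<Union>k\<in>I. B k N)"
    and meas: "\<And>k N. 0 < N \<Longrightarrow> B k N \<in> sets (M N)"
    and lim: "\<And>k. k \<in> I \<Longrightarrow> (\<lambda>N. measure (M N) (B k N)) \<longlonglongrightarrow> 0"
  shows "(\<lambda>N. measure (M N) (A N)) \<longlonglongrightarrow> 0"
proof (rule Lim_null_comparison)
  show "(\<lambda>N. \<Sum>k\<in>I. measure (M N) (B k N)) \<longlonglongrightarrow> 0"
    using lim by (rule tendsto_null_sum)
  show "\<forall>\<^sub>F N in sequentially. norm (measure (M N) (A N)) \<le> (\<Sum>k\<in>I. measure (M N) (B k N))"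
    using eventually_gt_at_top[of 0]
  proof eventually_elim
    case (elim N)
    interpret prob_space "M N" by (rule assms(1)[OF elim])
    have "measure (M N) (A N) \<le> measure (M N) (\<Union>k\<in>I. B k N)"
      using sub[OF elim] meas[OF elim] \<open>finite I\<close> by (intro finite_measure_mono) auto
    also have "\<dots> \<le> (\<Sum>k\<in>I. measure (M N) (B k N))"
      using meas[OF elim] \<open>finite I\<close> by (intro finite_measure_subadditive_finite) auto
    finally show ?case by simp
  qed
qed

text \<open>The state space carries all its subsets as measurable sets, so any condition on the
  state at one time is an event.\<close>

lemma markov_chain_event:
  assumes "markov_chain S A \<mu> M X" "0 \<le> t"
  shows "{\<omega> \<in> space M. P (X t \<omega>)} \<in> sets M"
proof -
  have X: "X t \<in> measurable M (count_space S)"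
    using assms by (simp add: markov_chain_def)
  have "X t -` {x \<in> S. P x} \<inter> space M \<in> sets M"
    by (rule measurable_sets[OF X]) auto
  moreover have "X t -` {x \<in> S. P x} \<inter> space M = {\<omega> \<in> space M. P (X t \<omega>)}"
    using measurable_space[OF X] by auto
  ultimately show ?thesis by simp
qed

lemma integral_empirical_measure:
  fixes f :: "real ^ 'd \<Rightarrow> real"
  assumes "f \<in> borel_measurable borel"
  shows "(\<integral>u. f u \<partial>empirical_measure N \<eta>) = empirical_mean N f \<eta>"
proof -
  let ?P = "point_measure (sites N) (\<lambda>x. ennreal (of_bool (\<eta> x) / real N ^ CARD('d)))"
  have "(\<integral>u. f u \<partial>empirical_measure N \<eta>) = (\<integral>x. f (point N x) \<partial>?P)"
    unfolding empirical_measure_def using assms by (intro integral_distr) auto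
  also have "\<dots> = (\<Sum>x\<in>sites N. of_bool (\<eta> x) / real N ^ CARD('d) * f (point N x))"
    by (subst lebesgue_integral_point_measure_finite) auto
  finally show ?thesis
    by (simp only: empirical_mean_def sum_divide_distrib times_divide_eq_left mult.commute[of "f _"])
qed

text \<open>Almost everywhere nonnegativity makes the truncation by \<open>ennreal\<close> invisible
  to the integral.\<close>

lemma integral_torus_density:
  fixes f r :: "real ^ 'd \<Rightarrow> real"
  assumes f: "f \<in> borel_measurable borel" and r: "r \<in> borel_measurable borel" and pos: "AE u in haar. 0 \<le> r u"
  shows "(\<integral>u. f u \<partial>torus_density r) = (\<integral>u. f u * r u \<partial>haar)"
proof -
  have "AE u in lborel. u \<in> unit_cube \<longrightarrow> 0 \<le> r u"
    using pos by (subst (asm) AE_restrict_space_iff) auto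
  then have nonneg: "AE u in lborel. 0 \<le> r u * indicator unit_cube u"
    by eventually_elim (simp add: indicator_def)
  have "torus_density r = density lborel (\<lambda>u. ennreal (r u * indicator unit_cube u))"
    unfolding torus_density_def by (intro arg_cong2[where f = density] refl ext) (simp add: indicator_def)
  then have "(\<integral>u. f u \<partial>torus_density r) = (\<integral>u. (r u * indicator unit_cube u) *\<^sub>R f u \<partial>lborel)"
    using f r nonneg by (simp add: integral_density)
  also have "\<dots> = (LINT u:unit_cube|lborel. f u * r u)"
    unfolding set_lebesgue_integral_def by (simp add: mult_ac)
  finally show ?thesis by (simp only: set_integral_unit_cube)
qed

text \<open>Each fraction is at most 1 and at most the difference itself. The weights start at k = 0
  and sum to 2, which gives 2 \<delta> for the first K terms and 2 (1/2)^K for the tail.\<close>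

lemma weak_dist_le:
  assumes "\<And>k. k < K \<Longrightarrow> \<bar>(\<integral>u. f k u \<partial>\<mu>) - (\<integral>u. f k u \<partial>\<nu>)\<bar> \<le> \<delta>" "0 \<le> \<delta>"
  shows "weak_dist f \<mu> \<nu> \<le> 2 * \<delta> + 2 * (1 / 2) ^ K"
proof -
  define x where "x k = \<bar>(\<integral>u. f k u \<partial>\<mu>) - (\<integral>u. f k u \<partial>\<nu>)\<bar>" for k
  define a where "a k = (1 / 2) ^ k * (x k / (1 + x k))" for k
  have x0: "0 \<le> x k" for k by (simp add: x_def)
  have frac: "0 \<le> x k / (1 + x k)" "x k / (1 + x k) \<le> 1" "x k / (1 + x k) \<le> x k" for k
    using x0[of k] by (auto simp: divide_le_eq mult_le_cancel_left1)
  have a1: "a k \<le> (1 / 2) ^ k" "0 \<le> a k" for k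
  proof -
    show "a k \<le> (1 / 2) ^ k"
      unfolding a_def by (rule order.trans[OF mult_left_mono[OF frac(2)]]) simp_all
    show "0 \<le> a k"
      unfolding a_def by (intro mult_nonneg_nonneg frac) simp
  qed
  have geo: "summable (\<lambda>k. (1 / 2 :: real) ^ k)" by (rule summable_geometric) simp
  have sum: "summable a"
    using a1 by (intro summable_comparison_test'[OF geo]) auto
  have "weak_dist f \<mu> \<nu> = suminf a"
    unfolding weak_dist_def a_def[abs_def] x_def ..
  also have "\<dots> = (\<Sum>k. a (k + K)) + (\<Sum>k<K. a k)" by (rule suminf_split_initial_segment[OF sum])
  also have "\<dots> \<le> 2 * (1 / 2) ^ K + 2 * \<delta>"
  proof (rule add_mono)
    have "(\<Sum>k. a (k + K)) \<le> (\<Sum>k. (1 / 2) ^ k * (1 / 2) ^ K)"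
      using a1[of "_ + K"] by (intro suminf_le summable_ignore_initial_segment[OF sum] summable_mult2 geo) (simp add: power_add[symmetric])
    also have "\<dots> = 2 * (1 / 2) ^ K"
      using suminf_mult2[OF geo, of "(1 / 2) ^ K"] suminf_geometric[of "1 / 2 :: real"] by simp
    finally show "(\<Sum>k. a (k + K)) \<le> 2 * (1 / 2) ^ K" .
    have "(\<Sum>k<K. a k) \<le> (\<Sum>k<K. (1 / 2) ^ k * \<delta>)"
    proof (rule sum_mono)
      fix k assume "k \<in> {..<K}"
      then have "x k \<le> \<delta>" using assms(1) by (simp add: x_def)
      then show "a k \<le> (1 / 2) ^ k * \<delta>"
        unfolding a_def using frac(3)[of k] by (intro mult_left_mono) auto
    qed
    also have "\<dots> = (\<Sum>k<K. (1 / 2) ^ k) * \<delta>" by (simp add: sum_distrib_right)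
    also have "\<dots> \<le> 2 * \<delta>"
      using sum_le_suminf[OF geo, of "{..<K}"] suminf_geometric[of "1 / 2 :: real"] assms(2)
      by (intro mult_right_mono) auto
    finally show "(\<Sum>k<K. a k) \<le> 2 * \<delta>" .
  qed
  finally show ?thesis by simp
qed

context symmetric_jump
begin

text \<open>From modes to sums by union bounds, then to continuous f by density, which works because
  both functionals are bounded in the sup norm uniformly in N.\<close>

lemma empirical_mean_converges:
  fixes M :: "nat \<Rightarrow> 'w measure"
  assumes \<rho>0: "\<rho>0 \<in> torus_cont" "\<And>u. \<rho>0 u \<in> {0..1}"
    and exclusion: "\<And>N. 0 < N \<Longrightarrow>
      markov_chain (configs N) (exclusion_generator p N) (local_equilibrium \<rho>0 N) (M N) (\<eta> N)"
    and \<sigma>: "bounded_weak_solution (covariance p) \<rho>0 \<sigma>" "\<sigma> t \<in> torus_cont"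
    and t: "0 \<le> t" and \<epsilon>: "0 < \<epsilon>" and f: "f \<in> torus_cont"
  shows "(\<lambda>N. measure (M N) {\<omega> \<in> space (M N).
      \<epsilon> < \<bar>empirical_mean N f (\<eta> N ((real N)\<^sup>2 * t) \<omega>) - (\<integral>u. f u * \<sigma> t u \<partial>haar)\<bar>}) \<longlonglongrightarrow> 0"
proof -
  define bad where "bad g \<epsilon> N = {\<omega> \<in> space (M N).
      \<epsilon> < \<bar>empirical_mean N g (\<eta> N ((real N)\<^sup>2 * t) \<omega>) - (\<integral>u. g u * \<sigma> t u \<partial>haar)\<bar>}" for g \<epsilon> N
  have prob: "prob_space (M N)" if "0 < N" for N
    using exclusion[OF that] by (simp add: markov_chain_def)
  have meas: "bad g \<epsilon> N \<in> sets (M N)" if "0 < N" for g \<epsilon> N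
    unfolding bad_def by (rule markov_chain_event[OF exclusion[OF that]]) (use t in simp)
  have trig: "q \<in> torus_cont \<and> (\<forall>\<epsilon>>0. (\<lambda>N. measure (M N) (bad q \<epsilon> N)) \<longlonglongrightarrow> 0)" if "trig_poly q" for q
    using that
  proof (induction rule: trig_poly.induct)
    case (trig_mode c k a)
    have "(\<lambda>N. measure (M N) (bad (\<lambda>u. c * mode k a u) \<epsilon> N)) \<longlonglongrightarrow> 0" if "0 < \<epsilon>" for \<epsilon>
    \<comment> \<open>A single covering event. The threshold uses |c| + 1 rather than |c| so that c
      = 0 needs no separate case.\<close>
    proof (rule tendsto_measure_UN_null[OF prob, where I = "{()}" and B = "\<lambda>_ N. bad (mode k a) (\<epsilon> / (\<bar>c\<bar> + 1)) N"])
      fix N :: nat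
      show "bad (\<lambda>u. c * mode k a u) \<epsilon> N \<subseteq> (\<Union>_\<in>{()}. bad (mode k a) (\<epsilon> / (\<bar>c\<bar> + 1)) N)"
      proof
        fix \<omega> assume \<omega>: "\<omega> \<in> bad (\<lambda>u. c * mode k a u) \<epsilon> N"
        let ?d = "empirical_mean N (mode k a) (\<eta> N ((real N)\<^sup>2 * t) \<omega>) - (\<integral>u. mode k a u * \<sigma> t u \<partial>haar)"
        have "empirical_mean N (\<lambda>u. c * mode k a u) (\<eta> N ((real N)\<^sup>2 * t) \<omega>) - (\<integral>u. c * mode k a u * \<sigma> t u \<partial>haar) = c * ?d"
          by (simp only: empirical_mean_def mult.assoc sum_distrib_left[symmetric] integral_mult_right_zero right_diff_distrib times_divide_eq_right)
        then have "\<epsilon> < \<bar>c\<bar> * \<bar>?d\<bar>" using \<omega> by (simp add: bad_def abs_mult)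
        also have "\<dots> \<le> (\<bar>c\<bar> + 1) * \<bar>?d\<bar>" by (intro mult_right_mono) auto
        finally have "\<epsilon> < \<bar>?d\<bar> * (\<bar>c\<bar> + 1)" by (simp only: mult.commute)
        moreover have "0 < \<bar>c\<bar> + 1" by linarith
        ultimately have "\<epsilon> / (\<bar>c\<bar> + 1) < \<bar>?d\<bar>" by (simp only: pos_divide_less_eq)
        then show "\<omega> \<in> (\<Union>_\<in>{()}. bad (mode k a) (\<epsilon> / (\<bar>c\<bar> + 1)) N)"
          using \<omega> by (simp add: bad_def)
      qed
    next
      have "0 < \<epsilon> / (\<bar>c\<bar> + 1)" using that by (intro divide_pos_pos) auto
      from empirical_mean_mode_converges[OF \<rho>0 exclusion t this, of k a]
      show "(\<lambda>N. measure (M N) (bad (mode k a) (\<epsilon> / (\<bar>c\<bar> + 1)) N)) \<longlonglongrightarrow> 0"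
        unfolding bad_def weak_solution_mode[OF \<sigma>(1) t] .
    qed (use meas in auto)
    then show ?case by (auto intro: torus_cont_mult)
  next
    case (trig_add g h)
    then have gh: "g \<in> torus_cont" "h \<in> torus_cont" by auto
    have "(\<lambda>N. measure (M N) (bad (\<lambda>u. g u + h u) \<epsilon> N)) \<longlonglongrightarrow> 0" if "0 < \<epsilon>" for \<epsilon>
    \<comment> \<open>The Booleans index the two summands: a deviation above \<epsilon> of the sum
      forces one above \<epsilon>/2 in a summand.\<close>
    proof (rule tendsto_measure_UN_null[OF prob, where I = UNIV and B = "\<lambda>b N. bad (if b then g else h) (\<epsilon> / 2) N"])
      fix N :: nat
      show "bad (\<lambda>u. g u + h u) \<epsilon> N \<subseteq> (\<Union>b\<in>UNIV. bad (if b then g else h) (\<epsilon> / 2) N)"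
      proof
        fix \<omega> assume \<omega>: "\<omega> \<in> bad (\<lambda>u. g u + h u) \<epsilon> N"
        let ?d = "\<lambda>g. empirical_mean N g (\<eta> N ((real N)\<^sup>2 * t) \<omega>) - (\<integral>u. g u * \<sigma> t u \<partial>haar)"
        have "(\<integral>u. (g u + h u) * \<sigma> t u \<partial>haar) = (\<integral>u. g u * \<sigma> t u \<partial>haar) + (\<integral>u. h u * \<sigma> t u \<partial>haar)"
          using gh \<sigma>(2) by (simp add: distrib_right haar_integrable torus_cont_mult)
        then have "?d (\<lambda>u. g u + h u) = ?d g + ?d h"
          by (simp add: empirical_mean_def distrib_right sum.distrib add_divide_distrib del: sum_mult_of_bool_eq)
        then have "\<epsilon> < \<bar>?d g + ?d h\<bar>" using \<omega> by (simp add: bad_def)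
        then have "\<epsilon> / 2 < \<bar>?d g\<bar> \<or> \<epsilon> / 2 < \<bar>?d h\<bar>" by linarith
        moreover have "\<omega> \<in> space (M N)" using \<omega> by (simp add: bad_def)
        ultimately have "\<omega> \<in> bad g (\<epsilon> / 2) N \<or> \<omega> \<in> bad h (\<epsilon> / 2) N" by (simp add: bad_def)
        then show "\<omega> \<in> (\<Union>b\<in>UNIV. bad (if b then g else h) (\<epsilon> / 2) N)" by (auto simp: UNIV_bool)
      qed
    next
      show "(\<lambda>N. measure (M N) (bad (if b then g else h) (\<epsilon> / 2) N)) \<longlonglongrightarrow> 0" for b
        using trig_add.IH that by (cases b) auto
    qed (use meas in auto)
    then show ?case using gh by (auto intro: torus_cont_add)
  qed
  obtain B where B: "0 \<le> B" "\<And>u. \<bar>\<sigma> t u\<bar> \<le> B"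
    using torus_cont_bounded[OF \<sigma>(2)] by blast
  \<comment> \<open>Replacing f by q costs \<delta> in the empirical mean, whose total mass is at
    most 1, and \<delta> B in the limit integral; together exactly \<epsilon>/2.\<close>
  define \<delta> where "\<delta> = \<epsilon> / (2 * (1 + B))"
  have \<delta>: "0 < \<delta>" "\<delta> * (1 + B) = \<epsilon> / 2" using \<epsilon> B(1) by (auto simp: \<delta>_def field_simps)
  obtain q where q: "trig_poly q" "\<And>u. \<bar>f u - q u\<bar> < \<delta>"
    using trig_poly_dense[OF f \<delta>(1)] by blast
  have qt: "q \<in> torus_cont" using trig[OF q(1)] by blast
  have "(\<lambda>N. measure (M N) (bad f \<epsilon> N)) \<longlonglongrightarrow> 0"
  proof (rule tendsto_measure_UN_null[OF prob, where I = "{()}" and B = "\<lambda>_ N. bad q (\<epsilon> / 2) N"])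
    fix N :: nat assume N: "0 < N"
    have emp: "\<bar>empirical_mean N f \<xi> - empirical_mean N q \<xi>\<bar> \<le> \<delta>" for \<xi>
    proof -
      let ?D = "real N ^ CARD('d)"
      have "empirical_mean N f \<xi> - empirical_mean N q \<xi> = (\<Sum>x\<in>sites N. (f (point N x) - q (point N x)) * of_bool (\<xi> x)) / ?D"
        by (simp only: empirical_mean_def left_diff_distrib sum_subtractf diff_divide_distrib)
      also have "\<bar>\<dots>\<bar> \<le> (\<Sum>x\<in>(sites N :: (int ^ 'd) set). \<delta>) / ?D"
        unfolding abs_divide
      proof (intro frac_le order.trans[OF sum_abs] sum_mono)
        show "\<bar>(f (point N x) - q (point N x)) * of_bool (\<xi> x)\<bar> \<le> \<delta>" for x
          using q(2)[of "point N x"] \<delta>(1) by (cases "\<xi> x") auto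
      qed (use N \<delta>(1) in auto)
      also have "\<dots> = \<delta>" using card_sites[OF N, where ?'d = 'd] N by simp
      finally show ?thesis .
    qed
    have int: "\<bar>(\<integral>u. f u * \<sigma> t u \<partial>haar) - (\<integral>u. q u * \<sigma> t u \<partial>haar)\<bar> \<le> \<delta> * B"
    proof -
      have "(\<integral>u. f u * \<sigma> t u \<partial>haar) - (\<integral>u. q u * \<sigma> t u \<partial>haar) = (\<integral>u. (f u - q u) * \<sigma> t u \<partial>haar)"
        using f qt \<sigma>(2) by (simp add: left_diff_distrib haar_integrable torus_cont_mult)
      also have "\<bar>\<dots>\<bar> \<le> (\<integral>u. \<bar>(f u - q u) * \<sigma> t u\<bar> \<partial>haar)"
        by (rule integral_abs_bound)
      also have "\<dots> \<le> (\<integral>u. \<delta> * B \<partial>(haar :: (real ^ 'd) measure))"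
      proof (rule Bochner_Integration.integral_mono)
        show "integrable haar (\<lambda>u. \<bar>(f u - q u) * \<sigma> t u\<bar>)"
          by (intro integrable_abs haar_integrable torus_cont_mult torus_cont_diff f qt \<sigma>(2))
        show "\<bar>(f u - q u) * \<sigma> t u\<bar> \<le> \<delta> * B" for u
          unfolding abs_mult using q(2)[of u] B \<delta>(1) by (intro mult_mono) auto
      qed simp
      finally show ?thesis using haar.prob_space[where ?'a = 'd] by simp
    qed
    show "bad f \<epsilon> N \<subseteq> (\<Union>_\<in>{()}. bad q (\<epsilon> / 2) N)"
    proof
      fix \<omega> assume \<omega>: "\<omega> \<in> bad f \<epsilon> N"
      let ?\<xi> = "\<eta> N ((real N)\<^sup>2 * t) \<omega>"
      have "\<epsilon> < \<bar>empirical_mean N f ?\<xi> - (\<integral>u. f u * \<sigma> t u \<partial>haar)\<bar>" using \<omega> by (simp add: bad_def)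
      moreover have "\<delta> + \<delta> * B = \<epsilon> / 2" using \<delta>(2) by (simp add: distrib_left)
      ultimately have "\<epsilon> / 2 < \<bar>empirical_mean N q ?\<xi> - (\<integral>u. q u * \<sigma> t u \<partial>haar)\<bar>"
        using emp[of ?\<xi>] int by linarith
      then show "\<omega> \<in> (\<Union>_\<in>{()}. bad q (\<epsilon> / 2) N)" using \<omega> by (simp add: bad_def)
    qed
  qed (use meas trig[OF q(1)] \<epsilon> in auto)
  then show ?thesis by (simp add: bad_def)
qed

end

lemma finite_integer_ball: "finite {z :: int ^ 'd. norm (real_vec z) \<le> R}"
proof -
  have "z $ i \<in> {- \<lceil>R\<rceil>..\<lceil>R\<rceil>}" if "norm (real_vec z) \<le> R" for z :: "int ^ 'd" and i
  proof -
    have "\<bar>real_of_int (z $ i)\<bar> \<le> R"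
      using component_le_norm_cart[of "real_vec z" i] that by simp
    then have "real_of_int (z $ i) \<le> real_of_int \<lceil>R\<rceil>" "real_of_int (- \<lceil>R\<rceil>) \<le> real_of_int (z $ i)"
      using le_of_int_ceiling[of R] by (smt (verit) of_int_minus)+
    then show ?thesis unfolding of_int_le_iff by simp
  qed
  then show ?thesis
    by (intro finite_subset[OF _ finite_int_box[of "- \<lceil>R\<rceil>" "\<lceil>R\<rceil>"]]) blast
qed

text \<open>Convergence is claimed for every bounded weak solution, and existence is included so
  that the claim has content. The proof works with the continuous solution \<sigma> and transfers
  the limit by almost sure equality at each time.\<close>

theorem theorem3p1p1:
  fixes p :: "(int ^ 'd::finite) pmf"
    and \<rho>\<^sub>0 :: "real ^ 'd \<Rightarrow> real"
    and M :: "nat \<Rightarrow> 'w measure"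
    and \<eta> :: "nat \<Rightarrow> real \<Rightarrow> 'w \<Rightarrow> (int ^ 'd \<Rightarrow> bool)"
    and f :: "nat \<Rightarrow> real ^ 'd \<Rightarrow> real"
  assumes symmetric: "\<And>z. pmf p (- z) = pmf p z"
    and finite_range: "\<exists>R. \<forall>z. norm (real_vec z) > R \<longrightarrow> pmf p z = 0"
    and profile: "\<rho>\<^sub>0 \<in> torus_cont" "\<And>u. \<rho>\<^sub>0 u \<in> {0..1}"
    and exclusion: "\<And>N. 0 < N \<Longrightarrow>
      markov_chain (configs N) (exclusion_generator p N) (local_equilibrium \<rho>\<^sub>0 N) (M N) (\<eta> N)"
    and metric: "dense_family f"
  shows "(\<exists>\<rho>. bounded_weak_solution (covariance p) \<rho>\<^sub>0 \<rho>) \<and>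
    (\<forall>\<rho>. bounded_weak_solution (covariance p) \<rho>\<^sub>0 \<rho> \<longrightarrow>
      (\<forall>t\<ge>0. converges_in_probability (weak_dist f) M
         (\<lambda>N \<omega>. empirical_measure N (\<eta> N ((real N)\<^sup>2 * t) \<omega>))
         (torus_density (\<rho> t))))"
proof -
  obtain R where R: "\<And>z. norm (real_vec z) > R \<Longrightarrow> pmf p z = 0"
    using finite_range by blast
  have "set_pmf p \<subseteq> {z. norm (real_vec z) \<le> R}"
    using R by (auto simp: set_pmf_iff) (meson not_le)
  then interpret symmetric_jump p
    using symmetric finite_subset[OF _ finite_integer_ball] by unfold_locales auto
  obtain \<sigma> where \<sigma>: "bounded_weak_solution (covariance p) \<rho>\<^sub>0 \<sigma>"
    "\<And>t. 0 \<le> t \<Longrightarrow> \<sigma> t \<in> torus_cont"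
    "\<And>t u. 0 \<le> t \<Longrightarrow> (\<And>v. 0 \<le> \<rho>\<^sub>0 v) \<Longrightarrow> 0 \<le> \<sigma> t u"
    using bounded_weak_solution_exists[OF profile(1)] by blast
  have prob: "prob_space (M N)" if "0 < N" for N
    using exclusion[OF that] by (simp add: markov_chain_def)
  have f_cont: "f k \<in> torus_cont" for k
    using metric by (simp add: dense_family_def)
  have f_borel: "f k \<in> borel_measurable borel" for k
    using f_cont by (rule torus_cont_measurable)
  have "converges_in_probability (weak_dist f) M
      (\<lambda>N \<omega>. empirical_measure N (\<eta> N ((real N)\<^sup>2 * t) \<omega>)) (torus_density (\<rho> t))"
    if \<rho>: "bounded_weak_solution (covariance p) \<rho>\<^sub>0 \<rho>" and t: "0 \<le> t" for \<rho> t
    unfolding converges_in_probability_def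
  proof (intro allI impI)
    fix \<epsilon> :: real assume \<epsilon>: "0 < \<epsilon>"
    have AE: "AE u in haar. \<rho> t u = \<sigma> t u"
      using weak_solution_unique[OF \<rho> \<sigma>(1) t] .
    have \<rho>_borel: "\<rho> t \<in> borel_measurable borel"
      using weak_solution_borel[OF \<rho> t] .
    have \<sigma>_borel: "\<sigma> t \<in> borel_measurable borel"
      using \<sigma>(2)[OF t] by (rule torus_cont_measurable)
    \<comment> \<open>An arbitrary solution may be negative on a null set; its density measure still
      integrates correctly.\<close>
    have nonneg: "AE u in haar. 0 \<le> \<rho> t u"
      using AE by eventually_elim (use \<sigma>(3)[OF t] profile(2) in auto)
    have limit: "(\<integral>u. f k u \<partial>torus_density (\<rho> t)) = (\<integral>u. f k u * \<sigma> t u \<partial>haar)" for k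
    proof -
      have "(\<integral>u. f k u * \<rho> t u \<partial>haar) = (\<integral>u. f k u * \<sigma> t u \<partial>haar)"
        using AE by (intro integral_cong_AE haar_measurable borel_measurable_times f_borel \<rho>_borel \<sigma>_borel)
          (auto elim: eventually_mono)
      then show ?thesis using integral_torus_density[OF f_borel \<rho>_borel nonneg] by simp
    qed
    have "(\<lambda>n. 2 * (1 / 2 :: real) ^ n) \<longlonglongrightarrow> 2 * 0"
      by (intro tendsto_mult tendsto_const LIMSEQ_power_zero) simp
    from order_tendstoD(2)[OF this, of "\<epsilon> / 2"] have "\<forall>\<^sub>F n in sequentially. 2 * (1 / 2 :: real) ^ n < \<epsilon> / 2"
      using \<epsilon> by simp
    \<comment> \<open>The tail of the metric costs less than \<epsilon>/2, and deviations of at most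
      \<epsilon>/4 in the first K functions cost at most 2 (\<epsilon>/4), so the distance exceeds
      \<epsilon> only if one of these K deviations exceeds \<epsilon>/4.\<close>
    then obtain K where K: "2 * (1 / 2 :: real) ^ K < \<epsilon> / 2"
      by (auto simp: eventually_sequentially)
    define B where "B k N = {\<omega> \<in> space (M N).
      \<epsilon> / 4 < \<bar>empirical_mean N (f k) (\<eta> N ((real N)\<^sup>2 * t) \<omega>) - (\<integral>u. f k u * \<sigma> t u \<partial>haar)\<bar>}" for k N
    show "(\<lambda>N. measure (M N) {\<omega> \<in> space (M N).
      \<epsilon> < weak_dist f (empirical_measure N (\<eta> N ((real N)\<^sup>2 * t) \<omega>)) (torus_density (\<rho> t))}) \<longlonglongrightarrow> 0"
    proof (rule tendsto_measure_UN_null[OF prob, where I = "{..<K}" and B = B])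
      fix N :: nat
      show "{\<omega> \<in> space (M N). \<epsilon> < weak_dist f (empirical_measure N (\<eta> N ((real N)\<^sup>2 * t) \<omega>)) (torus_density (\<rho> t))}
        \<subseteq> (\<Union>k\<in>{..<K}. B k N)"
      proof (rule subsetI, rule ccontr)
        fix \<omega>
        let ?\<xi> = "\<eta> N ((real N)\<^sup>2 * t) \<omega>"
        assume \<omega>: "\<omega> \<in> {\<omega> \<in> space (M N). \<epsilon> < weak_dist f (empirical_measure N (\<eta> N ((real N)\<^sup>2 * t) \<omega>)) (torus_density (\<rho> t))}"
          and "\<omega> \<notin> (\<Union>k\<in>{..<K}. B k N)"
        then have "\<bar>(\<integral>u. f k u \<partial>empirical_measure N ?\<xi>) - (\<integral>u. f k u \<partial>torus_density (\<rho> t))\<bar> \<le> \<epsilon> / 4" if "k < K" for k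
          using that unfolding limit integral_empirical_measure[OF f_borel] by (auto simp: B_def not_less)
        then have "weak_dist f (empirical_measure N ?\<xi>) (torus_density (\<rho> t)) \<le> 2 * (\<epsilon> / 4) + 2 * (1 / 2) ^ K"
          using \<epsilon> by (intro weak_dist_le) auto
        then show False using \<omega> K by simp
      qed
    next
      show "B k N \<in> sets (M N)" if "0 < N" for k N
        unfolding B_def by (rule markov_chain_event[OF exclusion[OF that]]) (use t in simp)
      show "(\<lambda>N. measure (M N) (B k N)) \<longlonglongrightarrow> 0" for k
        unfolding B_def using \<epsilon>
        by (intro empirical_mean_converges[OF profile exclusion \<sigma>(1) \<sigma>(2)[OF t] t _ f_cont]) auto
    qed simp_all
  qed
  then show ?thesis using \<sigma>(1) by blast
qed

end
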